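(* For every tree poset $P$ of height $k\geq2$ and every $\varepsilon>0$, there exists a constant $K=K(\varepsilon,P)>0$ such that for every sufficiently large $n$ there is a fingerprint $(\mathcal{T},g,C)$ of $\mathcal{G}_P$ satisfying: (a) every $T\in\mathcal{T}$ satisfies $|\widehat{T}|\le\frac{K}{n}\binom{n}{\lfloor n/2\rfloor}$; (b) for each $s$, the number of $T\in\mathcal{T}$ with $|\widehat{T}|=s$ is at most $\left(\frac{K\binom{n}{\lfloor n/2\rfloor}}{s}\right)^s\exp\left(\frac{K}{n}\binom{n}{\lfloor n/2\rfloor}\right)$; (c) $|C(g(I))|\le(k-1+\varepsilon)\binom{n}{\lfloor n/2\rfloor}$ for every independent set $I$ of $\mathcal{G}_P$.
   Context: $\mathcal{B}_n$ is the family of all subsets of $[n]$. A tree poset is a finite poset whose Hasse diagram is a tree; height is the largest number of elements in a chain. $\mathcal{G}_P$ is the $|P|$-uniform hypergraph on vertex set $\mathcal{B}_n$ whose edges are the $|P|$-element subfamilies inducing (under inclusion) a poset isomorphic to $P$; $\mathcal{I}(\mathcal{G}_P)$ is its set of independent sets. A fingerprint of $\mathcal{G}_P$ is a triple $(\mathcal{T},g,C)$ where: $\mathcal{T}$ is a collection of vectors $T=(T_1,\dots,T_m)$ of pairwise disjoint subsets of $\mathcal{B}_n$ (with $m$ allowed to vary), and $\widehat{T}=\bigcup_iT_i$; $g:\mathcal{I}(\mathcal{G}_P)\to\mathcal{T}$ satisfies $\widehat{g(I)}\subseteq I$ for every $I$; and $C:\mathcal{T}\to2^{\mathcal{B}_n}$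 satisfies $I\subseteq C(g(I))$ for every $I\in\mathcal{I}(\mathcal{G}_P)$. *)

theory Defs
  imports Complex_Main
begin

text \<open>A finite poset is given by a carrier X and a relation le that is a partial order on X.\<close>
definition poset_on :: "'a set \<Rightarrow> ('a \<Rightarrow> 'a \<Rightarrow> bool) \<Rightarrow> bool" where
  "poset_on X le \<longleftrightarrow> finite X \<and>
     (\<forall>x\<in>X. le x x) \<and>
     (\<forall>x\<in>X. \<forall>y\<in>X. le x y \<and> le y x \<longrightarrow> x = y) \<and>
     (\<forall>x\<in>X. \<forall>y\<in>X. \<forall>z\<in>X. le x y \<and> le y z \<longrightarrow> le x z)"

text \<open>Cover relation (edges of the Hasse diagram).\<close>
definition covers :: "'a set \<Rightarrow> ('a \<Rightarrow> 'a \<Rightarrow> bool) \<Rightarrow> 'a \<Rightarrow> 'a \<Rightarrow> bool" where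
  "covers X le x y \<longleftrightarrow> x \<in> X \<and> y \<in> X \<and> le x y \<and> x \<noteq> y \<and>
     \<not> (\<exists>z\<in>X. le x z \<and> le z y \<and> z \<noteq> x \<and> z \<noteq> y)"

definition hasse_edges :: "'a set \<Rightarrow> ('a \<Rightarrow> 'a \<Rightarrow> bool) \<Rightarrow> 'a set set" where
  "hasse_edges X le = {{x, y} | x y. covers X le x y}"

text \<open>The Hasse diagram (as an undirected graph on X) is a tree:
  connected and with |X| - 1 edges.\<close>
definition tree_poset :: "'a set \<Rightarrow> ('a \<Rightarrow> 'a \<Rightarrow> bool) \<Rightarrow> bool" where
  "tree_poset X le \<longleftrightarrow> poset_on X le \<and> X \<noteq> {} \<and>
     (\<forall>x\<in>X. \<forall>y\<in>X. (x, y) \<in> (\<Union>e\<in>hasse_edges X le. {(u, v). u \<in> e \<and> v \<in> e})\<^sup>*) \<and>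
     card (hasse_edges X le) = card X - 1"

definition is_chain :: "'a set \<Rightarrow> ('a \<Rightarrow> 'a \<Rightarrow> bool) \<Rightarrow> 'a set \<Rightarrow> bool" where
  "is_chain X le C \<longleftrightarrow> C \<subseteq> X \<and> (\<forall>x\<in>C. \<forall>y\<in>C. le x y \<or> le y x)"

text \<open>Height: largest number of elements in a chain.\<close>
definition poset_height :: "'a set \<Rightarrow> ('a \<Rightarrow> 'a \<Rightarrow> bool) \<Rightarrow> nat" where
  "poset_height X le = Max (card ` {C. is_chain X le C})"

text \<open>The Boolean lattice B_n: all subsets of [n] = {1..n}.\<close>
definition boolean_lattice :: "nat \<Rightarrow> nat set set" where
  "boolean_lattice n = Pow {1..n}"

text \<open>Edges of G_P: subfamilies of B_n that, under inclusion, induce a poset isomorphic to P.\<close>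
definition copy_of :: "'a set \<Rightarrow> ('a \<Rightarrow> 'a \<Rightarrow> bool) \<Rightarrow> nat \<Rightarrow> nat set set \<Rightarrow> bool" where
  "copy_of X le n F \<longleftrightarrow> F \<subseteq> boolean_lattice n \<and> card F = card X \<and>
     (\<exists>f. bij_betw f X F \<and> (\<forall>x\<in>X. \<forall>y\<in>X. le x y \<longleftrightarrow> f x \<subseteq> f y))"

text \<open>Independent sets of G_P.\<close>
definition indep_sets :: "'a set \<Rightarrow> ('a \<Rightarrow> 'a \<Rightarrow> bool) \<Rightarrow> nat \<Rightarrow> nat set set set" where
  "indep_sets X le n = {I. I \<subseteq> boolean_lattice n \<and> \<not> (\<exists>F\<subseteq>I. copy_of X le n F)}"

text \<open>A vector of pairwise disjoint subsets of B_n, and its union.\<close>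
definition disj_vector :: "nat \<Rightarrow> nat set set list \<Rightarrow> bool" where
  "disj_vector n T \<longleftrightarrow> (\<forall>i<length T. T ! i \<subseteq> boolean_lattice n) \<and>
     (\<forall>i<length T. \<forall>j<length T. i \<noteq> j \<longrightarrow> T ! i \<inter> T ! j = {})"

definition vec_union :: "nat set set list \<Rightarrow> nat set set" where
  "vec_union T = \<Union> (set T)"

text \<open>Fingerprint (calT, g, C) of G_P.\<close>
definition fingerprint ::
  "'a set \<Rightarrow> ('a \<Rightarrow> 'a \<Rightarrow> bool) \<Rightarrow> nat \<Rightarrow> nat set set list set \<Rightarrow>
   (nat set set \<Rightarrow> nat set set list) \<Rightarrow> (nat set set list \<Rightarrow> nat set set) \<Rightarrow> bool" where
  "fingerprint X le n calT g C \<longleftrightarrow>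
     (\<forall>T\<in>calT. disj_vector n T) \<and>
     (\<forall>T\<in>calT. C T \<subseteq> boolean_lattice n) \<and>
     (\<forall>I\<in>indep_sets X le n. g I \<in> calT \<and> vec_union (g I) \<subseteq> I \<and> I \<subseteq> C (g I))"

end

theory Submission
  imports Defs "HOL-Library.FuncSet" "HOL-Combinatorics.Multiset_Permutations" "HOL-Real_Asymp.Real_Asymp"
begin

text \<open>Measure families by their Lubell weight \<open>\<Sum>x. 1 / (n choose |x|)\<close>, the expected number of members on a
  random maximal chain.  If a family of middle layers has weight above \<open>g(k - 1) + \<epsilon>\<close>, then on average many
  chains carry \<open>k\<close> members that are \<open>g\<close> apart on the list of members met by the chain; after deleting members
  with too few such windows, the chains give a reversible transition kernel along which the tree is embedded
  leaf by leaf.  In the middle layers a random chain rarely creates an unwanted comparability, so most of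
  these embeddings are induced, and no set of images is hit too often: each image beyond the first costs a
  factor \<open>\<tau> = O(n)\<^sup>-\<^sup>g\<close>.

  Such a balanced measure on copies yields a container step: an independent set in the family is encoded by
  boundedly many subsets of weight \<open>O(\<tau>)\<close> times that of the family, and the encoding determines a container
  losing a constant fraction of the weight.  Iterating with \<open>g = 5\<close> brings the weight from \<open>n + 1\<close> to a constant,
  at the cost of fingerprints of relative size \<open>O(n\<^sup>-\<^sup>4)\<close> only; a bounded number of further steps with \<open>g = 1\<close>
  then reaches \<open>k - 1 + \<epsilon>\<close> with fingerprints of relative size \<open>O(1/n)\<close>.\<close>

text \<open>The count in (b) shapes the proof. Its base is a constant times
  \<open>(n choose (n div 2)) / s\<close>, so the main part of a fingerprint has to be chosen inside
  a family of size \<open>O(n choose (n div 2))\<close>, whereas B_n is larger by a factor of order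
  sqrt n. What is chosen from all of B_n costs up to about n bits per element and must fit into the
  factor exp(K/n (n choose (n div 2))). With gap 1 from the start, the bound \<open>O(1/n)\<close>
  times the weight allows an entry as large as a constant times the middle layer, which is far too
  expensive.

  A gap g helps because two entries of a window then lie at least g levels apart, so a random chain
  through one of them meets the other with probability at most about
  \<open>1 / (m choose g)\<close>, where m has order n. The price is the threshold g(k - 1) in place
  of k - 1. Hence a large gap can only lower the weight to a constant, but this already provides the
  small ground family in which gap 1 may finish.

  Middle layers enter because the embedding must be induced: the chance that a chain picks up a
  prescribed unwanted comparability is bounded by the ratio of the number of layers used to
  n.\<close>

section \<open>Containers from balanced measures\<close>

text \<open>Hyperedges are encoded as ordered tuples, functions on \<open>{..<r}\<close>; the bound on the mass of the tuples with
  prescribed entries at \<open>J\<close> charges the entry of least index.\<close>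
definition capped :: "nat \<Rightarrow> ('v \<Rightarrow> real) \<Rightarrow> real \<Rightarrow> (nat \<Rightarrow> 'v) set \<Rightarrow> ((nat \<Rightarrow> 'v) \<Rightarrow> real) \<Rightarrow> bool" where
  "capped r p \<tau> H \<mu> \<longleftrightarrow> (\<forall>f. 0 \<le> \<mu> f) \<and>
     (\<forall>J b. J \<subseteq> {..<r} \<and> J \<noteq> {} \<longrightarrow>
        (\<Sum>f | f \<in> H \<and> restrict f J = b. \<mu> f) \<le> p (b (Min J)) * \<tau> ^ (card J - 1))"

definition link :: "nat \<Rightarrow> (nat \<Rightarrow> 'v) set \<Rightarrow> 'v set \<Rightarrow> (nat \<Rightarrow> 'v) set" where
  "link r H T = (\<lambda>f. restrict f {..<r}) ` {f \<in> H. f r \<in> T}"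

text \<open>The potential of the container step. Taking a supremum over all capped measures makes it
  a function of the link alone, so a container defined through it can be recovered from
  \<open>T\<close>.\<close>

definition link_cap :: "nat \<Rightarrow> ('v \<Rightarrow> real) \<Rightarrow> real \<Rightarrow> (nat \<Rightarrow> 'v) set \<Rightarrow> real" where
  "link_cap r p \<tau> H = Sup {sum \<mu> H | \<mu>. capped r p \<tau> H \<mu>}"

lemma cappedD:
  "capped r p \<tau> H \<mu> \<Longrightarrow> J \<subseteq> {..<r} \<Longrightarrow> J \<noteq> {} \<Longrightarrow>
     (\<Sum>f | f \<in> H \<and> restrict f J = b. \<mu> f) \<le> p (b (Min J)) * \<tau> ^ (card J - 1)"
  "capped r p \<tau> H \<mu> \<Longrightarrow> 0 \<le> \<mu> f"
  by (auto simp: capped_def)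

lemma capped_mass_le:
  assumes "capped r p \<tau> H \<mu>" "0 < r" "finite H"
  shows "sum \<mu> H \<le> sum p ((\<lambda>f. f 0) ` H)"
proof -
  have "sum \<mu> H = (\<Sum>x\<in>(\<lambda>f. f 0) ` H. \<Sum>f | f \<in> H \<and> f 0 = x. \<mu> f)"
    using assms(3) by (rule sum.image_gen)
  also have "\<dots> \<le> sum p ((\<lambda>f. f 0) ` H)"
  proof (rule sum_mono)
    fix x
    have eq: "(restrict f {0::nat} = restrict (\<lambda>_. x) {0}) = (f 0 = x)" for f :: "nat \<Rightarrow> 'a"
      by (auto simp: restrict_def fun_eq_iff)
    show "(\<Sum>f | f \<in> H \<and> f 0 = x. \<mu> f) \<le> p x"
      using cappedD(1)[OF assms(1), of "{0}" "restrict (\<lambda>_. x) {0}"] assms(2)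
      by (simp add: eq)
  qed
  finally show ?thesis .
qed

lemma capped_mass_le_total:
  assumes "capped r p \<tau> H \<mu>" "0 < r" "finite F" "H \<subseteq> {..<r} \<rightarrow>\<^sub>E F" "\<And>x. 0 \<le> p x"
  shows "sum \<mu> H \<le> sum p F"
proof -
  have fin: "finite H" by (rule finite_subset[OF assms(4)]) (use assms(3) in \<open>auto intro!: finite_PiE\<close>)
  have "sum \<mu> H \<le> sum p ((\<lambda>f. f 0) ` H)" by (rule capped_mass_le[OF assms(1,2) fin])
  also have "\<dots> \<le> sum p F"
    using assms(2-5) by (intro sum_mono2) auto
  finally show ?thesis .
qed

lemma capped_zero: "(\<And>x. 0 \<le> p x) \<Longrightarrow> 0 \<le> \<tau> \<Longrightarrow> capped r p \<tau> H (\<lambda>_. 0)"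
  by (auto simp: capped_def)

lemma link_cap_upper:
  assumes "capped r p \<tau> H \<mu>" "0 < r" "finite F" "H \<subseteq> {..<r} \<rightarrow>\<^sub>E F" "\<And>x. 0 \<le> p x"
  shows "sum \<mu> H \<le> link_cap r p \<tau> H"
  unfolding link_cap_def
  by (rule cSup_upper) (use assms capped_mass_le_total[OF _ assms(2-5)] in \<open>auto intro!: bdd_aboveI\<close>)

lemma link_cap_le_total:
  assumes "0 < r" "finite F" "H \<subseteq> {..<r} \<rightarrow>\<^sub>E F" "\<And>x. 0 \<le> p x" "0 \<le> \<tau>"
  shows "link_cap r p \<tau> H \<le> sum p F"
  unfolding link_cap_def
  by (rule cSup_least)
     (use assms capped_zero[of p \<tau> r H] capped_mass_le_total[OF _ assms(1-4)] in auto)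

lemma link_cap_approx:
  assumes "0 < r" "finite F" "H \<subseteq> {..<r} \<rightarrow>\<^sub>E F" "\<And>x. 0 \<le> p x" "0 \<le> \<tau>" "y < link_cap r p \<tau> H"
  obtains \<mu> where "capped r p \<tau> H \<mu>" "y < sum \<mu> H"
proof -
  have "\<exists>x\<in>{sum \<mu> H | \<mu>. capped r p \<tau> H \<mu>}. y < x"
    using assms(6) unfolding link_cap_def
    by (rule less_cSupD[rotated]) (use capped_zero[of p \<tau> r H] assms in auto)
  then show ?thesis using that by auto
qed

lemma link_cap_nonneg:
  assumes "0 < r" "finite F" "H \<subseteq> {..<r} \<rightarrow>\<^sub>E F" "\<And>x. 0 \<le> p x" "0 \<le> \<tau>"
  shows "0 \<le> link_cap r p \<tau> H"
  using link_cap_upper[OF capped_zero[of p \<tau> r H] assms(1-4)] assms by simp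

lemma link_subset: "H \<subseteq> {..<Suc r} \<rightarrow>\<^sub>E F \<Longrightarrow> link r H T \<subseteq> {..<r} \<rightarrow>\<^sub>E F"
  by (auto simp: link_def PiE_iff split: if_splits)

lemma link_mono: "T \<subseteq> T' \<Longrightarrow> link r H T \<subseteq> link r H T'"
  by (auto simp: link_def)

lemma upd_restrict:
  assumes "f \<in> {..<Suc r} \<rightarrow>\<^sub>E F"
  shows "(restrict f {..<r})(r := f r) = f"
  using assms by (auto simp: fun_eq_iff restrict_def PiE_iff extensional_def)

text \<open>If the link of \<open>T\<close> carries little capped mass, then few sets are heavy for a nearly optimal
  measure \<open>\<nu>\<close> on it.  A vertex \<open>u\<close> whose \<open>\<mu>\<close>-link mostly avoids heavy sets could be added to
  \<open>T\<close> with profit, by adding half of its rescaled link to \<open>\<nu>\<close>.\<close>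
lemma profitable_vertices_heavy:
  fixes p :: "'v \<Rightarrow> real"
  assumes r: "0 < r" and F: "finite F" and p0: "\<And>x. 0 \<le> p x" and pF: "\<And>x. x \<in> F \<Longrightarrow> 0 < p x"
    and \<tau>: "0 < \<tau>" and H: "H \<subseteq> {..<Suc r} \<rightarrow>\<^sub>E F"
    and \<mu>: "capped (Suc r) p \<tau> H \<mu>" and mass: "c * sum p F \<le> sum \<mu> H" and c: "0 < c"
    and small: "link_cap r p \<tau> (link r H T) \<le> c / 2 ^ (r + 2) * sum p F"
    and Fne: "F \<noteq> {}"
  shows "c / 4 * sum p F \<le> sum p {u \<in> F. link_cap r p \<tau> (link r H T) + c / 16 * p u / \<tau>
            \<le> link_cap r p \<tau> (link r H (insert u T))}" (is "_ \<le> sum p ?U")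
proof -
  define \<Phi> where "\<Phi> T = link_cap r p \<tau> (link r H T)" for T
  define \<Lambda> where "\<Lambda> = sum p F"
  have finH: "finite H" by (rule finite_subset[OF H]) (use F in \<open>auto intro!: finite_PiE\<close>)
  have lk: "link r H S \<subseteq> {..<r} \<rightarrow>\<^sub>E F" for S using link_subset[OF H] .
  have finL: "finite (link r H S)" for S using finH by (simp add: link_def)
  \<comment> \<open>The slack of \<open>\<nu>\<close> against the supremum. It is at most
    \<open>c / 16 * p u / \<tau>\<close> for every \<open>u\<close> in \<open>F\<close>, which is at
    most half of the gain \<open>gu u / (2 * \<tau>)\<close> brought by a vertex with
    \<open>c / 4 * p u \<le> gu u\<close>.\<close>
  define \<xi> where "\<xi> = c / 16 * Min (p ` F) / \<tau>"
  have "0 < Min (p ` F)" using F Fne pF by simp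
  then have \<xi>: "0 < \<xi>" using c \<tau> by (simp add: \<xi>_def)
  have \<xi>le: "\<xi> \<le> c / 16 * p u / \<tau>" if "u \<in> F" for u
    unfolding \<xi>_def using that F c \<tau> by (intro divide_right_mono mult_left_mono) auto
  obtain \<nu> where \<nu>: "capped r p \<tau> (link r H T) \<nu>" "\<Phi> T - \<xi> < sum \<nu> (link r H T)"
    using link_cap_approx[where p=p and \<tau>=\<tau> and y="\<Phi> T - \<xi>", OF r F lk[of T] p0] \<tau> \<xi> by (auto simp: \<Phi>_def)
  have \<nu>le: "sum \<nu> (link r H T) \<le> c / 2 ^ (r + 2) * \<Lambda>"
    using link_cap_upper[OF \<nu>(1) r F lk p0] small by (simp add: \<Lambda>_def)
  define lam where "lam J b = (\<Sum>g | g \<in> link r H T \<and> restrict g J = b. \<nu> g)" for J b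
  define cap where "cap J b = p (b (Min J)) * \<tau> ^ (card J - 1)" for J :: "nat set" and b :: "nat \<Rightarrow> 'v"
  \<comment> \<open>Heavy means that \<open>\<nu>\<close> already uses more than half of the cap.
    Where \<open>b\<close> is not heavy, the other half is free for the link that is to be
    added.\<close>
  define heavy where "heavy J = {b \<in> J \<rightarrow>\<^sub>E F. cap J b / 2 < lam J b}" for J :: "nat set"
  define \<J> where "\<J> = {J. J \<subseteq> {..<r} \<and> J \<noteq> {}}"
  have finJ: "finite \<J>" by (simp add: \<J>_def)
  have cardJ: "card \<J> \<le> 2 ^ r"
    using card_mono[of "Pow {..<r}" \<J>] by (auto simp: \<J>_def card_Pow)
  have finite_in: "finite J" if "J \<in> \<J>" for J using that finite_subset by (auto simp: \<J>_def)
  have finh: "finite (heavy J)" if "J \<in> \<J>" for J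
    using finite_in[OF that] F by (auto simp: heavy_def intro!: finite_subset[OF _ finite_PiE[of J "\<lambda>_. F"]])
  define bad where "bad = {f \<in> H. \<exists>J\<in>\<J>. restrict f J \<in> heavy J}"
  have mu0: "0 \<le> \<mu> f" for f using cappedD(2)[OF \<mu>] .
  have nu0: "0 \<le> \<nu> f" for f using cappedD(2)[OF \<nu>(1)] .
  \<comment> \<open>Each heavy \<open>b\<close> carries \<open>\<mu>\<close>-mass at most its cap,
    hence at most twice its \<open>\<nu>\<close>-mass, and distinct \<open>b\<close> concern
    disjoint sets of tuples.\<close>
  have badJ: "(\<Sum>f | f \<in> H \<and> restrict f J \<in> heavy J. \<mu> f) \<le> 2 * sum \<nu> (link r H T)"
    if J: "J \<in> \<J>" for J
  proof -
    have "(\<Sum>f | f \<in> H \<and> restrict f J \<in> heavy J. \<mu> f)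
        = (\<Sum>b\<in>heavy J. \<Sum>f | f \<in> {f \<in> H. restrict f J \<in> heavy J} \<and> restrict f J = b. \<mu> f)"
      by (rule sum.group[symmetric]) (use finH finh[OF J] in auto)
    also have "\<dots> = (\<Sum>b\<in>heavy J. \<Sum>f | f \<in> H \<and> restrict f J = b. \<mu> f)"
      by (intro sum.cong refl) auto
    also have "\<dots> \<le> (\<Sum>b\<in>heavy J. 2 * lam J b)"
    proof (rule sum_mono)
      fix b assume b: "b \<in> heavy J"
      have "(\<Sum>f | f \<in> H \<and> restrict f J = b. \<mu> f) \<le> cap J b"
        unfolding cap_def using J by (intro cappedD(1)[OF \<mu>]) (auto simp: \<J>_def)
      also have "\<dots> \<le> 2 * lam J b" using b by (simp add: heavy_def)
      finally show "(\<Sum>f | f \<in> H \<and> restrict f J = b. \<mu> f) \<le> 2 * lam J b" .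
    qed
    also have "\<dots> = 2 * (\<Sum>b\<in>heavy J. lam J b)" by (simp add: sum_distrib_left)
    finally have 1: "(\<Sum>f | f \<in> H \<and> restrict f J \<in> heavy J. \<mu> f) \<le> 2 * (\<Sum>b\<in>heavy J. lam J b)" .
    have "(\<Sum>b\<in>heavy J. lam J b)
        = (\<Sum>b\<in>heavy J. \<Sum>g | g \<in> {g \<in> link r H T. restrict g J \<in> heavy J} \<and> restrict g J = b. \<nu> g)"
      unfolding lam_def by (intro sum.cong refl) auto
    also have "\<dots> = (\<Sum>g | g \<in> link r H T \<and> restrict g J \<in> heavy J. \<nu> g)"
      by (rule sum.group) (use finL finh[OF J] in auto)
    also have "\<dots> \<le> sum \<nu> (link r H T)"
      using finL nu0 by (intro sum_mono2) auto
    finally show ?thesis using 1 by linarith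
  qed
  have "sum \<mu> bad \<le> (\<Sum>J\<in>\<J>. \<Sum>f | f \<in> H \<and> restrict f J \<in> heavy J. \<mu> f)"
  proof -
    have "sum \<mu> bad = (\<Sum>f\<in>H. if \<exists>J\<in>\<J>. restrict f J \<in> heavy J then \<mu> f else 0)"
      unfolding bad_def using finH by (simp add: sum.inter_filter)
    also have "\<dots> \<le> (\<Sum>f\<in>H. \<Sum>J\<in>\<J>. if restrict f J \<in> heavy J then \<mu> f else 0)"
    proof (rule sum_mono)
      fix f
      show "(if \<exists>J\<in>\<J>. restrict f J \<in> heavy J then \<mu> f else 0)
          \<le> (\<Sum>J\<in>\<J>. if restrict f J \<in> heavy J then \<mu> f else 0)"
      proof (cases "\<exists>J\<in>\<J>. restrict f J \<in> heavy J")
        case True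
        then obtain J where J: "J \<in> \<J>" "restrict f J \<in> heavy J" by auto
        have "(if restrict f J \<in> heavy J then \<mu> f else 0)
            \<le> (\<Sum>J\<in>\<J>. if restrict f J \<in> heavy J then \<mu> f else 0)"
          by (rule member_le_sum) (use J finJ mu0 in auto)
        then show ?thesis using J True by auto
      next
        case False
        then show ?thesis using mu0 by (auto intro!: sum_nonneg)
      qed
    qed
    also have "\<dots> = (\<Sum>J\<in>\<J>. \<Sum>f\<in>H. if restrict f J \<in> heavy J then \<mu> f else 0)"
      by (rule sum.swap)
    also have "\<dots> = (\<Sum>J\<in>\<J>. \<Sum>f | f \<in> H \<and> restrict f J \<in> heavy J. \<mu> f)"
      using finH by (simp add: sum.inter_filter)
    finally show ?thesis .
  qed
  also have "\<dots> \<le> (\<Sum>J\<in>\<J>. 2 * sum \<nu> (link r H T))" by (intro sum_mono badJ)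
  also have "\<dots> = real (card \<J>) * (2 * sum \<nu> (link r H T))" by simp
  also have "\<dots> \<le> 2 ^ r * (2 * sum \<nu> (link r H T))"
  proof (rule mult_right_mono)
    show "real (card \<J>) \<le> 2 ^ r" using cardJ of_nat_mono by fastforce
  qed (use nu0 in \<open>auto intro!: sum_nonneg\<close>)
  \<comment> \<open>The \<open>2 ^ (r + 2)\<close> in the smallness hypothesis pays for at most
    \<open>2 ^ r\<close> index sets, for the factor \<open>2\<close> from heaviness, and for losing
    no more than half of the mass of \<open>\<mu>\<close>.\<close>
  also have "\<dots> \<le> 2 ^ r * (2 * (c / 2 ^ (r + 2) * \<Lambda>))"
    using \<nu>le by (intro mult_left_mono) auto
  also have "\<dots> = c / 2 * \<Lambda>" by (simp add: power_add field_simps)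
  finally have bad_le: "sum \<mu> bad \<le> c / 2 * \<Lambda>" .
  define good where "good = H - bad"
  have good_ge: "c / 2 * \<Lambda> \<le> sum \<mu> good"
  proof -
    have "sum \<mu> H = sum \<mu> good + sum \<mu> bad"
      unfolding good_def by (rule sum.subset_diff) (use finH in \<open>auto simp: bad_def\<close>)
    then show ?thesis using bad_le mass by (simp add: \<Lambda>_def)
  qed
  define gu where "gu u = (\<Sum>f | f \<in> good \<and> f r = u. \<mu> f)" for u
  have fing: "finite good" using finH by (simp add: good_def)
  have sumgu: "sum \<mu> good = (\<Sum>u\<in>F. gu u)"
    unfolding gu_def by (rule sum.group[symmetric]) (use fing F H in \<open>auto simp: good_def PiE_iff\<close>)
  have gu_le: "gu u \<le> p u" for u
  proof -
    have eq: "(restrict f {r} = restrict (\<lambda>_. u) {r}) = (f r = u)" for f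
      by (auto simp: restrict_def fun_eq_iff)
    have "gu u \<le> (\<Sum>f | f \<in> H \<and> f r = u. \<mu> f)"
      unfolding gu_def using finH mu0 by (intro sum_mono2) (auto simp: good_def)
    also have "\<dots> \<le> p u"
      using cappedD(1)[OF \<mu>, of "{r}" "restrict (\<lambda>_. u) {r}"] by (simp add: eq)
    finally show ?thesis .
  qed
  have profit: "\<Phi> T + c / 16 * p u / \<tau> \<le> \<Phi> (insert u T)" if u: "u \<in> F" and gu4: "c / 4 * p u \<le> gu u" for u
  proof -
    let ?L = "link r H (insert u T)"
    \<comment> \<open>The good part of the \<open>\<mu>\<close>-link of \<open>u\<close>. Under
      \<open>\<mu>\<close> the entry \<open>u\<close> is one more prescribed entry, which lowers the
      cap by a factor \<open>\<tau>\<close>; so \<open>\<kappa> / (2 * \<tau>)\<close> fills at most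
      half of each cap.\<close>
    define \<kappa> where "\<kappa> g = (if g(r := u) \<in> good then \<mu> (g(r := u)) else 0)" for g
    define \<nu>' where "\<nu>' g = (if g \<in> link r H T then \<nu> g else 0) + \<kappa> g / (2 * \<tau>)" for g
    have \<kappa>0: "0 \<le> \<kappa> g" for g using mu0 by (simp add: \<kappa>_def)
    have good_restrict: "restrict f {..<r} \<in> ?L" if "f \<in> good" "f r = u" for f
      using that by (auto simp: link_def good_def)
    have sum\<kappa>: "(\<Sum>g | g \<in> ?L \<and> Q g. \<kappa> g) = (\<Sum>f | f \<in> good \<and> f r = u \<and> Q (restrict f {..<r}). \<mu> f)" for Q
    proof -
      have "(\<Sum>g | g \<in> ?L \<and> Q g. \<kappa> g) = (\<Sum>g | g \<in> ?L \<and> Q g \<and> g(r := u) \<in> good. \<mu> (g(r := u)))"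
        by (rule sum.mono_neutral_cong_right) (use finL in \<open>auto simp: \<kappa>_def\<close>)
      also have "\<dots> = (\<Sum>f | f \<in> good \<and> f r = u \<and> Q (restrict f {..<r}). \<mu> f)"
      proof (rule sum.reindex_bij_witness[of _ "\<lambda>f. restrict f {..<r}" "\<lambda>g. g(r := u)"])
        fix g assume g: "g \<in> {g. g \<in> ?L \<and> Q g \<and> g(r := u) \<in> good}"
        then have "g \<in> {..<r} \<rightarrow>\<^sub>E F" using lk by blast
        then have *: "restrict (g(r := u)) {..<r} = g"
          by (auto simp: fun_eq_iff restrict_def PiE_iff extensional_def)
        then show "restrict (g(r := u)) {..<r} = g" .
        show "g(r := u) \<in> {f. f \<in> good \<and> f r = u \<and> Q (restrict f {..<r})}" using g * by auto
      next
        fix f assume f: "f \<in> {f. f \<in> good \<and> f r = u \<and> Q (restrict f {..<r})}"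
        then have "f \<in> {..<Suc r} \<rightarrow>\<^sub>E F" using H by (auto simp: good_def)
        from upd_restrict[OF this] f have *: "(restrict f {..<r})(r := u) = f" by auto
        then show "(restrict f {..<r})(r := u) = f" .
        show "restrict f {..<r} \<in> {g. g \<in> ?L \<and> Q g \<and> g(r := u) \<in> good}"
          using f good_restrict * by auto
      qed auto
      finally show ?thesis .
    qed
    have sum\<nu>: "(\<Sum>g | g \<in> ?L \<and> Q g. if g \<in> link r H T then \<nu> g else 0) = (\<Sum>g | g \<in> link r H T \<and> Q g. \<nu> g)" for Q
      by (rule sum.mono_neutral_cong_right) (use finL link_mono[of T "insert u T" r H] in auto)
    have sum\<nu>': "(\<Sum>g | g \<in> ?L \<and> Q g. \<nu>' g) = (\<Sum>g | g \<in> link r H T \<and> Q g. \<nu> g)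
        + (\<Sum>f | f \<in> good \<and> f r = u \<and> Q (restrict f {..<r}). \<mu> f) / (2 * \<tau>)" for Q
      unfolding \<nu>'_def by (simp add: sum.distrib sum\<nu> sum\<kappa> flip: sum_divide_distrib)
    have capped': "capped r p \<tau> ?L \<nu>'"
      unfolding capped_def
    proof (intro conjI allI impI)
      fix g show "0 \<le> \<nu>' g" using nu0 \<kappa>0 \<tau> by (simp add: \<nu>'_def)
    next
      fix J b assume "J \<subseteq> {..<r} \<and> J \<noteq> {}"
      then have J: "J \<in> \<J>" "J \<subseteq> {..<r}" "J \<noteq> {}" by (auto simp: \<J>_def)
      have rr: "restrict (restrict f {..<r}) J = restrict f J" for f :: "nat \<Rightarrow> 'v"
        using J(2) by (simp add: Int_absorb1)
      have split: "(\<Sum>g | g \<in> ?L \<and> restrict g J = b. \<nu>' g) = lam J b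
          + (\<Sum>f | f \<in> good \<and> f r = u \<and> restrict f J = b. \<mu> f) / (2 * \<tau>)"
        unfolding sum\<nu>' lam_def rr by simp
      have lamcap: "lam J b \<le> cap J b"
        unfolding lam_def cap_def by (rule cappedD(1)[OF \<nu>(1) J(2,3)])
      show "(\<Sum>g | g \<in> ?L \<and> restrict g J = b. \<nu>' g) \<le> p (b (Min J)) * \<tau> ^ (card J - 1)"
      proof (cases "\<exists>f\<in>good. f r = u \<and> restrict f J = b")
        case False
        then have e: "{f. f \<in> good \<and> f r = u \<and> restrict f J = b} = {}" by blast
        show ?thesis using lamcap unfolding split e cap_def by simp
      next
        case True
        then obtain f where f: "f \<in> good" "f r = u" "restrict f J = b" by auto
        have bF: "b \<in> J \<rightarrow>\<^sub>E F"
        proof -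
          have "f \<in> {..<Suc r} \<rightarrow>\<^sub>E F" using f H by (auto simp: good_def)
          then show ?thesis using f(3) J(2) by (auto simp: PiE_iff)
        qed
        have "b \<notin> heavy J" using f J by (auto simp: good_def bad_def)
        then have 1: "lam J b \<le> cap J b / 2" using bF by (auto simp: heavy_def)
        have finJ1: "finite J" using finite_in[OF J(1)] .
        have rJ: "r \<notin> J" using J by auto
        let ?b = "b(r := u)"
        have "(\<Sum>f | f \<in> good \<and> f r = u \<and> restrict f J = b. \<mu> f)
            \<le> (\<Sum>f | f \<in> H \<and> restrict f (insert r J) = ?b. \<mu> f)"
        proof (rule sum_mono2)
          show "{f \<in> good. f r = u \<and> restrict f J = b} \<subseteq> {f \<in> H. restrict f (insert r J) = ?b}"
            by (auto simp: good_def fun_eq_iff restrict_def)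
        qed (use finH mu0 in auto)
        also have "\<dots> \<le> p (?b (Min (insert r J))) * \<tau> ^ (card (insert r J) - 1)"
          using J(2) by (intro cappedD(1)[OF \<mu>]) auto
        \<comment> \<open>This is why caps charge the least index: links delete the last entry, so
          prescribing that entry as well changes nothing but the power of
          \<open>\<tau>\<close>.\<close>
        also have "Min (insert r J) = Min J"
        proof -
          have "Min J \<in> J" using finJ1 J(3) by simp
          then have "Min J < r" using J(2) by auto
          with Min_insert[OF finJ1 J(3), of r] show ?thesis by linarith
        qed
        also have "?b (Min J) = b (Min J)"
          using rJ Min_in[OF finJ1 J(3)] by (metis fun_upd_other)
        also have "\<tau> ^ (card (insert r J) - 1) = \<tau> * \<tau> ^ (card J - 1)"
        proof -
          have "card J > 0" using finJ1 J(3) by (simp add: card_gt_0_iff)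
          then show ?thesis using finJ1 rJ by (simp flip: power_Suc)
        qed
        also have "p (b (Min J)) * (\<tau> * \<tau> ^ (card J - 1)) = \<tau> * cap J b"
          by (simp add: cap_def)
        finally have "(\<Sum>f | f \<in> good \<and> f r = u \<and> restrict f J = b. \<mu> f) \<le> \<tau> * cap J b" .
        then have "(\<Sum>f | f \<in> good \<and> f r = u \<and> restrict f J = b. \<mu> f) / (2 * \<tau>) \<le> cap J b / 2"
          using \<tau> by (simp add: field_simps)
        then show ?thesis using 1 unfolding split cap_def by simp
      qed
    qed
    have "\<Phi> T + c / 16 * p u / \<tau> \<le> \<Phi> T - \<xi> + c / 8 * p u / \<tau>"
      using \<xi>le[OF u] by simp
    also have "\<dots> \<le> sum \<nu> (link r H T) + gu u / (2 * \<tau>)"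
      using \<nu>(2) gu4 \<tau> by (intro add_mono) (auto simp: field_simps)
    also have "\<dots> = sum \<nu>' ?L"
      using sum\<nu>'[of "\<lambda>_. True"] by (simp add: gu_def)
    also have "\<dots> \<le> \<Phi> (insert u T)"
      unfolding \<Phi>_def by (rule link_cap_upper[OF capped' r F lk p0])
    finally show ?thesis .
  qed
  \<comment> \<open>Vertices with \<open>gu u\<close> below \<open>c / 4 * p u\<close> account for
    at most half of the good mass; all others are profitable and have
    \<open>gu u \<le> p u\<close>.\<close>
  have "c / 2 * \<Lambda> \<le> (\<Sum>u\<in>F. gu u)" using good_ge sumgu by simp
  also have "\<dots> \<le> (\<Sum>u\<in>F. c / 4 * p u + (if u \<in> ?U then p u else 0))"
  proof (rule sum_mono)
    fix u assume u: "u \<in> F"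
    show "gu u \<le> c / 4 * p u + (if u \<in> ?U then p u else 0)"
    proof (cases "c / 4 * p u \<le> gu u")
      case True
      then have "u \<in> ?U" using profit[OF u True] u by (simp add: \<Phi>_def)
      moreover have "0 \<le> c / 4 * p u" using c p0 by simp
      ultimately show ?thesis using gu_le[of u] by simp
    next
      case False
      then show ?thesis using p0[of u] by auto
    qed
  qed
  also have "\<dots> = c / 4 * \<Lambda> + sum p ?U"
  proof -
    have "(\<Sum>u\<in>F. if u \<in> ?U then p u else 0) = sum p (F \<inter> ?U)"
      using F by (simp add: sum.inter_restrict)
    also have "F \<inter> ?U = ?U" by auto
    finally have "(\<Sum>u\<in>F. if u \<in> ?U then p u else 0) = sum p ?U" .
    then show ?thesis by (simp only: sum.distrib \<Lambda>_def sum_distrib_left)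
  qed
  finally show ?thesis by (simp add: \<Lambda>_def)
qed

section \<open>One container step\<close>

definition avoids :: "nat \<Rightarrow> (nat \<Rightarrow> 'v) set \<Rightarrow> 'v set \<Rightarrow> bool" where
  "avoids r H I \<longleftrightarrow> (\<forall>f\<in>H. \<not> f ` {..<r} \<subseteq> I)"

text \<open>The bounds on \<open>C\<close> are demanded for every list, including lists that encode
  nothing, so that steps can be composed without tracking which lists arise. A fixed list length
  lets a concatenation be cut apart again.\<close>

definition container_map ::
  "('v \<Rightarrow> real) \<Rightarrow> ('v set \<Rightarrow> bool) \<Rightarrow> nat \<Rightarrow> real \<Rightarrow> real \<Rightarrow> 'v set \<Rightarrow> ('v set list \<Rightarrow> 'v set) \<Rightarrow> bool" where
  "container_map p Ind s M b F C \<longleftrightarrow>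
     (\<forall>Ts. C Ts \<subseteq> F \<and> sum p (C Ts) \<le> b) \<and>
     (\<forall>I. Ind I \<longrightarrow> (\<exists>Ts. length Ts = s \<and> (\<forall>T\<in>set Ts. T \<subseteq> I \<inter> F \<and> sum p T \<le> M) \<and> I \<inter> F \<subseteq> C Ts))"

text \<open>Induction on the uniformity. From an independent \<open>I\<close> keep a maximal
  \<open>T\<close> whose weight is paid for by the potential of its link. If that potential is
  large, the link is a hypergraph of lower uniformity which \<open>I\<close> also avoids, and
  induction continues there. If it is small, maximality makes every vertex of \<open>I\<close>
  unprofitable, and the unprofitable vertices miss a constant fraction of the weight. Which case
  occurs can be read off from \<open>T\<close>.\<close>

lemma container_step:
  "\<forall>c>0. \<exists>c'>0. \<exists>K>0. c' \<le> 1 \<and> (\<forall>(F :: 'v set) p \<tau> H \<mu>.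
     finite F \<and> F \<noteq> {} \<and> (\<forall>x. 0 \<le> p x) \<and> (\<forall>x\<in>F. 0 < p x) \<and> 0 < \<tau> \<and> H \<subseteq> {..<Suc r} \<rightarrow>\<^sub>E F \<and>
     capped (Suc r) p \<tau> H \<mu> \<and> c * sum p F \<le> sum \<mu> H \<longrightarrow>
     (\<exists>C. container_map p (avoids (Suc r) H) r (K * \<tau> * sum p F) ((1 - c') * sum p F) F C))"
proof (induction r)
  case 0
  show ?case
  proof (intro allI impI)
    fix c :: real assume c: "0 < c"
    show "\<exists>c'>0. \<exists>K>0. c' \<le> 1 \<and> (\<forall>(F :: 'v set) p \<tau> H \<mu>.
     finite F \<and> F \<noteq> {} \<and> (\<forall>x. 0 \<le> p x) \<and> (\<forall>x\<in>F. 0 < p x) \<and> 0 < \<tau> \<and> H \<subseteq> {..<Suc 0} \<rightarrow>\<^sub>E F \<and>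
     capped (Suc 0) p \<tau> H \<mu> \<and> c * sum p F \<le> sum \<mu> H \<longrightarrow>
     (\<exists>C. container_map p (avoids (Suc 0) H) 0 (K * \<tau> * sum p F) ((1 - c') * sum p F) F C))"
    proof (rule exI[of _ "min c 1"], intro conjI, use c in simp, rule exI[of _ 1], intro conjI allI impI, simp, simp)
      fix F :: "'v set" and p \<tau> H \<mu>
      assume A: "finite F \<and> F \<noteq> {} \<and> (\<forall>x. 0 \<le> p x) \<and> (\<forall>x\<in>F. 0 < p x) \<and> 0 < \<tau> \<and> H \<subseteq> {..<Suc 0} \<rightarrow>\<^sub>E F \<and>
         capped (Suc 0) p \<tau> H \<mu> \<and> c * sum p F \<le> sum \<mu> H"
      \<comment> \<open>With a single entry the edges are vertices, all missed by \<open>I\<close>;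
        their removal is the container and nothing has to be recorded.\<close>
      let ?V = "(\<lambda>f. f 0) ` H"
      have fin: "finite H"
        by (rule finite_subset[of _ "{..<Suc 0} \<rightarrow>\<^sub>E F"]) (use A in \<open>auto intro!: finite_PiE\<close>)
      have VF: "?V \<subseteq> F" using A by auto
      have V: "sum \<mu> H \<le> sum p ?V" by (rule capped_mass_le[of "Suc 0" p \<tau>]) (use A fin in auto)
      have "sum p (F - ?V) = sum p F - sum p ?V" using A VF by (simp add: sum_diff)
      also have "\<dots> \<le> sum p F - c * sum p F" using A V by linarith
      also have "\<dots> \<le> (1 - min c 1) * sum p F"
      proof -
        have "min c 1 * sum p F \<le> c * sum p F" using A by (intro mult_right_mono sum_nonneg) auto
        then show ?thesis by (simp add: left_diff_distrib)
      qed
      finally have sm: "sum p (F - ?V) \<le> (1 - min c 1) * sum p F" .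
      show "\<exists>C. container_map p (avoids (Suc 0) H) 0 (1 * \<tau> * sum p F) ((1 - min c 1) * sum p F) F C"
        unfolding container_map_def avoids_def
        by (rule exI[of _ "\<lambda>_ :: 'v set list. F - ?V"]) (use sm in \<open>auto simp: lessThan_Suc\<close>)
    qed
  qed
next
  case (Suc r)
  show ?case
  proof (intro allI impI)
    fix c :: real assume c: "0 < c"
    \<comment> \<open>The smallness threshold of \<open>profitable_vertices_heavy\<close> for links
      of uniformity \<open>Suc r\<close>; above it the link is dense enough for the induction
      hypothesis.\<close>
    define d where "d = c / 2 ^ (Suc r + 2)"
    have d: "0 < d" using c by (simp add: d_def)
    define P where "P c' K F p \<tau> H C \<longleftrightarrow>
        container_map p (avoids (Suc r) H) r (K * \<tau> * sum p F) ((1 - c') * sum p F) F C"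
      for c' K \<tau> :: real and F :: "'v set" and p and H :: "(nat \<Rightarrow> 'v) set" and C :: "'v set list \<Rightarrow> 'v set"
    have "\<exists>c1>0. \<exists>K1>0. c1 \<le> 1 \<and> (\<forall>(F :: 'v set) p \<tau> H \<mu>.
     finite F \<and> F \<noteq> {} \<and> (\<forall>x. 0 \<le> p x) \<and> (\<forall>x\<in>F. 0 < p x) \<and> 0 < \<tau> \<and> H \<subseteq> {..<Suc r} \<rightarrow>\<^sub>E F \<and>
     capped (Suc r) p \<tau> H \<mu> \<and> d * sum p F \<le> sum \<mu> H \<longrightarrow> (\<exists>C. P c1 K1 F p \<tau> H C))"
      using Suc.IH[rule_format, OF d] unfolding P_def .
    then obtain c1 K1 where c1: "0 < c1" "c1 \<le> 1" "0 < K1" and IH0: "\<forall>(F :: 'v set) p \<tau> H \<mu>.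
     finite F \<and> F \<noteq> {} \<and> (\<forall>x. 0 \<le> p x) \<and> (\<forall>x\<in>F. 0 < p x) \<and> 0 < \<tau> \<and> H \<subseteq> {..<Suc r} \<rightarrow>\<^sub>E F \<and>
     capped (Suc r) p \<tau> H \<mu> \<and> d * sum p F \<le> sum \<mu> H \<longrightarrow> (\<exists>C. P c1 K1 F p \<tau> H C)"
      by blast
    note IH = IH0[rule_format]
    define c' where "c' = min c1 (c / 4)"
    define K where "K = max K1 (16 / c)"
    have c'pos: "0 < c'" "c' \<le> 1" "c' \<le> c1" "c' \<le> c / 4" using c1 c by (auto simp: c'_def)
    have K: "0 < K" "K1 \<le> K" "16 / c \<le> K" using c1 by (auto simp: K_def)
    show "\<exists>c'>0. \<exists>K>0. c' \<le> 1 \<and> (\<forall>(F :: 'v set) p \<tau> H \<mu>.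
     finite F \<and> F \<noteq> {} \<and> (\<forall>x. 0 \<le> p x) \<and> (\<forall>x\<in>F. 0 < p x) \<and> 0 < \<tau> \<and> H \<subseteq> {..<Suc (Suc r)} \<rightarrow>\<^sub>E F \<and>
     capped (Suc (Suc r)) p \<tau> H \<mu> \<and> c * sum p F \<le> sum \<mu> H \<longrightarrow>
     (\<exists>C. container_map p (avoids (Suc (Suc r)) H) (Suc r) (K * \<tau> * sum p F) ((1 - c') * sum p F) F C))"
    proof (rule exI[of _ c'], intro conjI, fact, rule exI[of _ K], intro conjI allI impI, fact, fact)
      fix F :: "'v set" and p \<tau> H \<mu>
      assume A: "finite F \<and> F \<noteq> {} \<and> (\<forall>x. 0 \<le> p x) \<and> (\<forall>x\<in>F. 0 < p x) \<and> 0 < \<tau> \<and> H \<subseteq> {..<Suc (Suc r)} \<rightarrow>\<^sub>E F \<and>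
         capped (Suc (Suc r)) p \<tau> H \<mu> \<and> c * sum p F \<le> sum \<mu> H"
      then have F: "finite F" "F \<noteq> {}" and p0: "\<And>x. 0 \<le> p x" and pF: "\<And>x. x \<in> F \<Longrightarrow> 0 < p x"
        and \<tau>: "0 < \<tau>" and H: "H \<subseteq> {..<Suc (Suc r)} \<rightarrow>\<^sub>E F" and \<mu>: "capped (Suc (Suc r)) p \<tau> H \<mu>"
        and mass: "c * sum p F \<le> sum \<mu> H" by auto
      define \<Lambda> where "\<Lambda> = sum p F"
      have \<Lambda>0: "0 \<le> \<Lambda>" using p0 by (simp add: \<Lambda>_def sum_nonneg)
      have lk: "link (Suc r) H T \<subseteq> {..<Suc r} \<rightarrow>\<^sub>E F" for T using link_subset[OF H] .
      define \<Phi> where "\<Phi> T = link_cap (Suc r) p \<tau> (link (Suc r) H T)" for T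
      define CC where "CC T = (SOME C. P c1 K1 F p \<tau> (link (Suc r) H T) C)" for T
      have CC: "P c1 K1 F p \<tau> (link (Suc r) H T) (CC T)" if D: "d * \<Lambda> < \<Phi> T" for T
      proof -
        obtain \<nu> where \<nu>: "capped (Suc r) p \<tau> (link (Suc r) H T) \<nu>" "d * \<Lambda> < sum \<nu> (link (Suc r) H T)"
          by (rule link_cap_approx[where p=p and \<tau>=\<tau> and y="d * \<Lambda>", OF _ F(1) lk[of T] p0])
             (use \<tau> D in \<open>simp_all add: \<Phi>_def\<close>)
        have "\<exists>C. P c1 K1 F p \<tau> (link (Suc r) H T) C"
          by (rule IH[of F p \<tau> _ \<nu>]) (use F p0 pF \<tau> lk \<nu> in \<open>auto simp: \<Lambda>_def\<close>)
        then show ?thesis unfolding CC_def by (rule someI_ex)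
      qed
      define Cont where "Cont T = {u \<in> F. \<Phi> (insert u T) < \<Phi> T + c / 16 * p u / \<tau>}" for T
      have Cont: "sum p (Cont T) \<le> (1 - c') * \<Lambda>" if "\<not> d * \<Lambda> < \<Phi> T" for T
      proof -
        let ?U = "{u \<in> F. \<Phi> T + c / 16 * p u / \<tau> \<le> \<Phi> (insert u T)}"
        have "c / 4 * sum p F \<le> sum p ?U"
          unfolding \<Phi>_def
          by (rule profitable_vertices_heavy[OF _ F(1) p0 pF \<tau> H \<mu> mass c])
             (use that F in \<open>auto simp: \<Phi>_def d_def \<Lambda>_def\<close>)
        moreover have "Cont T = F - ?U" by (auto simp: Cont_def)
        moreover have "sum p (F - ?U) = \<Lambda> - sum p ?U" unfolding \<Lambda>_def using F by (intro sum_diff) auto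
        moreover have "c' * \<Lambda> \<le> c / 4 * \<Lambda>" using c'pos \<Lambda>0 by (intro mult_right_mono) auto
        ultimately show ?thesis by (simp add: \<Lambda>_def left_diff_distrib)
      qed
      \<comment> \<open>The first entry decides which case applies and the remaining entries are
        passed on to the induction hypothesis. The value at \<open>[]\<close> only has to satisfy
        the bounds.\<close>
      define C where "C Ts = (case Ts of [] \<Rightarrow> {} | T # Ts' \<Rightarrow> if d * \<Lambda> < \<Phi> T then CC T Ts' else Cont T)" for Ts
      have C1: "C Ts \<subseteq> F \<and> sum p (C Ts) \<le> (1 - c') * \<Lambda>" for Ts
      proof (cases Ts)
        case Nil
        then show ?thesis using c'pos \<Lambda>0 by (simp add: C_def)
      next
        case (Cons T Ts')
        show ?thesis
        proof (cases "d * \<Lambda> < \<Phi> T")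
          case True
          from CC[OF True] have "CC T Ts' \<subseteq> F" "sum p (CC T Ts') \<le> (1 - c1) * \<Lambda>"
            unfolding P_def container_map_def avoids_def \<Lambda>_def by auto
          moreover have "(1 - c1) * \<Lambda> \<le> (1 - c') * \<Lambda>" using c'pos \<Lambda>0 by (intro mult_right_mono) auto
          ultimately show ?thesis using True Cons by (simp add: C_def)
        next
          case False
          then show ?thesis using Cont[OF False] Cons by (auto simp: C_def Cont_def)
        qed
      qed
      have C2: "\<exists>Ts. length Ts = Suc r \<and> (\<forall>T\<in>set Ts. T \<subseteq> I \<inter> F \<and> sum p T \<le> K * \<tau> * \<Lambda>) \<and> I \<inter> F \<subseteq> C Ts"
        if I: "\<forall>f\<in>H. \<not> f ` {..<Suc (Suc r)} \<subseteq> I" for I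
      proof -
        \<comment> \<open>No order on the vertices or greedy procedure is involved: any maximal
          member works. Its weight is bounded because the potential never exceeds the total
          weight.\<close>
        define \<T> where "\<T> = {T. T \<subseteq> I \<inter> F \<and> c / 16 * sum p T / \<tau> \<le> \<Phi> T}"
        have fin: "finite \<T>" using F by (auto simp: \<T>_def)
        have "{} \<in> \<T>"
          using link_cap_nonneg[where p=p and \<tau>=\<tau>, OF _ F(1) lk[of "{}"] p0] \<tau> by (auto simp: \<T>_def \<Phi>_def)
        then obtain T where T: "T \<in> \<T>" and max: "\<And>T'. T' \<in> \<T> \<Longrightarrow> T \<subseteq> T' \<Longrightarrow> T' = T"
          using finite_has_maximal2[OF fin] by metis
        have TI: "T \<subseteq> I \<inter> F" and T\<Phi>: "c / 16 * sum p T / \<tau> \<le> \<Phi> T" using T by (auto simp: \<T>_def)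
        have finT: "finite T" using TI F finite_subset by blast
        have IC: "I \<inter> F \<subseteq> Cont T"
        proof
          fix u assume u: "u \<in> I \<inter> F"
          show "u \<in> Cont T"
          proof (rule ccontr)
            assume "u \<notin> Cont T"
            then have *: "\<Phi> T + c / 16 * p u / \<tau> \<le> \<Phi> (insert u T)" using u by (auto simp: Cont_def)
            have "0 < c / 16 * p u / \<tau>" using c \<tau> pF u by simp
            then have uT: "u \<notin> T" using * by (auto simp: insert_absorb)
            have "c / 16 * sum p (insert u T) / \<tau> \<le> \<Phi> (insert u T)"
              using * T\<Phi> uT finT by (simp add: ring_distribs add_divide_distrib)
            then have "insert u T \<in> \<T>" using TI u by (auto simp: \<T>_def)
            from max[OF this] uT show False by auto
          qed
        qed
        have "\<Phi> T \<le> \<Lambda>" unfolding \<Phi>_def \<Lambda>_def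
          by (rule link_cap_le_total) (use F lk p0 \<tau> in auto)
        then have "c / 16 * sum p T / \<tau> \<le> \<Lambda>" using T\<Phi> by simp
        then have "sum p T \<le> 16 / c * \<tau> * \<Lambda>" using c \<tau> by (simp add: field_simps)
        also have "\<dots> \<le> K * \<tau> * \<Lambda>" using K \<tau> \<Lambda>0 by (intro mult_right_mono) auto
        finally have pT: "sum p T \<le> K * \<tau> * \<Lambda>" .
        show ?thesis
        proof (cases "d * \<Lambda> < \<Phi> T")
          case True
          \<comment> \<open>An edge whose last entry lies in \<open>T\<close>, hence in
            \<open>I\<close>, must leave \<open>I\<close> at an earlier entry.\<close>
          have "\<forall>f\<in>link (Suc r) H T. \<not> f ` {..<Suc r} \<subseteq> I"
          proof
            fix g assume "g \<in> link (Suc r) H T"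
            then obtain f where f: "f \<in> H" "f (Suc r) \<in> T" "g = restrict f {..<Suc r}"
              by (auto simp: link_def)
            have "\<not> f ` {..<Suc (Suc r)} \<subseteq> I" using I f by auto
            then obtain j where "j < Suc (Suc r)" "f j \<notin> I" by auto
            moreover from this have "j \<noteq> Suc r" using f TI by auto
            ultimately show "\<not> g ` {..<Suc r} \<subseteq> I" using f(3) less_Suc_eq[of j "Suc r"] by auto
          qed
          then have "\<exists>Ts. length Ts = r \<and> (\<forall>T\<in>set Ts. T \<subseteq> I \<inter> F \<and> sum p T \<le> K1 * \<tau> * sum p F) \<and> I \<inter> F \<subseteq> CC T Ts"
            using CC[OF True] unfolding P_def container_map_def avoids_def by (elim conjE) (erule allE[of _ I], erule (1) mp)
          then obtain Ts where Ts: "length Ts = r"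
            "\<forall>T'\<in>set Ts. T' \<subseteq> I \<inter> F \<and> sum p T' \<le> K1 * \<tau> * \<Lambda>" "I \<inter> F \<subseteq> CC T Ts"
            unfolding \<Lambda>_def by (elim exE conjE)
          have K1K: "K1 * \<tau> * \<Lambda> \<le> K * \<tau> * \<Lambda>" using K \<tau> \<Lambda>0 by (intro mult_right_mono) auto
          show ?thesis
          proof (intro exI[of _ "T # Ts"] conjI ballI)
            fix T' assume "T' \<in> set (T # Ts)"
            then show "T' \<subseteq> I \<inter> F" "sum p T' \<le> K * \<tau> * \<Lambda>"
              using Ts(2) TI pT K1K by (auto intro: order_trans)
          qed (use Ts True in \<open>simp_all add: C_def\<close>)
        next
          case False
          \<comment> \<open>Here only \<open>T\<close> is read. Empty sets pad the list to its fixed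
            length, and they obey the weight bound.\<close>
          have "0 \<le> K * \<tau> * \<Lambda>" using K \<tau> \<Lambda>0 by simp
          then show ?thesis
            by (intro exI[of _ "T # replicate r {}"]) (use TI pT False IC in \<open>auto simp: C_def\<close>)
        qed
      qed
      show "\<exists>C. container_map p (avoids (Suc (Suc r)) H) (Suc r) (K * \<tau> * sum p F) ((1 - c') * sum p F) F C"
        using C1 C2 unfolding \<Lambda>_def container_map_def avoids_def by (intro exI[of _ C]) blast
    qed
  qed
qed

section \<open>Tree posets\<close>

lemma poset_onD:
  assumes "poset_on X le"
  shows "finite X" "x \<in> X \<Longrightarrow> le x x" "x \<in> X \<Longrightarrow> y \<in> X \<Longrightarrow> le x y \<Longrightarrow> le y x \<Longrightarrow> x = y"
    "x \<in> X \<Longrightarrow> y \<in> X \<Longrightarrow> z \<in> X \<Longrightarrow> le x y \<Longrightarrow> le y z \<Longrightarrow> le x z"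
proof -
  note * = assms[unfolded poset_on_def]
  show "finite X" using * by (elim conjE)
  show "x \<in> X \<Longrightarrow> le x x" using * by (elim conjE) (erule bspec)
  show "x \<in> X \<Longrightarrow> y \<in> X \<Longrightarrow> le x y \<Longrightarrow> le y x \<Longrightarrow> x = y"
    using *[THEN conjunct2, THEN conjunct2, THEN conjunct1, THEN bspec, THEN bspec, of x y] by simp
  show "x \<in> X \<Longrightarrow> y \<in> X \<Longrightarrow> z \<in> X \<Longrightarrow> le x y \<Longrightarrow> le y z \<Longrightarrow> le x z"
    using *[THEN conjunct2, THEN conjunct2, THEN conjunct2, THEN bspec, THEN bspec, THEN bspec, of x y z] by (simp only: simp_thms)
qed

lemma tree_posetD:
  assumes "tree_poset X le"
  shows "poset_on X le" "finite X" "card (hasse_edges X le) = card X - 1" "X \<noteq> {}"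
    "x \<in> X \<Longrightarrow> y \<in> X \<Longrightarrow> (x, y) \<in> (\<Union>e\<in>hasse_edges X le. {(u, v). u \<in> e \<and> v \<in> e})\<^sup>*"
proof -
  note * = assms[unfolded tree_poset_def]
  show "poset_on X le" using * by (elim conjE)
  then show "finite X" by (rule poset_onD(1))
  show "X \<noteq> {}" using * by (elim conjE)
  show "card (hasse_edges X le) = card X - 1" using * by (elim conjE)
  show "x \<in> X \<Longrightarrow> y \<in> X \<Longrightarrow> (x, y) \<in> (\<Union>e\<in>hasse_edges X le. {(u, v). u \<in> e \<and> v \<in> e})\<^sup>*"
    using *[THEN conjunct2, THEN conjunct2, THEN conjunct1, THEN bspec, THEN bspec, of x y] by (simp only: simp_thms)
qed

lemma poset_on_dual: "poset_on X le \<Longrightarrow> poset_on X (\<lambda>x y. le y x)"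
  unfolding poset_on_def by blast

lemma covers_dual: "covers X (\<lambda>x y. le y x) x y \<longleftrightarrow> covers X le y x"
  by (auto simp: covers_def)

lemma hasse_edges_dual: "hasse_edges X (\<lambda>x y. le y x) = hasse_edges X le"
  unfolding hasse_edges_def covers_dual[of X le] by (auto simp: insert_commute)

lemma tree_poset_dual: "tree_poset X le \<Longrightarrow> tree_poset X (\<lambda>x y. le y x)"
  unfolding tree_poset_def hasse_edges_dual[of X le] using poset_on_dual by blast

text \<open>Among the elements above \<open>w\<close> and strictly below \<open>v\<close>, take one
  with the largest down-set; down-sets grow strictly along the order, so nothing fits between it and
  \<open>v\<close>.\<close>

lemma lower_cover:
  assumes P: "poset_on X le" and wv: "w \<in> X" "v \<in> X" "le w v" "w \<noteq> v"
  obtains u where "covers X le u v" "le w u"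
proof -
  let ?S = "{z \<in> X. le w z \<and> le z v \<and> z \<noteq> v}"
  have fin: "finite ?S" "?S \<noteq> {}" using poset_onD(1,2)[OF P] wv by auto
  define c where "c z = card {t \<in> X. le t z}" for z
  have "Max (c ` ?S) \<in> c ` ?S" using fin by (intro Max_in) auto
  then obtain u where u: "u \<in> ?S" "Max (c ` ?S) = c u" by (rule imageE)
  have max: "card {t \<in> X. le t z} \<le> card {t \<in> X. le t u}" if "z \<in> ?S" for z
    using Max_ge[of "c ` ?S" "c z"] fin that u(2) unfolding c_def by auto
  have "covers X le u v"
    unfolding covers_def
  proof (intro conjI notI)
    assume "\<exists>z\<in>X. le u z \<and> le z v \<and> z \<noteq> u \<and> z \<noteq> v"
    then obtain z where z: "z \<in> X" "le u z" "le z v" "z \<noteq> u" "z \<noteq> v" by auto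
    note finX = poset_onD(1)[OF P] and refl = poset_onD(2)[OF P]
      and anti = poset_onD(3)[OF P] and tr = poset_onD(4)[OF P]
    have "z \<in> ?S" using z u tr[of w u z] wv by auto
    have "{t \<in> X. le t u} \<subset> {t \<in> X. le t z}"
    proof (rule psubsetI)
      show "{t \<in> X. le t u} \<subseteq> {t \<in> X. le t z}" using tr z u by blast
      have "z \<notin> {t \<in> X. le t u}" using anti[of z u] z u by auto
      moreover have "z \<in> {t \<in> X. le t z}" using refl z by auto
      ultimately show "{t \<in> X. le t u} \<noteq> {t \<in> X. le t z}" by metis
    qed
    then have "card {t \<in> X. le t u} < card {t \<in> X. le t z}" using finX by (intro psubset_card_mono) auto
    with max[OF \<open>z \<in> ?S\<close>] show False by simp
  qed (use u wv in auto)
  then show ?thesis using that u by auto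
qed

lemma finite_hasse_edges: "finite X \<Longrightarrow> finite (hasse_edges X le)"
  by (rule finite_subset[of _ "Pow X"]) (auto simp: hasse_edges_def covers_def)

lemma hasse_edge_pair:
  assumes "e \<in> hasse_edges X le"
  shows "e \<subseteq> X" "card e = 2"
  using assms by (auto simp: hasse_edges_def covers_def)

text \<open>The degrees sum to \<open>2 * (card X - 1)\<close>, less than twice the number of
  vertices, so some degree is below two; connectedness excludes degree zero.\<close>

lemma tree_poset_leaf:
  assumes T: "tree_poset X le" and "card X > 1"
  obtains v u where "v \<in> X" "{e \<in> hasse_edges X le. v \<in> e} = {{u, v}}" "u \<noteq> v" "u \<in> X"
proof -
  let ?E = "hasse_edges X le"
  have finX: "finite X" using tree_posetD(2)[OF T] .
  note finE = finite_hasse_edges[OF finX, of le]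
  define deg where "deg x = card {e \<in> ?E. x \<in> e}" for x
  have "(\<Sum>x\<in>X. deg x) = (\<Sum>x\<in>X. \<Sum>e\<in>?E. if x \<in> e then 1 else 0)"
    using finE by (intro sum.cong refl) (simp add: deg_def flip: sum.inter_filter)
  also have "\<dots> = (\<Sum>e\<in>?E. \<Sum>x\<in>X. if x \<in> e then 1 else 0)" by (rule sum.swap)
  also have "\<dots> = (\<Sum>e\<in>?E. 2)"
  proof (rule sum.cong[OF refl])
    fix e assume e: "e \<in> ?E"
    have "(\<Sum>x\<in>X. if x \<in> e then 1 else 0) = card {x \<in> X. x \<in> e}"
      using finX by (simp flip: sum.inter_filter)
    also have "{x \<in> X. x \<in> e} = e" using hasse_edge_pair(1)[OF e] by auto
    finally show "(\<Sum>x\<in>X. if x \<in> e then 1 else 0) = (2::nat)" using hasse_edge_pair(2)[OF e] by simp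
  qed
  also have "\<dots> = 2 * (card X - 1)" using tree_posetD(3)[OF T] by simp
  finally have sm: "(\<Sum>x\<in>X. deg x) = 2 * (card X - 1)" .
  have "\<exists>v\<in>X. deg v < 2"
  proof (rule ccontr)
    assume "\<not> ?thesis"
    then have "(\<Sum>x\<in>X. 2) \<le> (\<Sum>x\<in>X. deg x)" by (intro sum_mono) (auto simp: not_less)
    then show False using sm assms(2) by simp
  qed
  then obtain v where v: "v \<in> X" "deg v < 2" by auto
  have "\<exists>y\<in>X. y \<noteq> v"
  proof (rule ccontr)
    assume "\<not> ?thesis"
    then have "X \<subseteq> {v}" by auto
    then have "card X \<le> 1" using card_mono[of "{v}" X] by simp
    then show False using assms(2) by simp
  qed
  then obtain y where y: "y \<in> X" "y \<noteq> v" by auto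
  have "(v, y) \<in> (\<Union>e\<in>?E. {(u, v). u \<in> e \<and> v \<in> e})\<^sup>*" using tree_posetD(5)[OF T] y v by blast
  then have "\<exists>e\<in>?E. v \<in> e" using y(2) by (cases rule: converse_rtranclE) auto
  then have "deg v \<noteq> 0" using finE by (auto simp: deg_def)
  then have "deg v = 1" using v by linarith
  then obtain e where e: "{e \<in> ?E. v \<in> e} = {e}" unfolding deg_def by (rule card_1_singletonE)
  then have "e \<in> ?E" "v \<in> e" by auto
  then obtain a b where ab: "e = {a, b}" "a \<noteq> b" "a \<in> X" "b \<in> X"
    by (auto simp: hasse_edges_def covers_def)
  then consider "a = v" | "b = v" using \<open>v \<in> e\<close> by auto
  then show ?thesis
  proof cases
    case 1
    then show ?thesis using that[of v b] ab e v by (simp add: insert_commute)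
  next
    case 2
    then show ?thesis using that[of v a] ab e v by simp
  qed
qed

text \<open>Anything above \<open>v\<close> would yield an upper cover of \<open>v\<close>, a second
  neighbour, so \<open>v\<close> is maximal. Anything strictly below \<open>v\<close> lies below
  some lower cover of \<open>v\<close>, and \<open>u\<close> is the only one.\<close>

lemma tree_poset_remove_leaf_up:
  assumes T: "tree_poset X le" and v: "{e \<in> hasse_edges X le. v \<in> e} = {{u, v}}" and c: "covers X le u v"
  shows "\<forall>w\<in>X - {v}. (le w v \<longleftrightarrow> le w u) \<and> \<not> le v w" "tree_poset (X - {v}) le"
proof -
  note P = tree_posetD(1)[OF T]
  note finX = poset_onD(1)[OF P] and refl = poset_onD(2)[OF P]
    and anti = poset_onD(3)[OF P] and tr = poset_onD(4)[OF P]
  have uv: "u \<in> X" "v \<in> X" "le u v" "u \<noteq> v" using c by (auto simp: covers_def)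
  have only: "w = u" if "covers X le w v \<or> covers X le v w" for w
  proof -
    have "{w, v} \<in> {e \<in> hasse_edges X le. v \<in> e}"
      using that by (auto simp: hasse_edges_def insert_commute)
    then have "{w, v} = {u, v}" using v by auto
    moreover have "w \<noteq> v" using that by (auto simp: covers_def)
    ultimately show ?thesis by (metis doubleton_eq_iff)
  qed
  have top: "\<not> le v w" if w: "w \<in> X - {v}" for w
  proof
    assume "le v w"
    with w uv obtain t where "covers X (\<lambda>x y. le y x) t v"
      using lower_cover[OF poset_on_dual[OF P], of w v] by auto
    then have "covers X le v t" by (simp add: covers_dual[of X le])
    then show False using only[of t] uv anti[of u v] by (auto simp: covers_def)
  qed
  show A: "\<forall>w\<in>X - {v}. (le w v \<longleftrightarrow> le w u) \<and> \<not> le v w"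
  proof (intro ballI conjI iffI)
    fix w assume w: "w \<in> X - {v}"
    show "\<not> le v w" by (rule top[OF w])
    show "le w v" if "le w u" using that tr[of w u v] w uv by auto
    show "le w u" if "le w v"
      using lower_cover[OF P, of w v] that w uv only by blast
  qed
  \<comment> \<open>A maximal \<open>v\<close> is never strictly between two other elements, so its
    deletion creates no new cover.\<close>
  have cov: "covers (X - {v}) le x y \<longleftrightarrow> covers X le x y \<and> x \<noteq> v \<and> y \<noteq> v" for x y
  proof
    assume *: "covers (X - {v}) le x y"
    then show "covers X le x y \<and> x \<noteq> v \<and> y \<noteq> v"
      using top unfolding covers_def by blast
  qed (auto simp: covers_def)
  have hE: "hasse_edges (X - {v}) le = hasse_edges X le - {{u, v}}"
  proof (rule set_eqI)
    fix e
    have "e \<in> hasse_edges (X - {v}) le \<longleftrightarrow> e \<in> hasse_edges X le \<and> v \<notin> e"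
      unfolding hasse_edges_def cov by auto
    also have "\<dots> \<longleftrightarrow> e \<in> hasse_edges X le - {{u, v}}" using v by auto
    finally show "e \<in> hasse_edges (X - {v}) le \<longleftrightarrow> e \<in> hasse_edges X le - {{u, v}}" .
  qed
  have "{u, v} \<in> hasse_edges X le" using v by blast
  then have cardE: "card (hasse_edges (X - {v}) le) = card (X - {v}) - 1"
    using tree_posetD(3)[OF T] uv finX finite_hasse_edges[OF finX, of le] unfolding hE by simp
  define R where "R Y = (\<Union>e\<in>hasse_edges Y le. {(u, v). u \<in> e \<and> v \<in> e})" for Y
  \<comment> \<open>Folding the leaf onto its neighbour turns every path of the old diagram into a
    path of the new one.\<close>
  define \<phi> where "\<phi> z = (if z = v then u else z)" for z
  have step: "(\<phi> x, \<phi> y) \<in> (R (X - {v}))\<^sup>*" if "(x, y) \<in> R X" for x y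
  proof -
    from that obtain e where e: "e \<in> hasse_edges X le" "x \<in> e" "y \<in> e" by (auto simp: R_def)
    show ?thesis
    proof (cases "e = {u, v}")
      case True
      then show ?thesis using e uv by (auto simp: \<phi>_def)
    next
      case False
      then have "e \<in> hasse_edges (X - {v}) le" "v \<notin> e" using e v hE by auto
      then have "(x, y) \<in> R (X - {v})" "x \<noteq> v" "y \<noteq> v" using e by (auto simp: R_def)
      then show ?thesis by (auto simp: \<phi>_def)
    qed
  qed
  have path: "(\<phi> x, \<phi> y) \<in> (R (X - {v}))\<^sup>*" if "(x, y) \<in> (R X)\<^sup>*" for x y
    using that by (induction rule: rtrancl_induct) (auto dest: step)
  have conn: "(x, y) \<in> (R (X - {v}))\<^sup>*" if "x \<in> X - {v}" "y \<in> X - {v}" for x y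
  proof -
    have "(x, y) \<in> (R X)\<^sup>*" using tree_posetD(5)[OF T] that unfolding R_def by blast
    from path[OF this] that show ?thesis by (auto simp: \<phi>_def)
  qed
  have "poset_on (X - {v}) le" using P unfolding poset_on_def by blast
  then show "tree_poset (X - {v}) le"
    unfolding tree_poset_def using conn cardE uv unfolding R_def by blast
qed

text \<open>Remove a leaf of the Hasse tree and put it back: its comparabilities are those of its neighbour.\<close>
lemma tree_poset_enumeration:
  assumes "tree_poset X le"
  shows "\<exists>e. bij_betw e {..<card X} X \<and> (\<forall>i<card X. 0 < i \<longrightarrow> (\<exists>u<i.
      (\<forall>w<i. (le (e w) (e i) \<longleftrightarrow> le (e w) (e u)) \<and> \<not> le (e i) (e w)) \<or>
      (\<forall>w<i. (le (e i) (e w) \<longleftrightarrow> le (e u) (e w)) \<and> \<not> le (e w) (e i))))"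
  using assms
proof (induction "card X" arbitrary: X)
  case 0
  then show ?case using tree_posetD(2,4)[of X le] by simp
next
  case (Suc m)
  have finX: "finite X" using tree_posetD(2)[OF Suc.prems] .
  show ?case
  proof (cases "card X > 1")
    case False
    then have "card X = 1" using Suc.hyps(2) by simp
    then obtain x where x: "X = {x}" by (rule card_1_singletonE)
    then show ?thesis by (intro exI[of _ "\<lambda>_. x"]) (auto simp: bij_betw_def inj_on_def)
  next
    case True
    then obtain v u where v: "v \<in> X" "{e \<in> hasse_edges X le. v \<in> e} = {{u, v}}" "u \<noteq> v" "u \<in> X"
      using tree_poset_leaf[OF Suc.prems] by blast
    have "{u, v} \<in> hasse_edges X le" using v by blast
    then consider "covers X le u v" | "covers X le v u"
      by (auto simp: hasse_edges_def doubleton_eq_iff)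
    then have *: "tree_poset (X - {v}) le \<and>
        ((\<forall>w\<in>X - {v}. (le w v \<longleftrightarrow> le w u) \<and> \<not> le v w) \<or> (\<forall>w\<in>X - {v}. (le v w \<longleftrightarrow> le u w) \<and> \<not> le w v))"
    proof cases
      case 1
      show ?thesis using tree_poset_remove_leaf_up[OF Suc.prems v(2) 1] by blast
    next
      case 2
      have "{e \<in> hasse_edges X (\<lambda>x y. le y x). v \<in> e} = {{u, v}}" using v(2) by (simp add: hasse_edges_dual[of X le])
      note d = tree_poset_remove_leaf_up[OF tree_poset_dual[OF Suc.prems] this]
      have "covers X (\<lambda>x y. le y x) u v" using 2 by (simp add: covers_dual[of X le])
      from d[OF this] show ?thesis using tree_poset_dual by blast
    qed
    have cX: "card (X - {v}) = m" using Suc.hyps(2) v(1) finX by simp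
    from Suc.hyps(1)[OF cX[symmetric]] * obtain e where e: "bij_betw e {..<m} (X - {v})"
      "\<forall>i<m. 0 < i \<longrightarrow> (\<exists>u<i.
      (\<forall>w<i. (le (e w) (e i) \<longleftrightarrow> le (e w) (e u)) \<and> \<not> le (e i) (e w)) \<or>
      (\<forall>w<i. (le (e i) (e w) \<longleftrightarrow> le (e u) (e w)) \<and> \<not> le (e w) (e i)))"
      unfolding cX by blast
    have eX: "e w \<in> X - {v}" if "w < m" for w using e(1) that by (auto simp: bij_betw_def)
    have "u \<in> e ` {..<m}" using e(1) v(3,4) by (simp add: bij_betw_def)
    then obtain iu where iu: "iu < m" "e iu = u" by auto
    let ?e = "e(m := v)"
    have bij: "bij_betw ?e {..<Suc m} X"
    proof -
      have inj: "inj_on e {..<m}" and im: "e ` {..<m} = X - {v}" using e(1) by (simp_all add: bij_betw_def)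
      have "inj_on ?e {..<Suc m}"
      proof (rule inj_onI)
        fix x y assume "x \<in> {..<Suc m}" "y \<in> {..<Suc m}" and eq: "?e x = ?e y"
        then have "(x = m \<or> x < m) \<and> (y = m \<or> y < m)" by auto
        then show "x = y" using eq inj eX[of x] eX[of y] by (auto simp: inj_on_def split: if_splits)
      qed
      moreover have "?e ` {..<Suc m} = insert v (e ` {..<m})"
        unfolding lessThan_Suc image_insert by (auto intro!: image_cong)
      ultimately show ?thesis using im v(1) by (auto simp: bij_betw_def)
    qed
    have "\<forall>i<Suc m. 0 < i \<longrightarrow> (\<exists>u<i.
      (\<forall>w<i. (le (?e w) (?e i) \<longleftrightarrow> le (?e w) (?e u)) \<and> \<not> le (?e i) (?e w)) \<or>
      (\<forall>w<i. (le (?e i) (?e w) \<longleftrightarrow> le (?e u) (?e w)) \<and> \<not> le (?e w) (?e i)))" (is "\<forall>i<Suc m. 0 < i \<longrightarrow> ?Q i")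
    proof (intro allI impI)
      fix i assume i: "i < Suc m" "0 < i"
      show "?Q i"
      proof (cases "i = m")
        case True
        have "(\<forall>w<m. (le (e w) v \<longleftrightarrow> le (e w) u) \<and> \<not> le v (e w)) \<or>
          (\<forall>w<m. (le v (e w) \<longleftrightarrow> le u (e w)) \<and> \<not> le (e w) v)"
          using * eX by blast
        then show ?thesis using iu True by (intro exI[of _ iu]) auto
      next
        case False
        then have im: "i < m" using i by simp
        with e(2) i obtain u' where u': "u' < i"
          "(\<forall>w<i. (le (e w) (e i) \<longleftrightarrow> le (e w) (e u')) \<and> \<not> le (e i) (e w)) \<or>
      (\<forall>w<i. (le (e i) (e w) \<longleftrightarrow> le (e u') (e w)) \<and> \<not> le (e w) (e i))" by blast
        have "\<And>w. w \<le> i \<Longrightarrow> ?e w = e w" using im by auto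
        then show ?thesis using u' im by (intro exI[of _ u']) auto
      qed
    qed
    then show ?thesis using bij Suc.hyps(2) by (intro exI[of _ ?e]) simp
  qed
qed

section \<open>Random maximal chains\<close>

text \<open>A maximal chain of subsets of \<open>A\<close> is encoded as the permutation of \<open>A\<close> whose prefixes are its members.\<close>
definition on_chain :: "'b list \<Rightarrow> 'b set \<Rightarrow> bool" where
  "on_chain \<sigma> x \<longleftrightarrow> set (take (card x) \<sigma>) = x"

definition chains_through :: "'b set \<Rightarrow> 'b set \<Rightarrow> 'b list set" where
  "chains_through A x = {\<sigma> \<in> permutations_of_set A. on_chain \<sigma> x}"

lemma finite_chains_through [simp]: "finite (chains_through A x)"
  by (simp add: chains_through_def)

lemma perm_setD:
  assumes "\<sigma> \<in> permutations_of_set A"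
  shows "set \<sigma> = A" "distinct \<sigma>" "length \<sigma> = card A"
  using assms by (auto simp: permutations_of_set_def distinct_card)

lemma on_chain_subset:
  assumes "on_chain \<sigma> x" "on_chain \<sigma> y" "card x \<le> card y"
  shows "x \<subseteq> y"
  using assms set_take_subset_set_take[of "card x" "card y" \<sigma>] by (simp add: on_chain_def)

text \<open>Cutting a chain at \<open>x\<close> gives two independent permutations; the counts of
  chains through given sets rest on this product structure.\<close>

lemma chains_through_split:
  assumes "finite A" "x \<subseteq> A"
  shows "bij_betw (\<lambda>(u, v). u @ v) (permutations_of_set x \<times> permutations_of_set (A - x)) (chains_through A x)"
  unfolding bij_betw_def
proof
  have fin: "finite x" using assms finite_subset by blast
  show "inj_on (\<lambda>(u, v). u @ v) (permutations_of_set x \<times> permutations_of_set (A - x))"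
    by (auto simp: inj_on_def dest!: perm_setD(3))
  show "(\<lambda>(u, v). u @ v) ` (permutations_of_set x \<times> permutations_of_set (A - x)) = chains_through A x" (is "?l = ?r")
  proof
    show "?l \<subseteq> ?r"
      using assms by (auto simp: chains_through_def on_chain_def permutations_of_set_def distinct_card)
    show "?r \<subseteq> ?l"
    proof
      fix \<sigma> assume "\<sigma> \<in> ?r"
      then have *: "set \<sigma> = A" "distinct \<sigma>" "set (take (card x) \<sigma>) = x"
        by (auto simp: chains_through_def on_chain_def permutations_of_set_def)
      have "set (take (card x) \<sigma>) \<union> set (drop (card x) \<sigma>) = set \<sigma>"
        by (metis append_take_drop_id set_append)
      moreover have "set (take (card x) \<sigma>) \<inter> set (drop (card x) \<sigma>) = {}"
        using *(2) by (rule set_take_disj_set_drop_if_distinct) simp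
      ultimately have "set (drop (card x) \<sigma>) = A - x" using * by auto
      then have "(take (card x) \<sigma>, drop (card x) \<sigma>) \<in> permutations_of_set x \<times> permutations_of_set (A - x)"
        using * by (auto simp: permutations_of_set_def)
      then show "\<sigma> \<in> ?l" by (force intro!: image_eqI[of _ _ "(take (card x) \<sigma>, drop (card x) \<sigma>)"])
    qed
  qed
qed

lemma card_chains_through:
  assumes "finite A" "x \<subseteq> A"
  shows "card (chains_through A x) = fact (card x) * fact (card A - card x)"
proof -
  have "finite x" using assms finite_subset by blast
  then show ?thesis
    using bij_betw_same_card[OF chains_through_split[OF assms]] assms
    by (simp add: card_cartesian_product card_Diff_subset)
qed

lemma card_chains_through_pred:
  assumes "finite A" "x \<subseteq> A"
    and Q: "\<And>u v. u \<in> permutations_of_set x \<Longrightarrow> v \<in> permutations_of_set (A - x) \<Longrightarrow> Q (u @ v) \<longleftrightarrow> Q1 u \<and> Q2 v"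
  shows "card {\<sigma> \<in> chains_through A x. Q \<sigma>}
    = card {u \<in> permutations_of_set x. Q1 u} * card {v \<in> permutations_of_set (A - x). Q2 v}"
proof -
  have "bij_betw (\<lambda>(u, v). u @ v) ({u \<in> permutations_of_set x. Q1 u} \<times> {v \<in> permutations_of_set (A - x). Q2 v})
      {\<sigma> \<in> chains_through A x. Q \<sigma>}"
  proof (rule bij_betw_subset[OF chains_through_split[OF assms(1,2)]])
    show "(\<lambda>(u, v). u @ v) ` ({u \<in> permutations_of_set x. Q1 u} \<times> {v \<in> permutations_of_set (A - x). Q2 v})
        = {\<sigma> \<in> chains_through A x. Q \<sigma>}"
      using Q bij_betw_imp_surj_on[OF chains_through_split[OF assms(1,2)], symmetric] by (auto simp: image_iff)
  qed auto
  from bij_betw_same_card[OF this] show ?thesis by (simp add: card_cartesian_product)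
qed

lemma card_chains_through_pair:
  assumes "finite A" "x \<subseteq> y" "y \<subseteq> A"
  shows "card (chains_through A x \<inter> chains_through A y)
    = fact (card x) * fact (card y - card x) * fact (card A - card y)"
proof -
  have "finite y" using assms(1,3) by (rule finite_subset[rotated])
  moreover from this have "finite x" using assms(2) by (rule finite_subset[rotated])
  ultimately have fin: "finite x" "finite y" by auto
  have le: "card x \<le> card y" using fin assms by (simp add: card_mono)
  have "chains_through A x \<inter> chains_through A y = {\<sigma> \<in> chains_through A y. on_chain \<sigma> x}"
    by (auto simp: chains_through_def)
  also have "card \<dots> = card {u \<in> permutations_of_set y. on_chain u x} * card {v \<in> permutations_of_set (A - y). True}"
    by (rule card_chains_through_pred) (use assms le in \<open>auto simp: on_chain_def dest!: perm_setD(3)\<close>)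
  also have "{u \<in> permutations_of_set y. on_chain u x} = chains_through y x"
    by (simp add: chains_through_def)
  finally show ?thesis
    using assms fin by (simp add: card_chains_through card_Diff_subset)
qed

lemma card_permutations_nth:
  assumes "finite B" "a \<in> B" "t < card B"
  shows "card {\<sigma> \<in> permutations_of_set B. \<sigma> ! t = a} = fact (card B - 1)"
proof -
  let ?f = "\<lambda>\<rho>. take t \<rho> @ a # drop t \<rho>"
  let ?g = "\<lambda>\<sigma>. take t \<sigma> @ drop (Suc t) \<sigma>"
  have "bij_betw ?f (permutations_of_set (B - {a})) {\<sigma> \<in> permutations_of_set B. \<sigma> ! t = a}"
  proof (rule bij_betw_byWitness[of _ ?g])
    show "\<forall>\<rho>\<in>permutations_of_set (B - {a}). ?g (?f \<rho>) = \<rho>"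
      using assms by (auto dest!: perm_setD(3))
    show "\<forall>\<sigma>\<in>{\<sigma> \<in> permutations_of_set B. \<sigma> ! t = a}. ?f (?g \<sigma>) = \<sigma>"
    proof
      fix \<sigma> assume *: "\<sigma> \<in> {\<sigma> \<in> permutations_of_set B. \<sigma> ! t = a}"
      then have len: "length \<sigma> = card B" using perm_setD(3)[of \<sigma> B] by simp
      then have "take t \<sigma> @ \<sigma> ! t # drop (Suc t) \<sigma> = \<sigma>"
        using assms(3) by (intro id_take_nth_drop[symmetric]) simp
      then show "?f (?g \<sigma>) = \<sigma>" using * len assms(3) by simp
    qed
    show "?f ` permutations_of_set (B - {a}) \<subseteq> {\<sigma> \<in> permutations_of_set B. \<sigma> ! t = a}"
    proof safe
      fix \<rho> assume "\<rho> \<in> permutations_of_set (B - {a})"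
      then have *: "set \<rho> = B - {a}" "distinct \<rho>" "length \<rho> = card B - 1"
        using perm_setD[of \<rho> "B - {a}"] assms by auto
      have "set (take t \<rho>) \<union> set (drop t \<rho>) = set \<rho>" by (metis append_take_drop_id set_append)
      moreover have "set (take t \<rho>) \<inter> set (drop t \<rho>) = {}"
        using *(2) by (rule set_take_disj_set_drop_if_distinct) simp
      ultimately show "?f \<rho> \<in> permutations_of_set B"
        using * assms(2) by (auto simp: permutations_of_set_def)
      show "?f \<rho> ! t = a" using *(3) assms(3) by (simp add: nth_append)
    qed
    show "?g ` {\<sigma> \<in> permutations_of_set B. \<sigma> ! t = a} \<subseteq> permutations_of_set (B - {a})"
    proof safe
      fix \<sigma> assume "\<sigma> \<in> permutations_of_set B" "a = \<sigma> ! t"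
      then have *: "set \<sigma> = B" "distinct \<sigma>" "length \<sigma> = card B" "a = \<sigma> ! t"
        using perm_setD[of \<sigma> B] by auto
      have sp: "take t \<sigma> @ a # drop (Suc t) \<sigma> = \<sigma>"
        unfolding *(4) by (rule id_take_nth_drop[symmetric]) (use * assms(3) in simp)
      have "set (take t \<sigma> @ a # drop (Suc t) \<sigma>) = B" by (simp only: sp *(1))
      then have "set (take t \<sigma>) \<union> {a} \<union> set (drop (Suc t) \<sigma>) = B"
        by simp
      moreover have "distinct (take t \<sigma> @ a # drop (Suc t) \<sigma>)" using sp *(2) by simp
      ultimately show "?g \<sigma> \<in> permutations_of_set (B - {\<sigma> ! t})"
        using *(4) by (auto simp: permutations_of_set_def)
    qed
  qed
  from bij_betw_same_card[OF this, symmetric] show ?thesis using assms by simp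
qed

text \<open>Past \<open>x\<close> the list is a uniformly random permutation of
  \<open>A - x\<close>, so all elements are equally likely at each later position.\<close>

lemma card_chains_through_nth_above:
  assumes "finite A" "x \<subseteq> A" "a \<in> A - x" "card x \<le> t" "t < card A"
  shows "real (card {\<sigma> \<in> chains_through A x. \<sigma> ! t = a}) = card (chains_through A x) / (card A - card x)"
proof -
  have fin: "finite x" using assms finite_subset by blast
  have cd: "card (A - x) = card A - card x" using fin assms by (simp add: card_Diff_subset)
  have "card {\<sigma> \<in> chains_through A x. \<sigma> ! t = a}
     = card {u \<in> permutations_of_set x. True} * card {v \<in> permutations_of_set (A - x). v ! (t - card x) = a}"
    by (rule card_chains_through_pred) (use assms in \<open>auto simp: nth_append dest!: perm_setD(3)\<close>)
  also have "card {v \<in> permutations_of_set (A - x). v ! (t - card x) = a} = fact (card A - card x - 1)"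
    using card_permutations_nth[of "A - x" a "t - card x"] assms cd by simp
  finally have "card {\<sigma> \<in> chains_through A x. \<sigma> ! t = a} = fact (card x) * fact (card A - card x - 1)"
    using fin by simp
  moreover have "fact (card A - card x) = real (card A - card x) * fact (card A - card x - 1)"
    using assms by (intro fact_reduce) simp
  ultimately show ?thesis
    using assms by (simp add: card_chains_through of_nat_diff)
qed

section \<open>Windows on random chains\<close>

text \<open>Instead of deleting windows one key at a time, take \<open>W\<close> maximising its size plus the threshold of every
  key that it no longer uses.\<close>
lemma prune_windows:
  fixes key :: "nat \<Rightarrow> 'w \<Rightarrow> 'v" and \<theta> :: "'v \<Rightarrow> real"
  assumes fin: "finite W0" "finite V" and key: "\<And>j \<omega>. j < k \<Longrightarrow> \<omega> \<in> W0 \<Longrightarrow> key j \<omega> \<in> V"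
    and \<theta>: "\<And>v. 0 \<le> \<theta> v"
  obtains W where "W \<subseteq> W0" "real (card W0) - real k * sum \<theta> V \<le> real (card W)"
    "\<And>\<omega> j. \<omega> \<in> W \<Longrightarrow> j < k \<Longrightarrow> \<theta> (key j \<omega>) \<le> real (card {\<omega>' \<in> W. key j \<omega>' = key j \<omega>})"
proof -
  define \<Psi> where "\<Psi> W = real (card W) + (\<Sum>j<k. sum \<theta> (V - key j ` W))" for W
  have "Max (\<Psi> ` Pow W0) \<in> \<Psi> ` Pow W0" using fin by (intro Max_in) auto
  then obtain W where W: "W \<subseteq> W0" "Max (\<Psi> ` Pow W0) = \<Psi> W" by auto
  have max: "\<Psi> W' \<le> \<Psi> W" if "W' \<subseteq> W0" for W'
    using Max_ge[of "\<Psi> ` Pow W0" "\<Psi> W'"] fin that W(2) by simp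
  have finW: "finite W" using W(1) fin(1) by (rule finite_subset)
  show ?thesis
  proof
    show "W \<subseteq> W0" by fact
    have "real (card W0) \<le> \<Psi> W0" using \<theta> by (simp add: \<Psi>_def sum_nonneg)
    also have "\<dots> \<le> \<Psi> W" by (rule max) simp
    also have "\<dots> \<le> real (card W) + (\<Sum>j<k. sum \<theta> V)"
      unfolding \<Psi>_def using fin \<theta> by (intro add_left_mono sum_mono sum_mono2) auto
    finally show "real (card W0) - real k * sum \<theta> V \<le> real (card W)" by simp
    fix \<omega> j assume \<omega>: "\<omega> \<in> W" and j: "j < k"
    define v where "v = key j \<omega>"
    \<comment> \<open>Deleting all windows with the underused key \<open>v\<close> loses fewer than
      \<open>\<theta> v\<close> of them but gains the threshold of \<open>v\<close>, against
      maximality; the terms of the other positions can only grow.\<close>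
    define D where "D = {\<omega>' \<in> W. key j \<omega>' = v}"
    show "\<theta> (key j \<omega>) \<le> real (card {\<omega>' \<in> W. key j \<omega>' = key j \<omega>})"
    proof (rule ccontr)
      assume "\<not> ?thesis"
      then have less: "real (card D) < \<theta> v" by (simp add: D_def v_def)
      have vV: "v \<in> V" using key[OF j] \<omega> W(1) by (auto simp: v_def)
      have cW: "real (card (W - D)) = real (card W) - real (card D)"
        using finW by (subst card_Diff_subset) (auto simp: D_def of_nat_diff card_mono)
      have mono: "sum \<theta> (V - key i ` W) \<le> sum \<theta> (V - key i ` (W - D))" for i
        using fin \<theta> by (intro sum_mono2) auto
      have "sum \<theta> (V - key j ` W) + \<theta> v = sum \<theta> (insert v (V - key j ` W))"
        using fin \<omega> by (subst sum.insert) (auto simp: v_def)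
      also have "\<dots> \<le> sum \<theta> (V - key j ` (W - D))"
        using fin \<theta> vV by (intro sum_mono2) (auto simp: D_def)
      finally have j_gain: "sum \<theta> (V - key j ` W) + \<theta> v \<le> sum \<theta> (V - key j ` (W - D))" .
      have "(\<Sum>i<k. sum \<theta> (V - key i ` W) + (if i = j then \<theta> v else 0)) \<le> (\<Sum>i<k. sum \<theta> (V - key i ` (W - D)))"
        using mono j_gain by (intro sum_mono) auto
      then have "(\<Sum>i<k. sum \<theta> (V - key i ` W)) + \<theta> v \<le> (\<Sum>i<k. sum \<theta> (V - key i ` (W - D)))"
        using j by (simp add: sum.distrib)
      then have "\<Psi> W < \<Psi> (W - D)" using less cW by (simp add: \<Psi>_def)
      moreover have "\<Psi> (W - D) \<le> \<Psi> W" using W(1) by (intro max) auto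
      ultimately show False by simp
    qed
  qed
qed

definition chain_members :: "'b set set \<Rightarrow> 'b list \<Rightarrow> 'b set set" where
  "chain_members F \<sigma> = {x \<in> F. on_chain \<sigma> x}"

definition chain_rank :: "'b set set \<Rightarrow> 'b list \<Rightarrow> 'b set \<Rightarrow> nat" where
  "chain_rank F \<sigma> x = card {z \<in> chain_members F \<sigma>. z \<subset> x}"

definition chain_nth :: "'b set set \<Rightarrow> 'b list \<Rightarrow> nat \<Rightarrow> 'b set" where
  "chain_nth F \<sigma> = inv_into (chain_members F \<sigma>) (chain_rank F \<sigma>)"

lemma on_chain_finite: "on_chain \<sigma> x \<Longrightarrow> finite x"
  unfolding on_chain_def by (erule subst) simp

lemma on_chain_linear:
  assumes "on_chain \<sigma> x" "on_chain \<sigma> y" "x \<noteq> y"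
  shows "x \<subset> y \<or> y \<subset> x"
  using on_chain_subset[OF assms(1,2)] on_chain_subset[OF assms(2,1)] assms(3)
  by (cases "card x \<le> card y") auto

context
  fixes F :: "'b set set"
  assumes finF: "finite F"
begin

lemma finite_chain_members: "finite (chain_members F \<sigma>)"
  using finF by (simp add: chain_members_def)

lemma chain_rank_less:
  assumes "x \<in> chain_members F \<sigma>" "x \<subset> y"
  shows "chain_rank F \<sigma> x < chain_rank F \<sigma> y"
  unfolding chain_rank_def using assms finite_chain_members
  by (intro psubset_card_mono) auto

lemma chain_rank_bij:
  "bij_betw (chain_rank F \<sigma>) (chain_members F \<sigma>) {..<card (chain_members F \<sigma>)}"
proof -
  have inj: "inj_on (chain_rank F \<sigma>) (chain_members F \<sigma>)"
  proof (rule inj_onI, rule ccontr)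
    fix x y assume xy: "x \<in> chain_members F \<sigma>" "y \<in> chain_members F \<sigma>" and eq: "chain_rank F \<sigma> x = chain_rank F \<sigma> y" and "x \<noteq> y"
    then have "x \<subset> y \<or> y \<subset> x" by (intro on_chain_linear[of \<sigma>]) (auto simp: chain_members_def)
    then show False using chain_rank_less[OF xy(1), of y] chain_rank_less[OF xy(2), of x] eq by auto
  qed
  have "chain_rank F \<sigma> ` chain_members F \<sigma> \<subseteq> {..<card (chain_members F \<sigma>)}"
    unfolding chain_rank_def using finite_chain_members by (auto intro!: psubset_card_mono)
  then have "chain_rank F \<sigma> ` chain_members F \<sigma> = {..<card (chain_members F \<sigma>)}"
    using card_image[OF inj] by (intro card_subset_eq) auto
  with inj show ?thesis by (simp add: bij_betw_def)
qed

lemma chain_nth: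
  assumes "m < card (chain_members F \<sigma>)"
  shows "chain_nth F \<sigma> m \<in> chain_members F \<sigma>" "chain_rank F \<sigma> (chain_nth F \<sigma> m) = m"
proof -
  have "m \<in> chain_rank F \<sigma> ` chain_members F \<sigma>"
    using chain_rank_bij[of \<sigma>] assms by (simp add: bij_betw_def)
  then show "chain_nth F \<sigma> m \<in> chain_members F \<sigma>" "chain_rank F \<sigma> (chain_nth F \<sigma> m) = m"
    unfolding chain_nth_def by (auto simp: inv_into_into f_inv_into_f)
qed

text \<open>The \<open>m' - m\<close> members with ranks from \<open>m\<close> to
  \<open>m' - 1\<close> have distinct sizes, all at least that of the first set and below that of
  the second. A gap in rank is therefore at least as large a gap in level.\<close>

lemma chain_nth_gap:
  assumes "m < m'" "m' < card (chain_members F \<sigma>)"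
  shows "chain_nth F \<sigma> m \<subset> chain_nth F \<sigma> m'" "card (chain_nth F \<sigma> m) + (m' - m) \<le> card (chain_nth F \<sigma> m')"
proof -
  let ?x = "chain_nth F \<sigma> m" and ?y = "chain_nth F \<sigma> m'"
  have x: "?x \<in> chain_members F \<sigma>" "chain_rank F \<sigma> ?x = m" and y: "?y \<in> chain_members F \<sigma>" "chain_rank F \<sigma> ?y = m'"
    using chain_nth[of m] chain_nth[of m'] assms by auto
  have ne: "?x \<noteq> ?y" using x y assms by auto
  then have "?x \<subset> ?y \<or> ?y \<subset> ?x" using x y by (intro on_chain_linear[of \<sigma>]) (auto simp: chain_members_def)
  then show sub: "?x \<subset> ?y" using chain_rank_less[OF y(1), of ?x] x y assms by auto
  let ?Z = "{z \<in> chain_members F \<sigma>. z \<subset> ?y} - {z \<in> chain_members F \<sigma>. z \<subset> ?x}"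
  have "card ?Z = m' - m"
    using x(2) y(2) sub finite_chain_members unfolding chain_rank_def by (subst card_Diff_subset) auto
  moreover have "card ?Z = card (card ` ?Z)"
  proof (rule card_image[symmetric], rule inj_onI, rule ccontr)
    fix z z' assume "z \<in> ?Z" "z' \<in> ?Z" and eq: "card z = card z'" and "z \<noteq> z'"
    then have o: "on_chain \<sigma> z" "on_chain \<sigma> z'" by (auto simp: chain_members_def)
    show False using on_chain_subset[OF o] on_chain_subset[OF o(2,1)] eq \<open>z \<noteq> z'\<close> by auto
  qed
  moreover have "card ` ?Z \<subseteq> {card ?x..<card ?y}"
  proof (rule image_subsetI)
    fix z assume "z \<in> ?Z"
    then have z: "z \<in> chain_members F \<sigma>" "z \<subset> ?y" and n: "\<not> z \<subset> ?x" by auto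
    have o: "on_chain \<sigma> z" "on_chain \<sigma> ?x" "on_chain \<sigma> ?y" using z x y by (auto simp: chain_members_def)
    have "card z < card ?y" using z(2) on_chain_finite[OF o(3)] by (rule psubset_card_mono[rotated])
    moreover have "?x \<subseteq> z" using on_chain_linear[OF o(1,2)] n z by auto
    then have "card ?x \<le> card z" using on_chain_finite[OF o(1)] by (intro card_mono)
    ultimately show "card z \<in> {card ?x..<card ?y}" by simp
  qed
  then have "card (card ` ?Z) \<le> card ?y - card ?x"
    using card_mono[of "{card ?x..<card ?y}" "card ` ?Z"] by simp
  moreover have "card ?x \<le> card ?y"
    using sub y on_chain_finite[of \<sigma> ?y] by (intro card_mono) (auto simp: chain_members_def)
  ultimately show "card ?x + (m' - m) \<le> card ?y" by linarith
qed

end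

definition lubell :: "'b set \<Rightarrow> 'b set \<Rightarrow> real" where
  "lubell A x = 1 / real (card A choose card x)"

lemma lubell_chains:
  assumes "finite A" "x \<subseteq> A"
  shows "real (card (chains_through A x)) = fact (card A) * lubell A x"
proof -
  have "card x \<le> card A" using assms by (simp add: card_mono)
  then show ?thesis
    using assms by (simp add: card_chains_through lubell_def binomial_fact)
qed

text \<open>A window is a chain with \<open>k\<close> of its members in \<open>F\<close>, at ranks \<open>i, i + g, ..., i + g(k - 1)\<close>; \<open>B j j' x y\<close> collects
  the chains having a window, not pruned away, with \<open>j\<close>-th entry \<open>x\<close> and \<open>j'\<close>-th entry \<open>y\<close>.\<close>
lemma chain_windows:
  fixes F :: "'b set set" and g k :: nat and \<epsilon> :: real
  assumes A: "finite A" and F: "F \<subseteq> Pow A" and k: "0 < k" and g: "0 < g" and \<epsilon>: "0 < \<epsilon>"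
    and big: "\<epsilon> * sum (lubell A) F \<le> sum (lubell A) F - real (g * (k - 1))"
  obtains G :: "nat \<Rightarrow> 'b set set" and B :: "nat \<Rightarrow> nat \<Rightarrow> 'b set \<Rightarrow> 'b set \<Rightarrow> 'b list set" where
    "\<And>j. j < k \<Longrightarrow> G j \<subseteq> F"
    "\<And>j. j < k \<Longrightarrow> \<epsilon> / 2 * sum (lubell A) F \<le> sum (lubell A) (G j)"
    "\<And>j j' x y. j < k \<Longrightarrow> j' < k \<Longrightarrow> B j j' x y \<subseteq> chains_through A x \<inter> chains_through A y"
    "\<And>j j' x y. B j j' x y = B j' j y x"
    "\<And>j j' x y y'. j < k \<Longrightarrow> y \<noteq> y' \<Longrightarrow> B j j' x y \<inter> B j j' x y' = {}"
    "\<And>j j' x y \<sigma>. j < j' \<Longrightarrow> j' < k \<Longrightarrow> \<sigma> \<in> B j j' x y \<Longrightarrow> x \<subset> y \<and> card x + g \<le> card y"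
    "\<And>j j' x. j < k \<Longrightarrow> j' < k \<Longrightarrow> x \<in> G j \<Longrightarrow>
       \<epsilon> / (2 * real k) * real (card (chains_through A x)) \<le> real (card (\<Union>y\<in>G j'. B j j' x y))"
proof -
  define \<Omega> where "\<Omega> = permutations_of_set A"
  define \<Lambda> where "\<Lambda> = sum (lubell A) F"
  define X where "X \<sigma> = card (chain_members F \<sigma>)" for \<sigma>
  define n where "n = card A"
  have finF: "finite F" using F A finite_subset by auto
  have fin\<Omega>: "finite \<Omega>" by (simp add: \<Omega>_def)
  have card\<Omega>: "card \<Omega> = fact n" using A by (simp add: \<Omega>_def n_def)
  have XF: "X \<sigma> \<le> card F" for \<sigma> unfolding X_def chain_members_def using finF by (intro card_mono) auto
  define W0 where "W0 = (SIGMA \<sigma>:\<Omega>. {i. i + g * (k - 1) < X \<sigma>})"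
  have fini: "finite {i. i + c < X \<sigma>}" for c \<sigma> by (rule finite_subset[of _ "{..<X \<sigma>}"]) auto
  have finW0: "finite W0" unfolding W0_def using fin\<Omega> fini by blast
  have sumX: "(\<Sum>\<sigma>\<in>\<Omega>. real (X \<sigma>)) = fact n * \<Lambda>"
  proof -
    have "(\<Sum>\<sigma>\<in>\<Omega>. real (X \<sigma>)) = (\<Sum>\<sigma>\<in>\<Omega>. \<Sum>x\<in>F. if on_chain \<sigma> x then 1 else 0)"
      unfolding X_def chain_members_def using finF by (simp flip: sum.inter_filter)
    also have "\<dots> = (\<Sum>x\<in>F. \<Sum>\<sigma>\<in>\<Omega>. if on_chain \<sigma> x then 1 else 0)" by (rule sum.swap)
    also have "\<dots> = (\<Sum>x\<in>F. real (card (chains_through A x)))"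
      using fin\<Omega> by (simp add: chains_through_def \<Omega>_def flip: sum.inter_filter)
    also have "\<dots> = (\<Sum>x\<in>F. fact n * lubell A x)"
      using F by (intro sum.cong refl) (auto simp: n_def intro!: lubell_chains[OF A])
    finally show ?thesis by (simp add: \<Lambda>_def sum_distrib_left)
  qed
  have "fact n * (\<epsilon> * \<Lambda>) \<le> fact n * (\<Lambda> - real (g * (k - 1)))"
    using big by (intro mult_left_mono) (auto simp: \<Lambda>_def)
  also have "\<dots> = (\<Sum>\<sigma>\<in>\<Omega>. real (X \<sigma>) - real (g * (k - 1)))"
    by (simp add: sum_subtractf sumX card\<Omega> right_diff_distrib)
  also have "\<dots> \<le> (\<Sum>\<sigma>\<in>\<Omega>. real (card {i. i + g * (k - 1) < X \<sigma>}))"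
  proof (rule sum_mono)
    fix \<sigma>
    \<comment> \<open>For a chain with too few members the natural difference is truncated to zero
      while the real difference on the left is not positive, so such chains need no separate
      treatment.\<close>
    have "{i. i + g * (k - 1) < X \<sigma>} = {..<X \<sigma> - g * (k - 1)}" by auto
    then show "real (X \<sigma>) - real (g * (k - 1)) \<le> real (card {i. i + g * (k - 1) < X \<sigma>})"
      by (simp only: card_lessThan)
  qed
  also have "\<dots> = real (card W0)" unfolding W0_def using fin\<Omega> fini by simp
  finally have cardW0: "fact n * (\<epsilon> * \<Lambda>) \<le> real (card W0)" .
  define el where "el j \<omega> = (case \<omega> of (\<sigma>, i) \<Rightarrow> chain_nth F \<sigma> (i + g * j))" for j \<omega>
  have elW0: "i + g * j < X \<sigma>" "\<sigma> \<in> \<Omega>" if "(\<sigma>, i) \<in> W0" "j < k" for \<sigma> i j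
  proof -
    have "g * j \<le> g * (k - 1)" using that by (intro mult_left_mono) auto
    moreover have "i + g * (k - 1) < X \<sigma>" using that by (simp add: W0_def)
    ultimately show "i + g * j < X \<sigma>" by linarith
    show "\<sigma> \<in> \<Omega>" using that by (simp add: W0_def)
  qed
  have el: "el j (\<sigma>, i) \<in> F" "on_chain \<sigma> (el j (\<sigma>, i))" "\<sigma> \<in> \<Omega>" "chain_rank F \<sigma> (el j (\<sigma>, i)) = i + g * j"
    if "(\<sigma>, i) \<in> W0" "j < k" for \<sigma> i j
    using elW0[OF that] chain_nth[OF finF, of "i + g * j" \<sigma>] by (auto simp: el_def X_def chain_members_def)
  \<comment> \<open>Over all \<open>k\<close> positions the thresholds add up to half of the lower
    bound on \<open>card W0\<close>, so pruning leaves the other half.\<close>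
  define \<theta> where "\<theta> x = \<epsilon> / (2 * real k) * real (card (chains_through A x))" for x
  have \<theta>0: "0 \<le> \<theta> x" for x using \<epsilon> by (simp add: \<theta>_def)
  have sum\<theta>: "real k * sum \<theta> F = \<epsilon> / 2 * (fact n * \<Lambda>)"
  proof -
    have "sum \<theta> F = (\<Sum>x\<in>F. \<epsilon> / (2 * real k) * (fact n * lubell A x))"
      unfolding \<theta>_def n_def using F by (intro sum.cong refl) (auto simp: lubell_chains[OF A])
    also have "\<dots> = \<epsilon> / (2 * real k) * (fact n * \<Lambda>)" by (simp add: \<Lambda>_def sum_distrib_left)
    finally show ?thesis using k by simp
  qed
  obtain W where W: "W \<subseteq> W0" "real (card W0) - real k * sum \<theta> F \<le> real (card W)"
    "\<And>\<omega> j. \<omega> \<in> W \<Longrightarrow> j < k \<Longrightarrow> \<theta> (el j \<omega>) \<le> real (card {\<omega>' \<in> W. el j \<omega>' = el j \<omega>})"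
  proof (rule prune_windows[of W0 F k el \<theta>])
    show "el j \<omega> \<in> F" if "j < k" "\<omega> \<in> W0" for j \<omega> using el(1) that by (cases \<omega>) auto
  qed (use finW0 finF \<theta>0 in auto)
  have finW: "finite W" using W(1) finW0 by (rule finite_subset)
  have cardW: "\<epsilon> / 2 * (fact n * \<Lambda>) \<le> real (card W)"
    using W(2) cardW0 sum\<theta> by (simp add: field_simps)
  define G where "G j = el j ` W" for j
  define B where "B j j' x y = {\<sigma>. \<exists>i. (\<sigma>, i) \<in> W \<and> el j (\<sigma>, i) = x \<and> el j' (\<sigma>, i) = y}" for j j' x y
  \<comment> \<open>On a given chain one entry fixes the whole window, as its rank is
    \<open>i + g * j\<close>. Hence counting windows with a given entry is counting chains, and for
    a fixed entry \<open>x\<close> the sets \<open>B j j' x y\<close> are disjoint.\<close>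
  have inj: "i = i'" if "(\<sigma>, i) \<in> W" "(\<sigma>, i') \<in> W" "el j (\<sigma>, i) = el j (\<sigma>, i')" "j < k" for \<sigma> i i' j
  proof -
    have "(\<sigma>, i) \<in> W0" "(\<sigma>, i') \<in> W0" using that W(1) by auto
    from el(4)[OF this(1) that(4)] el(4)[OF this(2) that(4)] have "i + g * j = i' + g * j"
      unfolding that(3) by (rule trans[OF sym])
    then show ?thesis by simp
  qed
  have chW: "\<sigma> \<in> chains_through A (el j (\<sigma>, i))" if "(\<sigma>, i) \<in> W" "j < k" for \<sigma> i j
  proof -
    have "(\<sigma>, i) \<in> W0" using that W(1) by blast
    from el(2,3)[OF this that(2)] show ?thesis by (simp add: chains_through_def \<Omega>_def)
  qed
  have cardB: "card {\<omega> \<in> W. el j \<omega> = x} = card (fst ` {\<omega> \<in> W. el j \<omega> = x})" if "j < k" for j x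
  proof (rule card_image[symmetric], rule inj_onI)
    fix \<omega> \<omega>' assume *: "\<omega> \<in> {\<omega> \<in> W. el j \<omega> = x}" "\<omega>' \<in> {\<omega> \<in> W. el j \<omega> = x}" "fst \<omega> = fst \<omega>'"
    obtain \<sigma> i i' where "\<omega> = (\<sigma>, i)" "\<omega>' = (\<sigma>, i')" using *(3) by (cases \<omega>, cases \<omega>') simp
    with * inj[of \<sigma> i i' j, OF _ _ _ that] show "\<omega> = \<omega>'" by simp
  qed
  show ?thesis
  proof (rule that[of G B])
    fix j assume j: "j < k"
    show GF: "G j \<subseteq> F"
      unfolding G_def
    proof (rule image_subsetI)
      fix \<omega> assume "\<omega> \<in> W"
      then have "\<omega> \<in> W0" using W(1) by blast
      then show "el j \<omega> \<in> F" using el(1)[OF _ j] by (cases \<omega>) blast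
    qed
    have finG: "finite (G j)" using finW by (simp add: G_def)
    have "real (card W) = (\<Sum>x\<in>G j. real (card {\<omega> \<in> W. el j \<omega> = x}))"
      using sum.image_gen[OF finW, of "\<lambda>_. 1::real" "el j"] by (simp add: G_def)
    also have "\<dots> \<le> (\<Sum>x\<in>G j. real (card (chains_through A x)))"
    proof (rule sum_mono)
      fix x
      have "card (fst ` {\<omega> \<in> W. el j \<omega> = x}) \<le> card (chains_through A x)"
        by (rule card_mono) (use chW[OF _ j] in auto)
      then show "real (card {\<omega> \<in> W. el j \<omega> = x}) \<le> real (card (chains_through A x))"
        using cardB[OF j] by simp
    qed
    also have "\<dots> = (\<Sum>x\<in>G j. fact n * lubell A x)"
      using GF F by (intro sum.cong refl) (auto simp: n_def intro!: lubell_chains[OF A])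
    also have "\<dots> = fact n * sum (lubell A) (G j)" by (simp add: sum_distrib_left)
    finally have "real (card W) \<le> fact n * sum (lubell A) (G j)" .
    moreover have "fact n * (\<epsilon> / 2 * \<Lambda>) = \<epsilon> / 2 * (fact n * \<Lambda>)" by simp
    ultimately have "fact n * (\<epsilon> / 2 * \<Lambda>) \<le> fact n * sum (lubell A) (G j)" using cardW by linarith
    then have "\<epsilon> / 2 * \<Lambda> \<le> sum (lubell A) (G j)" by (rule mult_left_le_imp_le) simp
    then show "\<epsilon> / 2 * sum (lubell A) F \<le> sum (lubell A) (G j)" by (simp add: \<Lambda>_def)
  next
    fix j j' x y assume "j < k" "j' < k"
    then show "B j j' x y \<subseteq> chains_through A x \<inter> chains_through A y"
      using chW unfolding B_def by auto
  next
    show "B j j' x y = B j' j y x" for j j' x y by (auto simp: B_def)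
  next
    fix j j' x y y' assume j: "j < k" and "y \<noteq> (y' :: 'b set)"
    show "B j j' x y \<inter> B j j' x y' = {}"
    proof (rule equals0I)
      fix \<sigma> assume "\<sigma> \<in> B j j' x y \<inter> B j j' x y'"
      then obtain i i' where i: "(\<sigma>, i) \<in> W" "el j (\<sigma>, i) = x" "el j' (\<sigma>, i) = y"
        "(\<sigma>, i') \<in> W" "el j (\<sigma>, i') = x" "el j' (\<sigma>, i') = y'" by (auto simp: B_def)
      then have "i = i'" using inj[of \<sigma> i i' j] j by simp
      then show False using i \<open>y \<noteq> y'\<close> by simp
    qed
  next
    fix j j' x y \<sigma> assume j: "j < j'" "j' < k" "\<sigma> \<in> B j j' x y"
    then obtain i where i: "(\<sigma>, i) \<in> W0" "x = chain_nth F \<sigma> (i + g * j)" "y = chain_nth F \<sigma> (i + g * j')"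
      using W(1) by (auto simp: B_def el_def)
    have gap: "g * j + g \<le> g * j'" using j(1) mult_le_mono2[of "Suc j" j' g] by simp
    have "i + g * j' < card (chain_members F \<sigma>)" using elW0(1)[OF i(1) j(2)] by (simp add: X_def)
    moreover have "i + g * j < i + g * j'" using gap g by linarith
    ultimately have "x \<subset> y" "card x + ((i + g * j') - (i + g * j)) \<le> card y"
      using chain_nth_gap[OF finF, of "i + g * j" "i + g * j'" \<sigma>] i(2,3) by simp_all
    then show "x \<subset> y \<and> card x + g \<le> card y" using gap by linarith
  next
    fix j j' x assume j: "j < k" "j' < k" and "x \<in> G j"
    then obtain \<omega> where \<omega>: "\<omega> \<in> W" "x = el j \<omega>" by (auto simp: G_def)
    have "fst ` {\<omega> \<in> W. el j \<omega> = x} \<subseteq> (\<Union>y\<in>G j'. B j j' x y)"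
      by (force simp: B_def G_def)
    moreover have "finite (\<Union>y\<in>G j'. B j j' x y)"
      by (rule finite_subset[of _ "fst ` W"]) (use finW in \<open>force simp: B_def\<close>)+
    ultimately have "card (fst ` {\<omega> \<in> W. el j \<omega> = x}) \<le> card (\<Union>y\<in>G j'. B j j' x y)"
      by (intro card_mono)
    then show "\<epsilon> / (2 * real k) * real (card (chains_through A x)) \<le> real (card (\<Union>y\<in>G j'. B j j' x y))"
      using W(3)[OF \<omega>(1) j(1)] cardB[OF j(1), of x] \<omega>(2) by (simp add: \<theta>_def)
  qed
qed

section \<open>Unwanted comparabilities on a random chain\<close>

lemma nth_on_chain_mem:
  assumes "\<sigma> \<in> chains_through A x" "finite A" "t < card A"
  shows "\<sigma> ! t \<in> x \<longleftrightarrow> t < card x"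
proof -
  have *: "distinct \<sigma>" "length \<sigma> = card A" "set (take (card x) \<sigma>) = x"
    using assms(1) by (auto simp: chains_through_def on_chain_def dest: perm_setD)
  have "\<sigma> ! t \<in> set (take (card x) \<sigma>) \<longleftrightarrow> t < card x"
  proof
    assume "\<sigma> ! t \<in> set (take (card x) \<sigma>)"
    then obtain i where "i < card x" "i < length \<sigma>" "\<sigma> ! t = \<sigma> ! i" by (auto simp: in_set_conv_nth)
    then show "t < card x" using *(1,2) assms(3) by (simp add: nth_eq_iff_index_eq)
  next
    assume "t < card x"
    then show "\<sigma> ! t \<in> set (take (card x) \<sigma>)"
      using *(2) assms(3) by (auto simp: in_set_conv_nth intro!: exI[of _ t])
  qed
  then show ?thesis using *(3) by simp
qed

lemma card_chains_first_above_le: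
  assumes A: "finite A" "x \<subseteq> A" and D: "D \<subseteq> A - x" and T: "T \<subseteq> {card x..<card A}"
  shows "real (card {\<sigma> \<in> chains_through A x. \<exists>t\<in>T. \<sigma> ! t \<in> D})
    \<le> real (card T * card D) / real (card A - card x) * real (card (chains_through A x))"
proof -
  have fin: "finite D" "finite T" using A D T finite_subset[of D "A - x"] finite_subset[of T "{card x..<card A}"] by auto
  have "{\<sigma> \<in> chains_through A x. \<exists>t\<in>T. \<sigma> ! t \<in> D} = (\<Union>(t, a)\<in>T \<times> D. {\<sigma> \<in> chains_through A x. \<sigma> ! t = a})"
    by auto
  also have "real (card \<dots>) \<le> (\<Sum>(t, a)\<in>T \<times> D. real (card {\<sigma> \<in> chains_through A x. \<sigma> ! t = a}))"
    using card_UN_le[of "T \<times> D" "\<lambda>(t, a). {\<sigma> \<in> chains_through A x. \<sigma> ! t = a}"] fin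
    by (simp add: case_prod_unfold flip: of_nat_sum)
  also have "\<dots> = (\<Sum>(t, a)\<in>T \<times> D. real (card (chains_through A x)) / real (card A - card x))"
  proof (intro sum.cong refl, clarify)
    fix t a assume "t \<in> T" "a \<in> D"
    then have "a \<in> A - x" "card x \<le> t" "t < card A" using D T by auto
    then show "real (card {\<sigma> \<in> chains_through A x. \<sigma> ! t = a}) = real (card (chains_through A x)) / real (card A - card x)"
      by (rule card_chains_through_nth_above[OF A])
  qed
  finally show ?thesis by (simp add: card_cartesian_product case_prod_unfold)
qed

text \<open>A new image \<open>y\<close> above (below) \<open>x\<close> is bad if it is comparable to an earlier image in \<open>Z\<close> in a way that does
  not follow from the position of \<open>x\<close>.\<close>
definition bad_above :: "'b set set \<Rightarrow> 'b set \<Rightarrow> 'b set \<Rightarrow> bool" where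
  "bad_above Z x y \<longleftrightarrow> (\<exists>z\<in>Z. z \<subseteq> y \<and> \<not> z \<subseteq> x \<or> y \<subseteq> z)"

definition bad_below :: "'b set set \<Rightarrow> 'b set \<Rightarrow> 'b set \<Rightarrow> bool" where
  "bad_below Z x y \<longleftrightarrow> (\<exists>z\<in>Z. y \<subseteq> z \<and> \<not> x \<subseteq> z \<or> z \<subseteq> y)"

text \<open>Each \<open>z\<close> can spoil a chain in two ways. If \<open>z\<close> becomes
  contained, a fixed element of \<open>z - x\<close> must be added at one of at most
  \<open>hi - lo\<close> positions. If \<open>z\<close> contains the new image, the first element
  added after \<open>x\<close> already lies in \<open>z - x\<close>, which has at most
  \<open>hi - lo\<close> elements. Either event has probability at most
  \<open>\<beta>\<close>.\<close>

lemma few_bad_chains_above: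
  assumes A: "finite A" "x \<subseteq> A" and x: "lo \<le> card x" "card x \<le> hi" and hi: "hi < card A"
    and Z: "finite Z" "Z \<subseteq> Pow A" "\<And>z. z \<in> Z \<Longrightarrow> card z \<le> hi"
    and \<beta>: "real (hi - lo) \<le> \<beta> * real (card A - hi)"
  shows "real (card {\<sigma> \<in> chains_through A x. \<exists>y. y \<subseteq> A \<and> card y \<le> hi \<and> on_chain \<sigma> y \<and> x \<subset> y \<and> bad_above Z x y})
    \<le> 2 * real (card Z) * \<beta> * real (card (chains_through A x))" (is "real (card ?S) \<le> _")
proof -
  let ?c = "real (card (chains_through A x))"
  have finx: "finite x" using A finite_subset by blast
  have ratio: "real m / real (card A - card x) \<le> \<beta>" if "m \<le> hi - lo" for m
  proof -
    have \<beta>0: "0 \<le> \<beta>" using \<beta> hi by (smt (verit) of_nat_0_le_iff of_nat_0_less_iff zero_less_diff zero_le_mult_iff)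
    have "real m \<le> \<beta> * real (card A - hi)" using that \<beta> by (meson of_nat_mono order_trans)
    also have "\<dots> \<le> \<beta> * real (card A - card x)" using x \<beta>0 by (intro mult_left_mono) auto
    finally show ?thesis using x hi by (simp add: divide_le_eq)
  qed
  define S1 where "S1 a = {\<sigma> \<in> chains_through A x. \<exists>t\<in>{card x..<hi}. \<sigma> ! t \<in> {a}}" for a
  define S2 where "S2 z = {\<sigma> \<in> chains_through A x. \<exists>t\<in>{card x}. \<sigma> ! t \<in> z - x}" for z
  have c1: "real (card (S1 a)) \<le> \<beta> * ?c" if "a \<in> A - x" for a
  proof -
    have "real (card (S1 a)) \<le> real (card {card x..<hi} * card {a}) / real (card A - card x) * ?c"
      unfolding S1_def by (rule card_chains_first_above_le[OF A]) (use that hi in auto)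
    also have "\<dots> \<le> \<beta> * ?c" using x by (intro mult_right_mono ratio) auto
    finally show ?thesis .
  qed
  have c2: "real (card (S2 z)) \<le> \<beta> * ?c" if z: "z \<in> Z" "x \<subseteq> z" for z
  proof -
    have "real (card (S2 z)) \<le> real (card {card x} * card (z - x)) / real (card A - card x) * ?c"
      unfolding S2_def by (rule card_chains_first_above_le[OF A]) (use z Z hi x in auto)
    also have "\<dots> \<le> \<beta> * ?c"
    proof (intro mult_right_mono ratio)
      show "card {card x} * card (z - x) \<le> hi - lo"
        using card_Diff_subset[OF finx z(2)] Z(3)[OF z(1)] x by simp
    qed auto
    finally show ?thesis .
  qed
  \<comment> \<open>One witness suffices: a chain member that contains \<open>z\<close> contains
    this element.\<close>
  define a where "a z = (SOME a. a \<in> z - x)" for z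
  have a: "a z \<in> z - x" if "\<not> z \<subseteq> x" for z
    unfolding a_def by (rule someI_ex) (use that in auto)
  define S where "S z = (if \<not> z \<subseteq> x then S1 (a z) else {}) \<union> (if x \<subseteq> z then S2 z else {})" for z
  have "?S \<subseteq> (\<Union>z\<in>Z. S z)"
  proof
    fix \<sigma> assume "\<sigma> \<in> ?S"
    then obtain y z where \<sigma>: "\<sigma> \<in> chains_through A x" and y: "y \<subseteq> A" "card y \<le> hi" "on_chain \<sigma> y" "x \<subset> y"
      and z: "z \<in> Z" "z \<subseteq> y \<and> \<not> z \<subseteq> x \<or> y \<subseteq> z" by (auto simp: bad_above_def)
    have \<sigma>y: "\<sigma> \<in> chains_through A y" using \<sigma> y by (simp add: chains_through_def)
    note memx = nth_on_chain_mem[OF \<sigma> A(1)] and memy = nth_on_chain_mem[OF \<sigma>y A(1)]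
    have finy: "finite y" using y(1) A(1) finite_subset by blast
    from z(2) have "\<sigma> \<in> S z"
    proof
      assume *: "z \<subseteq> y \<and> \<not> z \<subseteq> x"
      then have az: "a z \<in> y" "a z \<notin> x" "a z \<in> A" using a[of z] y by auto
      then have "a z \<in> set \<sigma>" using perm_setD(1)[of \<sigma> A] \<sigma> by (simp add: chains_through_def)
      then obtain t where t: "t < card A" "\<sigma> ! t = a z"
        using perm_setD(3)[of \<sigma> A] \<sigma> by (auto simp: chains_through_def in_set_conv_nth)
      have "t < card y" "\<not> t < card x" using memx[OF t(1)] memy[OF t(1)] t(2) az by auto
      then have "\<sigma> \<in> S1 (a z)" using \<sigma> t y by (auto simp: S1_def intro!: bexI[of _ t])
      then show ?thesis using * by (simp add: S_def)
    next
      assume *: "y \<subseteq> z"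
      \<comment> \<open>With indices from zero, position \<open>card x\<close> holds the first
        element added after \<open>x\<close>; it belongs to every larger member of the
        chain.\<close>
      have "card x < card y" using y(4) finy by (rule psubset_card_mono[rotated])
      moreover have "card x < card A" using x hi by simp
      ultimately have "\<sigma> ! card x \<in> y - x" using memx[of "card x"] memy[of "card x"] by auto
      then have "\<sigma> \<in> S2 z" using \<sigma> * by (auto simp: S2_def)
      then show ?thesis using * y by (auto simp: S_def)
    qed
    then show "\<sigma> \<in> (\<Union>z\<in>Z. S z)" using z by auto
  qed
  moreover have finS: "finite (S z)" for z by (simp add: S_def S1_def S2_def)
  ultimately have "card ?S \<le> card (\<Union>z\<in>Z. S z)" using Z(1) by (intro card_mono) auto
  also have "\<dots> \<le> (\<Sum>z\<in>Z. card (S z))" using Z(1) by (rule card_UN_le)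
  finally have "real (card ?S) \<le> real (\<Sum>z\<in>Z. card (S z))" by (rule of_nat_mono)
  also have "real (\<Sum>z\<in>Z. card (S z)) = (\<Sum>z\<in>Z. real (card (S z)))" by simp
  also have "\<dots> \<le> (\<Sum>z\<in>Z. 2 * \<beta> * ?c)"
  proof (rule sum_mono)
    fix z assume z: "z \<in> Z"
    have \<beta>c: "0 \<le> \<beta> * ?c" using ratio[of 0] by simp
    have "card (S z) \<le> card (if \<not> z \<subseteq> x then S1 (a z) else {}) + card (if x \<subseteq> z then S2 z else {})"
      unfolding S_def by (rule card_Un_le)
    then have "real (card (S z)) \<le> real (card (if \<not> z \<subseteq> x then S1 (a z) else {})) + real (card (if x \<subseteq> z then S2 z else {}))"
      by (simp only: of_nat_mono flip: of_nat_add)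
    also have "\<dots> \<le> \<beta> * ?c + \<beta> * ?c"
      using c1[of "a z"] c2[OF z] a[of z] z Z(2) \<beta>c by (intro add_mono) auto
    finally show "real (card (S z)) \<le> 2 * \<beta> * ?c" by simp
  qed
  finally show ?thesis by simp
qed

lemma on_chain_rev:
  assumes \<sigma>: "\<sigma> \<in> permutations_of_set A" and x: "x \<subseteq> A" "on_chain \<sigma> x"
  shows "on_chain (rev \<sigma>) (A - x)"
proof -
  note perm = perm_setD[OF \<sigma>]
  have cx: "card (A - x) = length \<sigma> - card x"
    using x perm by (metis List.finite_set card_Diff_subset finite_subset)
  have le: "card x \<le> length \<sigma>" using x perm by (metis List.finite_set card_mono)
  have "set (drop (card x) \<sigma>) = A - x"
    using x(2) perm(1,2) set_take_disj_set_drop_if_distinct[OF perm(2), of "card x" "card x"]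
      set_append[of "take (card x) \<sigma>" "drop (card x) \<sigma>"] by (auto simp: on_chain_def)
  then show ?thesis using cx le by (simp add: on_chain_def take_rev)
qed

text \<open>Reversing a permutation replaces its prefixes by their complements. This exchanges the
  two directions, with the size range \<open>lo..hi\<close> becoming
  \<open>card A - hi..card A - lo\<close>.\<close>

lemma few_bad_chains_below:
  assumes A: "finite A" "x \<subseteq> A" and x: "lo \<le> card x" "card x \<le> hi" and lo: "0 < lo"
    and Z: "finite Z" "Z \<subseteq> Pow A" "\<And>z. z \<in> Z \<Longrightarrow> lo \<le> card z"
    and \<beta>: "real (hi - lo) \<le> \<beta> * real lo"
  shows "real (card {\<sigma> \<in> chains_through A x. \<exists>y. y \<subseteq> A \<and> lo \<le> card y \<and> on_chain \<sigma> y \<and> y \<subset> x \<and> bad_below Z x y})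
    \<le> 2 * real (card Z) * \<beta> * real (card (chains_through A x))" (is "real (card ?S) \<le> _")
proof -
  have cA: "card (A - y) = card A - card y" "card y \<le> card A" if "y \<subseteq> A" for y
    using that A(1) by (auto simp: card_Diff_subset finite_subset card_mono)
  let ?Z = "(\<lambda>z. A - z) ` Z" and ?hi = "card A - lo"
  let ?T = "{\<sigma> \<in> chains_through A (A - x). \<exists>y. y \<subseteq> A \<and> card y \<le> ?hi \<and> on_chain \<sigma> y \<and> A - x \<subset> y \<and> bad_above ?Z (A - x) y}"
  have loA: "lo \<le> card A" using x cA(2)[OF A(2)] by simp
  have "rev ` ?S \<subseteq> ?T"
  proof (rule image_subsetI)
    fix \<sigma> assume "\<sigma> \<in> ?S"
    then obtain y z where \<sigma>: "\<sigma> \<in> permutations_of_set A" "on_chain \<sigma> x"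
      and y: "y \<subseteq> A" "lo \<le> card y" "on_chain \<sigma> y" "y \<subset> x"
      and z: "z \<in> Z" "y \<subseteq> z \<and> \<not> x \<subseteq> z \<or> z \<subseteq> y" by (auto simp: chains_through_def bad_below_def)
    have "bad_above ?Z (A - x) (A - y)"
      unfolding bad_above_def by (rule bexI[of _ "A - z"]) (use z A(2) in auto)
    moreover have "A - x \<subset> A - y" using y A(2) by auto
    moreover have "card (A - y) \<le> ?hi" using cA(1)[OF y(1)] y(2) by simp
    moreover have "rev \<sigma> \<in> permutations_of_set A" using \<sigma>(1) by (simp add: permutations_of_set_def)
    ultimately show "rev \<sigma> \<in> ?T"
      using on_chain_rev[OF \<sigma>(1) A(2) \<sigma>(2)] on_chain_rev[OF \<sigma>(1) y(1,3)] by (auto simp: chains_through_def)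
  qed
  then have "card ?S \<le> card ?T" by (intro card_inj_on_le[of rev]) auto
  then have "real (card ?S) \<le> real (card ?T)" by simp
  also have "\<dots> \<le> 2 * real (card ?Z) * \<beta> * real (card (chains_through A (A - x)))"
  proof (rule few_bad_chains_above[where lo = "card A - hi"])
    show "real (?hi - (card A - hi)) \<le> \<beta> * real (card A - ?hi)"
    proof -
      have "?hi - (card A - hi) \<le> hi - lo" "card A - ?hi = lo" using loA by auto
      then show ?thesis using \<beta> by (metis of_nat_mono order_trans)
    qed
    have "card (A - z) \<le> ?hi" if "z \<in> Z" for z using cA(1)[of z] Z(2) Z(3)[OF that] that by auto
    then show "card z \<le> ?hi" if "z \<in> ?Z" for z using that by blast
  qed (use A Z x lo loA cA[OF A(2)] in auto)
  also have "card ?Z = card Z" using Z(2) by (intro card_image inj_onI) blast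
  also have "card (chains_through A (A - x)) = card (chains_through A x)"
    using A cA[OF A(2)] by (simp add: card_chains_through)
  finally show ?thesis .
qed

section \<open>Embedding a tree along chains\<close>

lemma sum_extend_functions:
  assumes "finite H" "finite H'" "H \<subseteq> {..<m} \<rightarrow>\<^sub>E F"
    and "\<And>f. f \<in> H' \<Longrightarrow> f \<in> {..<Suc m} \<rightarrow>\<^sub>E F \<and> restrict f {..<m} \<in> H"
  shows "sum \<phi> H' = (\<Sum>g\<in>H. \<Sum>y | g(m := y) \<in> H'. \<phi> (g(m := y)))"
proof -
  have "sum \<phi> H' = (\<Sum>g\<in>H. \<Sum>f | f \<in> H' \<and> restrict f {..<m} = g. \<phi> f)"
    by (rule sum.group[symmetric]) (use assms in auto)
  also have "\<dots> = (\<Sum>g\<in>H. \<Sum>y | g(m := y) \<in> H'. \<phi> (g(m := y)))"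
  proof (rule sum.cong[OF refl])
    fix g assume g: "g \<in> H"
    then have gE: "g \<in> {..<m} \<rightarrow>\<^sub>E F" using assms(3) by blast
    have r: "restrict (g(m := y)) {..<m} = g" for y
      using gE by (auto simp: fun_eq_iff restrict_def PiE_iff extensional_def)
    show "(\<Sum>f | f \<in> H' \<and> restrict f {..<m} = g. \<phi> f) = (\<Sum>y | g(m := y) \<in> H'. \<phi> (g(m := y)))"
    proof (rule sum.reindex_bij_witness[of _ "\<lambda>y. g(m := y)" "\<lambda>f. f m"])
      fix f assume f: "f \<in> {f. f \<in> H' \<and> restrict f {..<m} = g}"
      then have "g(m := f m) = f" using upd_restrict[of f m F] assms(4) by auto
      then show "g(m := f m) = f" "f m \<in> {y. g(m := y) \<in> H'}" "\<phi> (g(m := f m)) = \<phi> f" using f by auto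
    qed (use r in auto)
  qed
  finally show ?thesis .
qed

text \<open>For antisymmetric \<open>R\<close> the equivalence forces injectivity, since equal
  images contain each other; the members are then exactly the ordered induced copies.\<close>

definition embeddings :: "nat \<Rightarrow> (nat \<Rightarrow> nat \<Rightarrow> bool) \<Rightarrow> 'b set set \<Rightarrow> (nat \<Rightarrow> 'b set) set" where
  "embeddings r R F = {f \<in> {..<r} \<rightarrow>\<^sub>E F. \<forall>i<r. \<forall>j<r. R i j \<longleftrightarrow> f i \<subseteq> f j}"

lemma capped_extend_zero:
  assumes "capped r p \<tau> H \<mu>" "H \<subseteq> H'" "finite H'"
  shows "capped r p \<tau> H' (\<lambda>f. if f \<in> H then \<mu> f else 0)"
    "(\<Sum>f\<in>H'. if f \<in> H then \<mu> f else 0) = sum \<mu> H"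
proof -
  have eq: "(\<Sum>f | f \<in> H' \<and> Q f. if f \<in> H then \<mu> f else 0) = (\<Sum>f | f \<in> H \<and> Q f. \<mu> f)" for Q
    by (rule sum.mono_neutral_cong_right) (use assms(2,3) in auto)
  show "capped r p \<tau> H' (\<lambda>f. if f \<in> H then \<mu> f else 0)"
    unfolding capped_def eq using assms(1) by (auto simp: capped_def)
  show "(\<Sum>f\<in>H'. if f \<in> H then \<mu> f else 0) = sum \<mu> H"
    using eq[of "\<lambda>_. True"] by simp
qed

lemma sum_at_most_one:
  assumes "\<And>y. P y \<Longrightarrow> y = c"
  shows "(\<Sum>y | P y. \<phi> y) = (if P c then \<phi> c else (0 :: real))"
proof (cases "P c")
  case True
  then have "{y. P y} = {c}" using assms by blast
  then show ?thesis using True by simp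
next
  case False
  then have "{y. P y} = {}" using assms by blast
  then show ?thesis using False by simp
qed

text \<open>The outcome of \<open>chain_windows\<close> together with the numerical facts about
  layers: \<open>\<delta>\<close> is the fraction of chains that still carry a window through a
  given entry, \<open>\<tau>\<close> bounds the probability of meeting a second set at distance at
  least \<open>g\<close>, and \<open>\<beta>\<close> bounds each kind of unwanted
  comparability.\<close>

locale chain_kernel =
  fixes A :: "'b set" and F :: "'b set set" and k g lo hi :: nat and \<delta> \<tau> \<beta> :: real
    and G :: "nat \<Rightarrow> 'b set set" and B :: "nat \<Rightarrow> nat \<Rightarrow> 'b set \<Rightarrow> 'b set \<Rightarrow> 'b list set"
  assumes finA: "finite A" and FA: "F \<subseteq> Pow A"
    and lo: "0 < lo" "\<And>x. x \<in> F \<Longrightarrow> lo \<le> card x" and hi: "hi < card A" "\<And>x. x \<in> F \<Longrightarrow> card x \<le> hi"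
    and GF: "\<And>j. j < k \<Longrightarrow> G j \<subseteq> F"
    and Bsub: "\<And>j j' x y. j < k \<Longrightarrow> j' < k \<Longrightarrow> B j j' x y \<subseteq> chains_through A x \<inter> chains_through A y"
    and Bsym: "\<And>j j' x y. B j j' x y = B j' j y x"
    and Bdisj: "\<And>j j' x y y'. j < k \<Longrightarrow> y \<noteq> y' \<Longrightarrow> B j j' x y \<inter> B j j' x y' = {}"
    and Bgap: "\<And>j j' x y \<sigma>. j < j' \<Longrightarrow> j' < k \<Longrightarrow> \<sigma> \<in> B j j' x y \<Longrightarrow> x \<subset> y \<and> card x + g \<le> card y"
    and Bbig: "\<And>j j' x. j < k \<Longrightarrow> j' < k \<Longrightarrow> x \<in> G j \<Longrightarrow>
       \<delta> * real (card (chains_through A x)) \<le> real (card (\<Union>y\<in>G j'. B j j' x y))"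
    and \<tau>: "0 < \<tau>" "\<And>x y. x \<in> F \<Longrightarrow> y \<in> F \<Longrightarrow> x \<subset> y \<Longrightarrow> card x + g \<le> card y \<Longrightarrow>
       real (card (chains_through A x \<inter> chains_through A y)) \<le> \<tau> * real (card (chains_through A x)) \<and>
       real (card (chains_through A x \<inter> chains_through A y)) \<le> \<tau> * real (card (chains_through A y))"
    and \<beta>: "0 \<le> \<beta>" "real (hi - lo) \<le> \<beta> * real lo" "real (hi - lo) \<le> \<beta> * real (card A - hi)"
begin

lemma finF: "finite F" using FA finA finite_subset by auto

lemma chains_pos: "x \<in> F \<Longrightarrow> 0 < real (card (chains_through A x))"
  using FA card_chains_through[OF finA, of x] by auto

lemma finB: "j < k \<Longrightarrow> j' < k \<Longrightarrow> finite (B j j' x y)"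
  by (rule finite_subset[OF Bsub]) auto

text \<open>The probability that a random chain through \<open>x\<close> carries a surviving window
  with \<open>x\<close> and \<open>y\<close> at positions \<open>j\<close> and \<open>j'\<close>.
  The total over \<open>y\<close> may be less than one.\<close>

definition kern :: "nat \<Rightarrow> nat \<Rightarrow> 'b set \<Rightarrow> 'b set \<Rightarrow> real" where
  "kern j j' x y = real (card (B j j' x y)) / real (card (chains_through A x))"

lemma kern_nonneg: "0 \<le> kern j j' x y" by (simp add: kern_def)

lemma kern_le:
  assumes "j < k" "j' < k" "j \<noteq> j'" "x \<in> F" "y \<in> F"
  shows "kern j j' x y \<le> \<tau>"
proof (cases "B j j' x y = {}")
  case True
  then show ?thesis using \<tau>(1) by (simp add: kern_def)
next
  case False
  then obtain \<sigma> where \<sigma>: "\<sigma> \<in> B j j' x y" by blast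
  have "card (B j j' x y) \<le> card (chains_through A x \<inter> chains_through A y)"
    using Bsub[OF assms(1,2)] by (intro card_mono) auto
  then have "real (card (B j j' x y)) \<le> real (card (chains_through A x \<inter> chains_through A y))" by simp
  also have "\<dots> \<le> \<tau> * real (card (chains_through A x))"
  proof (cases "j < j'")
    case True
    show ?thesis using \<tau>(2)[OF assms(4,5)] Bgap[OF True assms(2) \<sigma>] by blast
  next
    case False
    then have "j' < j" using assms(3) by simp
    from Bgap[OF this assms(1), of \<sigma> y x] \<sigma> have "y \<subset> x \<and> card y + g \<le> card x"
      using Bsym[of j j' x y] by simp
    then show ?thesis using \<tau>(2)[OF assms(5,4)] by (simp add: Int_commute)
  qed
  finally show ?thesis using chains_pos[OF assms(4)] by (simp add: kern_def divide_le_eq)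
qed

lemma card_UN_B:
  assumes "j < k" "j' < k" "finite Y"
  shows "real (card (\<Union>y\<in>Y. B j j' x y)) = (\<Sum>y\<in>Y. real (card (B j j' x y)))"
  using assms finB[OF assms(1,2)] Bdisj[OF assms(1)] by (subst card_UN_disjoint) auto

lemma kern_sum_le:
  assumes "j < k" "j' < k" "finite Y" "x \<in> F"
  shows "(\<Sum>y\<in>Y. kern j j' x y) \<le> 1"
proof -
  have "card (\<Union>y\<in>Y. B j j' x y) \<le> card (chains_through A x)"
    using Bsub[OF assms(1,2)] by (intro card_mono) auto
  then have "(\<Sum>y\<in>Y. real (card (B j j' x y))) \<le> real (card (chains_through A x))"
    using card_UN_B[OF assms(1-3), of x] by linarith
  then show ?thesis using chains_pos[OF assms(4)] by (simp add: kern_def flip: sum_divide_distrib)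
qed

text \<open>Detailed balance: the right side is invariant under exchanging \<open>(j, x)\<close>
  with \<open>(j', y)\<close>, so the Lubell weight is a reversing measure for the kernel.\<close>

lemma lubell_kern: "x \<in> F \<Longrightarrow> lubell A x * kern j j' x y = real (card (B j j' x y)) / fact (card A)"
proof -
  assume x: "x \<in> F"
  then have "x \<subseteq> A" using FA by auto
  then have "lubell A x = real (card (chains_through A x)) / fact (card A)"
    using lubell_chains[OF finA] by simp
  moreover have "real (card (chains_through A x)) \<noteq> 0" using chains_pos[OF x] by linarith
  ultimately show ?thesis unfolding kern_def by (simp del: of_nat_eq_0_iff)
qed

lemma lubell_kern_sum_le:
  assumes "j < k" "j' < k" "y \<in> F"
  shows "(\<Sum>x\<in>F. lubell A x * kern j j' x y) \<le> lubell A y"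
proof -
  have "(\<Sum>x\<in>F. lubell A x * kern j j' x y) = (\<Sum>x\<in>F. lubell A y * kern j' j y x)"
    using assms(3) by (intro sum.cong refl) (simp add: lubell_kern Bsym[of j j'])
  also have "\<dots> = lubell A y * (\<Sum>x\<in>F. kern j' j y x)" by (simp add: sum_distrib_left)
  also have "\<dots> \<le> lubell A y * 1"
    using kern_sum_le[OF assms(2,1) finF assms(3)] by (intro mult_left_mono) (auto simp: lubell_def)
  finally show ?thesis by simp
qed

text \<open>A surviving chain whose other entry is not admissible is a bad chain, and the earlier
  images in \<open>Z\<close> cause bad chains of proportion at most \<open>\<delta> / 2\<close>,
  half of what the windows provide.\<close>

lemma kern_sum_ge:
  assumes j: "j < k" "j' < k" and x: "x \<in> G j" and Z: "finite Z" "Z \<subseteq> F"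
    and few: "2 * real (card Z) * \<beta> \<le> \<delta> / 2" and Y: "finite Y"
    and up: "j < j' \<Longrightarrow> {y \<in> G j'. x \<subset> y \<and> \<not> bad_above Z x y} \<subseteq> Y"
    and down: "j' < j \<Longrightarrow> {y \<in> G j'. y \<subset> x \<and> \<not> bad_below Z x y} \<subseteq> Y" and ne: "j \<noteq> j'"
  shows "\<delta> / 2 \<le> (\<Sum>y\<in>Y. kern j j' x y)"
proof -
  let ?c = "real (card (chains_through A x))"
  have xF: "x \<in> F" using x GF j by auto
  have xA: "x \<subseteq> A" using xF FA by auto
  define bad where "bad = (if j < j' then
      {\<sigma> \<in> chains_through A x. \<exists>y. y \<subseteq> A \<and> card y \<le> hi \<and> on_chain \<sigma> y \<and> x \<subset> y \<and> bad_above Z x y} else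
      {\<sigma> \<in> chains_through A x. \<exists>y. y \<subseteq> A \<and> lo \<le> card y \<and> on_chain \<sigma> y \<and> y \<subset> x \<and> bad_below Z x y})"
  have ZA: "Z \<subseteq> Pow A" using Z(2) FA by blast
  have "real (card bad) \<le> 2 * real (card Z) * \<beta> * ?c"
  proof (cases "j < j'")
    case True
    show ?thesis using True unfolding bad_def
      by (simp only: if_True) (rule few_bad_chains_above[OF finA xA lo(2)[OF xF] hi(2)[OF xF] hi(1) Z(1) ZA _ \<beta>(3)], use Z hi in auto)
  next
    case False
    show ?thesis using False unfolding bad_def
      by (simp only: if_False) (rule few_bad_chains_below[OF finA xA lo(2)[OF xF] hi(2)[OF xF] lo(1) Z(1) ZA _ \<beta>(2)], use Z lo in auto)
  qed
  also have "\<dots> \<le> \<delta> / 2 * ?c" using few by (intro mult_right_mono) auto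
  finally have bad: "real (card bad) \<le> \<delta> / 2 * ?c" .
  have finbad: "finite bad" by (simp add: bad_def)
  have sub: "(\<Union>y\<in>G j'. B j j' x y) \<subseteq> (\<Union>y\<in>Y. B j j' x y) \<union> bad"
  proof
    fix \<sigma> assume "\<sigma> \<in> (\<Union>y\<in>G j'. B j j' x y)"
    then obtain y where y: "y \<in> G j'" "\<sigma> \<in> B j j' x y" by blast
    show "\<sigma> \<in> (\<Union>y\<in>Y. B j j' x y) \<union> bad"
    proof (cases "y \<in> Y")
      case False
      have yF: "y \<in> F" using y(1) GF[OF j(2)] by blast
      then have yA: "y \<subseteq> A" "lo \<le> card y" "card y \<le> hi" using FA lo hi by auto
      have "\<sigma> \<in> chains_through A x" "\<sigma> \<in> chains_through A y" using Bsub[OF j] y(2) by auto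
      then have \<sigma>: "\<sigma> \<in> chains_through A x" "on_chain \<sigma> y" by (auto simp: chains_through_def)
      have "\<sigma> \<in> bad"
      proof (cases "j < j'")
        case True
        then have "x \<subset> y" using Bgap[OF True j(2) y(2)] by simp
        moreover from this have "bad_above Z x y" using up[OF True] False y(1) by blast
        ultimately show ?thesis using True \<sigma> yA unfolding bad_def by auto
      next
        case nless: False
        then have less: "j' < j" using ne by simp
        have "\<sigma> \<in> B j' j y x" using y(2) Bsym[of j j' x y] by simp
        then have "y \<subset> x" using Bgap[OF less j(1)] by blast
        moreover from this have "bad_below Z x y" using down[OF less] False y(1) by blast
        ultimately show ?thesis using nless \<sigma> yA unfolding bad_def by auto
      qed
      then show ?thesis by blast
    qed (use y in auto)
  qed
  have "\<delta> * ?c \<le> real (card (\<Union>y\<in>G j'. B j j' x y))" by (rule Bbig[OF j x])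
  also have "\<dots> \<le> real (card ((\<Union>y\<in>Y. B j j' x y) \<union> bad))"
    using sub Y finB[OF j] finbad by (intro of_nat_mono card_mono) auto
  also have "\<dots> \<le> real (card (\<Union>y\<in>Y. B j j' x y) + card bad)"
    by (intro of_nat_mono card_Un_le)
  also have "\<dots> = (\<Sum>y\<in>Y. real (card (B j j' x y))) + real (card bad)"
    using card_UN_B[OF j Y, of x] by simp
  finally have "\<delta> / 2 * ?c \<le> (\<Sum>y\<in>Y. real (card (B j j' x y)))" using bad by (simp add: field_simps)
  then show ?thesis using chains_pos[OF xF] by (simp add: kern_def pos_le_divide_eq flip: sum_divide_distrib)
qed

text \<open>The weight of an embedding is the Lubell weight of the root times the kernel along the tree
  edges.  Reversibility of the kernel bounds the weight with one prescribed image, and each further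
  prescribed image costs a factor \<open>\<tau>\<close>.\<close>
lemma embedding_measure:
  fixes R :: "nat \<Rightarrow> nat \<Rightarrow> bool" and h :: "nat \<Rightarrow> nat"
  assumes refl: "\<And>i. i < r \<Longrightarrow> R i i"
    and h: "\<And>i. i < r \<Longrightarrow> h i < k" "\<And>i j. i < r \<Longrightarrow> j < r \<Longrightarrow> R i j \<Longrightarrow> i \<noteq> j \<Longrightarrow> h i < h j"
    and attach: "\<And>i. i < r \<Longrightarrow> 0 < i \<Longrightarrow> \<exists>u<i.
      (\<forall>w<i. (R w i \<longleftrightarrow> R w u) \<and> \<not> R i w) \<or> (\<forall>w<i. (R i w \<longleftrightarrow> R u w) \<and> \<not> R w i)"
    and few: "2 * real r * \<beta> \<le> \<delta> / 2" and \<delta>: "0 < \<delta>"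
    and m: "0 < m" "m \<le> r"
  shows "\<exists>\<nu>. capped m (lubell A) \<tau> {f \<in> embeddings m R F. \<forall>i<m. f i \<in> G (h i)} \<nu> \<and>
     (\<delta> / 2) ^ (m - 1) * sum (lubell A) (G (h 0)) \<le> sum \<nu> {f \<in> embeddings m R F. \<forall>i<m. f i \<in> G (h i)}"
  using m
proof (induction m)
  case 0
  from 0(1) have False by simp
  then show ?case ..
next
  case (Suc m)
  define H where "H m = {f \<in> embeddings m R F. \<forall>i<m. f i \<in> G (h i)}" for m
  have HE: "H m \<subseteq> {..<m} \<rightarrow>\<^sub>E F" for m by (auto simp: H_def embeddings_def)
  have finH: "finite (H m)" for m
    by (rule finite_subset[OF HE]) (use finF in \<open>auto intro!: finite_PiE\<close>)
  show ?case
  proof (cases "m = 0")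
    case True
    have h0: "h 0 < k" using h(1) Suc.prems by simp
    define s where "s x = (\<lambda>i. if i = (0::nat) then x else undefined)" for x :: "'b set"
    have s: "s x 0 = x" for x by (simp add: s_def)
    have H1: "H (Suc 0) = s ` G (h 0)"
    proof
      show "s ` G (h 0) \<subseteq> H (Suc 0)"
        using GF[OF h0] refl Suc.prems by (auto simp: H_def embeddings_def s_def PiE_iff extensional_def)
      show "H (Suc 0) \<subseteq> s ` G (h 0)"
      proof
        fix f assume f: "f \<in> H (Suc 0)"
        then have "f = s (f 0)" by (auto simp: H_def embeddings_def s_def PiE_iff extensional_def fun_eq_iff)
        moreover have "f 0 \<in> G (h 0)" using f by (auto simp: H_def)
        ultimately show "f \<in> s ` G (h 0)" by blast
      qed
    qed
    have inj: "inj_on s (G (h 0))" by (rule inj_on_inverseI[of _ "\<lambda>f. f 0"]) (simp add: s)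
    define \<nu> where "\<nu> f = lubell A (f 0)" for f :: "nat \<Rightarrow> 'b set"
    have "capped (Suc 0) (lubell A) \<tau> (H (Suc 0)) \<nu>"
      unfolding capped_def
    proof (intro conjI allI impI)
      fix J b assume "J \<subseteq> {..<Suc 0} \<and> J \<noteq> {}"
      then have J: "J = {0}" by auto
      have "{f. f \<in> H (Suc 0) \<and> restrict f J = b} \<subseteq> {s (b 0)}"
        unfolding J H1 by (auto simp: s)
      then have "(\<Sum>f | f \<in> H (Suc 0) \<and> restrict f J = b. \<nu> f) \<le> (\<Sum>f\<in>{s (b 0)}. \<nu> f)"
        by (intro sum_mono2) (auto simp: \<nu>_def lubell_def)
      then show "(\<Sum>f | f \<in> H (Suc 0) \<and> restrict f J = b. \<nu> f) \<le> lubell A (b (Min J)) * \<tau> ^ (card J - 1)"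
        by (simp add: J \<nu>_def s)
    qed (simp add: \<nu>_def lubell_def)
    moreover have "sum \<nu> (H (Suc 0)) = sum (lubell A) (G (h 0))"
      unfolding H1 by (subst sum.reindex[OF inj]) (simp add: \<nu>_def s)
    ultimately show ?thesis using True by (intro exI[of _ \<nu>]) (simp add: H_def)
  next
    case False
    then have m0: "0 < m" and mr: "m < r" using Suc.prems by auto
    have "\<exists>\<nu>. capped m (lubell A) \<tau> (H m) \<nu> \<and> (\<delta> / 2) ^ (m - 1) * sum (lubell A) (G (h 0)) \<le> sum \<nu> (H m)"
      unfolding H_def by (rule Suc.IH) (use m0 mr in simp_all)
    then obtain \<nu> where \<nu>: "capped m (lubell A) \<tau> (H m) \<nu>"
      "(\<delta> / 2) ^ (m - 1) * sum (lubell A) (G (h 0)) \<le> sum \<nu> (H m)" by (elim exE conjE)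
    have \<nu>0: "0 \<le> \<nu> f" for f using cappedD(2)[OF \<nu>(1)] .
    obtain u where u: "u < m"
      "(\<forall>w<m. (R w m \<longleftrightarrow> R w u) \<and> \<not> R m w) \<or> (\<forall>w<m. (R m w \<longleftrightarrow> R u w) \<and> \<not> R w m)"
      using attach[OF mr m0] by blast
    have hu: "h u < k" and hm: "h m < k" using h(1) u mr by auto
    \<comment> \<open>Reflexivity at \<open>u\<close> makes \<open>u\<close> comparable with
      \<open>m\<close> under either form of attachment, and \<open>h\<close> is strictly increasing
      on comparable indices.\<close>
    have hne: "h u \<noteq> h m"
      using u refl[of u] h(2)[of u m] h(2)[of m u] mr by auto
    \<comment> \<open>The new leaf is placed by one kernel step from the image of its neighbour
      \<open>u\<close>.\<close>
    define \<nu>' where "\<nu>' f = \<nu> (restrict f {..<m}) * kern (h u) (h m) (f u) (f m)" for f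
    have \<nu>'0: "0 \<le> \<nu>' f" for f by (simp add: \<nu>'_def \<nu>0 kern_nonneg)
    have restr: "restrict f {..<m} \<in> H m" if "f \<in> H (Suc m)" for f
      using that by (auto simp: H_def embeddings_def PiE_iff extensional_def)
    have upd: "restrict (g(m := y)) {..<m} = g" if "g \<in> H m" for g y
    proof -
      have "g \<in> {..<m} \<rightarrow>\<^sub>E F" using that HE by blast
      then show ?thesis by (auto simp: fun_eq_iff restrict_def PiE_iff extensional_def)
    qed
    have \<nu>'upd: "\<nu>' (g(m := y)) = \<nu> g * kern (h u) (h m) (g u) y" if "g \<in> H m" for g y
      using upd[OF that, of y] u by (simp add: \<nu>'_def)
    define Y where "Y g = {y. g(m := y) \<in> H (Suc m)}" for g
    have YF: "Y g \<subseteq> F" for g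
    proof
      fix y assume "y \<in> Y g"
      then have "g(m := y) \<in> {..<Suc m} \<rightarrow>\<^sub>E F" using HE[of "Suc m"] by (auto simp: Y_def)
      from PiE_mem[OF this, of m] show "y \<in> F" by simp
    qed
    have finY: "finite (Y g)" for g using YF finF finite_subset by blast
    have gF: "g i \<in> F" if "g \<in> H m" "i < m" for g i
      using PiE_mem[of g "{..<m}" "\<lambda>_. F" i] HE that by auto
    have sum': "(\<Sum>f | f \<in> H (Suc m) \<and> Q f. \<nu>' f)
        = (\<Sum>g\<in>H m. \<Sum>y | y \<in> Y g \<and> Q (g(m := y)). \<nu> g * kern (h u) (h m) (g u) y)" for Q
    proof -
      have "(\<Sum>f | f \<in> H (Suc m) \<and> Q f. \<nu>' f)
          = (\<Sum>g\<in>H m. \<Sum>y | g(m := y) \<in> {f. f \<in> H (Suc m) \<and> Q f}. \<nu>' (g(m := y)))"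
        by (rule sum_extend_functions[OF finH _ HE]) (use finH[of "Suc m"] HE[of "Suc m"] restr in auto)
      also have "\<dots> = (\<Sum>g\<in>H m. \<Sum>y | y \<in> Y g \<and> Q (g(m := y)). \<nu> g * kern (h u) (h m) (g u) y)"
        by (intro sum.cong) (auto simp: Y_def \<nu>'upd)
      finally show ?thesis .
    qed
    have "capped (Suc m) (lubell A) \<tau> (H (Suc m)) \<nu>'"
      unfolding capped_def
    proof (intro conjI allI impI)
      fix f show "0 \<le> \<nu>' f" by (rule \<nu>'0)
    next
      fix J b assume "J \<subseteq> {..<Suc m} \<and> J \<noteq> {}"
      then have J: "J \<subseteq> {..<Suc m}" "J \<noteq> {}" by auto
      have finJ: "finite J" using J(1) finite_subset by blast
      have inner1: "(\<Sum>y | y \<in> Y g \<and> Q y. \<nu> g * kern (h u) (h m) (g u) y) \<le> \<nu> g" if "g \<in> H m" for g Q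
      proof -
        have "(\<Sum>y | y \<in> Y g \<and> Q y. kern (h u) (h m) (g u) y) \<le> 1"
          by (rule kern_sum_le[OF hu hm]) (use finY gF[OF that u(1)] in auto)
        then show ?thesis using \<nu>0[of g] by (simp add: mult_left_le flip: sum_distrib_left)
      qed
      show "(\<Sum>f | f \<in> H (Suc m) \<and> restrict f J = b. \<nu>' f) \<le> lubell A (b (Min J)) * \<tau> ^ (card J - 1)"
      proof (cases "m \<in> J")
        case False
        then have Jm: "J \<subseteq> {..<m}" using J(1) less_Suc_eq by auto
        have rJ: "restrict (g(m := y)) J = restrict g J" for g y using False by auto
        have "(\<Sum>f | f \<in> H (Suc m) \<and> restrict f J = b. \<nu>' f) \<le> (\<Sum>g\<in>H m. if restrict g J = b then \<nu> g else 0)"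
          unfolding sum' rJ by (intro sum_mono) (use inner1[of _ "\<lambda>_. True"] in auto)
        also have "\<dots> = (\<Sum>g | g \<in> H m \<and> restrict g J = b. \<nu> g)" using finH by (simp add: sum.inter_filter)
        also have "\<dots> \<le> lubell A (b (Min J)) * \<tau> ^ (card J - 1)" by (rule cappedD(1)[OF \<nu>(1) Jm J(2)])
        finally show ?thesis .
      next
        case mJ: True
        \<comment> \<open>The last entry is prescribed, so at most one extension of each
          \<open>g\<close> contributes.\<close>
        define Q where "Q g y \<longleftrightarrow> restrict (g(m := y)) J = b" for g y
        have ym: "y = b m" if "Q g y" for g y
          using fun_cong[OF that[unfolded Q_def], of m] mJ by simp
        have inner2: "(\<Sum>y | y \<in> Y g \<and> Q g y. \<nu> g * kern (h u) (h m) (g u) y)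
            \<le> (if b m \<in> F \<and> Q g (b m) then \<nu> g * kern (h u) (h m) (g u) (b m) else 0)" for g
        proof -
          have "(\<Sum>y | y \<in> Y g \<and> Q g y. \<nu> g * kern (h u) (h m) (g u) y)
            = (if b m \<in> Y g \<and> Q g (b m) then \<nu> g * kern (h u) (h m) (g u) (b m) else 0)"
            by (rule sum_at_most_one) (rule ym[OF conjunct2])
          also have "\<dots> \<le> (if b m \<in> F \<and> Q g (b m) then \<nu> g * kern (h u) (h m) (g u) (b m) else 0)"
            using YF[of g] by (auto simp: \<nu>0 kern_nonneg)
          finally show ?thesis .
        qed
        show ?thesis
        proof (cases "b m \<in> F")
          case False
          have "(\<Sum>f | f \<in> H (Suc m) \<and> restrict f J = b. \<nu>' f) \<le> (\<Sum>g\<in>H m. 0)"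
            unfolding sum' Q_def[symmetric] by (intro sum_mono order_trans[OF inner2]) (use False in auto)
          also have "\<dots> \<le> lubell A (b (Min J)) * \<tau> ^ (card J - 1)" using \<tau>(1) by (simp add: lubell_def)
          finally show ?thesis .
        next
          case bF: True
          show ?thesis
          proof (cases "J = {m}")
            case True
            \<comment> \<open>Only the new image is prescribed: the marginal of \<open>\<nu>\<close>
              at \<open>u\<close> is at most the Lubell weight, and reversibility carries this bound
              across the edge to \<open>b m\<close>.\<close>
            have "(\<Sum>f | f \<in> H (Suc m) \<and> restrict f J = b. \<nu>' f)
                \<le> (\<Sum>g\<in>H m. \<nu> g * kern (h u) (h m) (g u) (b m))"
              unfolding sum' Q_def[symmetric] by (intro sum_mono order_trans[OF inner2]) (auto simp: \<nu>0 kern_nonneg)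
            also have "\<dots> = (\<Sum>x\<in>F. \<Sum>g | g \<in> H m \<and> g u = x. \<nu> g * kern (h u) (h m) (g u) (b m))"
              by (rule sum.group[symmetric]) (use finH finF gF u(1) in auto)
            also have "\<dots> = (\<Sum>x\<in>F. (\<Sum>g | g \<in> H m \<and> g u = x. \<nu> g) * kern (h u) (h m) x (b m))"
              by (simp add: sum_distrib_right)
            also have "\<dots> \<le> (\<Sum>x\<in>F. lubell A x * kern (h u) (h m) x (b m))"
            proof (intro sum_mono mult_right_mono kern_nonneg)
              fix x :: "'b set"
              have eq: "(restrict f {u} = restrict (\<lambda>_. x) {u}) = (f u = x)" for f :: "nat \<Rightarrow> 'b set"
                by (auto simp: restrict_def fun_eq_iff)
              show "(\<Sum>g | g \<in> H m \<and> g u = x. \<nu> g) \<le> lubell A x"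
                using cappedD(1)[OF \<nu>(1), of "{u}" "restrict (\<lambda>_. x) {u}"] u(1) by (simp add: eq)
            qed
            also have "\<dots> \<le> lubell A (b m)" by (rule lubell_kern_sum_le[OF hu hm bF])
            finally show ?thesis using True by simp
          next
            case False
            \<comment> \<open>An earlier entry is prescribed as well: the single kernel value
              contributes the factor \<open>\<tau>\<close>, and the rest is the cap at
              \<open>J0\<close>, which charges the same least index.\<close>
            define J0 where "J0 = J - {m}"
            have J0: "J0 \<subseteq> {..<m}" "J0 \<noteq> {}" "J = insert m J0" "finite J0" "m \<notin> J0"
              using J mJ False finJ less_Suc_eq by (auto simp: J0_def)
            have r0: "restrict g J0 = restrict b J0" if "Q g (b m)" for g
            proof
              fix i
              show "restrict g J0 i = restrict b J0 i"
                using fun_cong[OF that[unfolded Q_def], of i] J0(3,5) by (auto simp: restrict_def split: if_splits)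
            qed
            have "(\<Sum>f | f \<in> H (Suc m) \<and> restrict f J = b. \<nu>' f)
                \<le> (\<Sum>g\<in>H m. if restrict g J0 = restrict b J0 then \<tau> * \<nu> g else 0)"
              unfolding sum' Q_def[symmetric]
            proof (intro sum_mono order_trans[OF inner2])
              fix g assume g: "g \<in> H m"
              have "\<nu> g * kern (h u) (h m) (g u) (b m) \<le> \<nu> g * \<tau>"
                using kern_le[OF hu hm hne gF[OF g u(1)] bF] \<nu>0 by (intro mult_left_mono)
              then show "(if b m \<in> F \<and> Q g (b m) then \<nu> g * kern (h u) (h m) (g u) (b m) else 0)
                \<le> (if restrict g J0 = restrict b J0 then \<tau> * \<nu> g else 0)"
                using r0[of g] \<nu>0[of g] \<tau>(1) by (simp only: mult.commute) (auto split: if_splits)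
            qed
            also have "\<dots> = \<tau> * (\<Sum>g | g \<in> H m \<and> restrict g J0 = restrict b J0. \<nu> g)"
              using finH[of m] by (simp only: sum_distrib_left sum.inter_filter if_distrib mult_zero_right)
            also have "\<dots> \<le> \<tau> * (lubell A (restrict b J0 (Min J0)) * \<tau> ^ (card J0 - 1))"
              using \<tau>(1) by (intro mult_left_mono cappedD(1)[OF \<nu>(1) J0(1,2)]) auto
            also have "restrict b J0 (Min J0) = b (Min J)"
            proof -
              have "Min J0 \<in> J0" using J0 by simp
              moreover from this have "Min J0 < m" using J0(1) by auto
              with Min_insert[OF J0(4,2), of m] have "Min J = Min J0" unfolding J0(3) by linarith
              ultimately show ?thesis by simp
            qed
            also have "\<tau> * (lubell A (b (Min J)) * \<tau> ^ (card J0 - 1)) = lubell A (b (Min J)) * \<tau> ^ (card J - 1)"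
            proof -
              have "card J = Suc (card J0)" "0 < card J0" using J0 by (auto simp: card_gt_0_iff)
              then show ?thesis by (cases "card J0") auto
            qed
            finally show ?thesis .
          qed
        qed
      qed
    qed
    moreover have "(\<delta> / 2) ^ m * sum (lubell A) (G (h 0)) \<le> sum \<nu>' (H (Suc m))"
    proof -
      have "(\<delta> / 2) ^ m * sum (lubell A) (G (h 0)) = \<delta> / 2 * ((\<delta> / 2) ^ (m - 1) * sum (lubell A) (G (h 0)))"
        using m0 by (cases m) auto
      also have "\<dots> \<le> \<delta> / 2 * sum \<nu> (H m)" using \<nu>(2) \<delta> by (intro mult_left_mono) auto
      also have "\<dots> = (\<Sum>g\<in>H m. \<nu> g * (\<delta> / 2))" by (simp add: sum_distrib_left mult.commute)
      also have "\<dots> \<le> (\<Sum>g\<in>H m. \<nu> g * (\<Sum>y\<in>Y g. kern (h u) (h m) (g u) y))"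
      proof (intro sum_mono mult_left_mono \<nu>0)
        fix g assume g: "g \<in> H m"
        have gE: "g \<in> {..<m} \<rightarrow>\<^sub>E F" using g HE by blast
        have gR: "R i j \<longleftrightarrow> g i \<subseteq> g j" if "i < m" "j < m" for i j
          using g that by (auto simp: H_def embeddings_def)
        have gG: "g i \<in> G (h i)" if "i < m" for i using g that by (auto simp: H_def)
        \<comment> \<open>The images already placed, against which a new image must create no
          comparability beyond those required.\<close>
        define Z where "Z = g ` {..<m}"
        have Z: "finite Z" "Z \<subseteq> F" "card Z \<le> r"
          using gF[OF g] mr card_image_le[of "{..<m}" g] by (auto simp: Z_def)
        have YI: "y \<in> Y g" if y: "y \<in> G (h m)" and Ry: "\<And>w. w < m \<Longrightarrow> (R w m \<longleftrightarrow> g w \<subseteq> y) \<and> (R m w \<longleftrightarrow> y \<subseteq> g w)" for y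
        proof -
          have "y \<in> F" using y GF[OF hm] by blast
          then have "g(m := y) \<in> {..<Suc m} \<rightarrow>\<^sub>E F" using gE by (auto simp: PiE_iff extensional_def less_Suc_eq)
          moreover have "R i j \<longleftrightarrow> (g(m := y)) i \<subseteq> (g(m := y)) j" if "i < Suc m" "j < Suc m" for i j
            using that gR[of i j] Ry refl[OF mr] by (cases "i = m"; cases "j = m") auto
          moreover have "(g(m := y)) i \<in> G (h i)" if "i < Suc m" for i
            using that gG[of i] y by (cases "i = m") auto
          ultimately show ?thesis by (simp add: Y_def H_def embeddings_def)
        qed
        show "\<delta> / 2 \<le> (\<Sum>y\<in>Y g. kern (h u) (h m) (g u) y)"
        proof (rule kern_sum_ge[OF hu hm gG[OF u(1)] Z(1,2) _ finY _ _ hne])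
          have "2 * real (card Z) * \<beta> \<le> 2 * real r * \<beta>" using Z(3) \<beta>(1) by (intro mult_right_mono) auto
          then show "2 * real (card Z) * \<beta> \<le> \<delta> / 2" using few by simp
        next
          assume less: "h u < h m"
          have nR: "\<not> R m u" using h(2)[of m u] less u(1) mr by auto
          \<comment> \<open>The other alternative, taken at \<open>w = u\<close>, would give
            \<open>R m u\<close> by reflexivity.\<close>
          then have up: "\<forall>w<m. (R w m \<longleftrightarrow> R w u) \<and> \<not> R m w"
            using u refl[of u] mr by auto
          show "{y \<in> G (h m). g u \<subset> y \<and> \<not> bad_above Z (g u) y} \<subseteq> Y g"
          proof
            fix y assume "y \<in> {y \<in> G (h m). g u \<subset> y \<and> \<not> bad_above Z (g u) y}"
            then have y: "y \<in> G (h m)" "g u \<subset> y" "\<not> bad_above Z (g u) y" by auto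
            show "y \<in> Y g"
            proof (rule YI[OF y(1)])
              fix w assume w: "w < m"
              then have "g w \<in> Z" by (simp add: Z_def)
              then have "\<not> (g w \<subseteq> y \<and> \<not> g w \<subseteq> g u)" "\<not> y \<subseteq> g w" using y(3) by (auto simp: bad_above_def)
              then show "(R w m \<longleftrightarrow> g w \<subseteq> y) \<and> (R m w \<longleftrightarrow> y \<subseteq> g w)"
                using up w gR[OF w u(1)] y(2) by blast
            qed
          qed
        next
          assume less: "h m < h u"
          have nR: "\<not> R u m" using h(2)[of u m] less u(1) mr by auto
          then have down: "\<forall>w<m. (R m w \<longleftrightarrow> R u w) \<and> \<not> R w m"
            using u refl[of u] mr by auto
          show "{y \<in> G (h m). y \<subset> g u \<and> \<not> bad_below Z (g u) y} \<subseteq> Y g"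
          proof
            fix y assume "y \<in> {y \<in> G (h m). y \<subset> g u \<and> \<not> bad_below Z (g u) y}"
            then have y: "y \<in> G (h m)" "y \<subset> g u" "\<not> bad_below Z (g u) y" by auto
            show "y \<in> Y g"
            proof (rule YI[OF y(1)])
              fix w assume w: "w < m"
              then have "g w \<in> Z" by (simp add: Z_def)
              then have "\<not> (y \<subseteq> g w \<and> \<not> g u \<subseteq> g w)" "\<not> g w \<subseteq> y" using y(3) by (auto simp: bad_below_def)
              then show "(R w m \<longleftrightarrow> g w \<subseteq> y) \<and> (R m w \<longleftrightarrow> y \<subseteq> g w)"
                using down w gR[OF u(1) w] y(2) by blast
            qed
          qed
        qed
      qed
      also have "\<dots> = sum \<nu>' (H (Suc m))" using sum'[of "\<lambda>_. True"] by (simp add: sum_distrib_left)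
      finally show ?thesis .
    qed
    ultimately show ?thesis by (intro exI[of _ \<nu>']) (simp add: H_def)
  qed
qed

end

section \<open>Middle layers of the Boolean lattice\<close>

text \<open>The width is linear in \<open>n\<close>. The embedding only needs the number of layers
  to be a small constant fraction of \<open>n\<close>, arranged by a large \<open>q\<close>, and
  each layer left out is then exponentially small against the middle one.\<close>

definition middle_layers :: "nat \<Rightarrow> nat \<Rightarrow> nat set set" where
  "middle_layers q n = {x. x \<subseteq> {1..n} \<and> n div 2 - n div q \<le> card x \<and> card x \<le> n div 2 + n div q}"

lemma lubell_ge:
  assumes "finite A" "x \<subseteq> A"
  shows "1 \<le> real (card A choose (card A div 2)) * lubell A x"
proof -
  have "0 < card A choose card x" using assms by (simp add: card_mono)
  then show ?thesis
    using binomial_maximum[of "card A" "card x"] by (simp add: lubell_def le_divide_eq)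
qed

text \<open>Turns weight into size: each set weighs at least the reciprocal of the central binomial
  coefficient.\<close>

lemma card_le_lubell:
  assumes "finite A" "F \<subseteq> Pow A"
  shows "real (card F) \<le> real (card A choose (card A div 2)) * sum (lubell A) F"
proof -
  have "real (card F) = (\<Sum>x\<in>F. 1)" by simp
  also have "\<dots> \<le> (\<Sum>x\<in>F. real (card A choose (card A div 2)) * lubell A x)"
    using assms by (intro sum_mono lubell_ge) auto
  finally show ?thesis by (simp add: sum_distrib_left)
qed

lemma lubell_nonneg: "0 \<le> lubell A x" by (simp add: lubell_def)

lemma lubell_pos: "finite A \<Longrightarrow> x \<subseteq> A \<Longrightarrow> 0 < lubell A x"
  by (simp add: lubell_def card_mono)

lemma sum_over_layers:
  assumes "finite A"
  shows "(\<Sum>x\<in>Pow A. \<phi> (card x)) = (\<Sum>m\<le>card A. real (card A choose m) * \<phi> m)"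
proof -
  have "(\<Sum>x\<in>Pow A. \<phi> (card x)) = (\<Sum>m\<le>card A. \<Sum>x | x \<in> Pow A \<and> card x = m. \<phi> (card x))"
    by (rule sum.group[symmetric]) (use assms in \<open>auto simp: card_mono\<close>)
  also have "\<dots> = (\<Sum>m\<le>card A. real (card A choose m) * \<phi> m)"
    using n_subsets[OF assms] by (intro sum.cong) auto
  finally show ?thesis .
qed

lemma lubell_total:
  assumes "finite A" "F \<subseteq> Pow A"
  shows "sum (lubell A) F \<le> real (card A) + 1"
proof -
  have "sum (lubell A) F \<le> sum (lubell A) (Pow A)"
    using assms by (intro sum_mono2) (auto simp: lubell_nonneg)
  also have "\<dots> = (\<Sum>m\<le>card A. 1)"
    unfolding lubell_def by (subst sum_over_layers[OF assms(1)]) (auto intro!: sum.cong)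
  finally show ?thesis by simp
qed

text \<open>In the lower half of its row \<open>(m choose d)\<close> is at least
  \<open>(m choose g)\<close>, which is at least \<open>(m / g) ^ g\<close>. With \<open>m\<close>
  at least \<open>n / 4\<close> this produces \<open>(4 * g / n) ^ g\<close>, the value used for
  \<open>\<tau>\<close>.\<close>

lemma binomial_ge_power:
  assumes "0 < g" "g \<le> d" "2 * d \<le> m" "real n \<le> 4 * real m" "0 < n"
  shows "1 / real (m choose d) \<le> (4 * real g / real n) ^ g"
proof -
  have "(real n / (4 * real g)) ^ g \<le> (real m / real g) ^ g"
    using assms by (intro power_mono) (auto simp: field_simps)
  also have "\<dots> \<le> real (m choose g)" using binomial_ge_n_over_k_pow_k[of g m] assms by simp
  also have "\<dots> \<le> real (m choose d)" using binomial_mono[of g d m] assms by simp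
  finally have "(real n / (4 * real g)) ^ g \<le> real (m choose d)" .
  then have "1 / real (m choose d) \<le> 1 / (real n / (4 * real g)) ^ g"
    using assms by (intro divide_left_mono mult_pos_pos) auto
  also have "\<dots> = (4 * real g / real n) ^ g" by (simp add: power_divide)
  finally show ?thesis .
qed

text \<open>Given either set, a random chain through it meets the other with probability one over a
  binomial coefficient. The factor-two hypotheses place that coefficient in the lower half of its
  row, the factor-four ones make the row long.\<close>

lemma chains_through_pair_le:
  assumes A: "finite A" "x \<subseteq> y" "y \<subseteq> A" and g: "0 < g" "card x + g \<le> card y"
    and x: "2 * (card y - card x) \<le> card A - card x" "card A \<le> 4 * (card A - card x)"
    and y: "2 * (card y - card x) \<le> card y" "card A \<le> 4 * card y"
  shows "real (card (chains_through A x \<inter> chains_through A y))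
      \<le> (4 * real g / real (card A)) ^ g * real (card (chains_through A x))" (is "?c \<le> ?t * _")
    "real (card (chains_through A x \<inter> chains_through A y))
      \<le> (4 * real g / real (card A)) ^ g * real (card (chains_through A y))"
proof -
  have xA: "x \<subseteq> A" using A by blast
  have le: "card x \<le> card y" "card y \<le> card A" using A g by (auto simp: card_mono)
  have n0: "0 < card A" using le g by linarith
  define d where "d = card y - card x"
  have c: "?c = fact (card x) * fact d * fact (card A - card y)"
    using card_chains_through_pair[OF A] by (simp add: d_def)
  have "?c = 1 / real ((card A - card x) choose d) * real (card (chains_through A x))"
  proof -
    have "card A - card x - d = card A - card y" using le by (simp add: d_def)
    moreover have "d \<le> card A - card x" using le by (simp add: d_def)
    ultimately show ?thesis
      unfolding c by (simp add: card_chains_through[OF A(1) xA] binomial_fact)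
  qed
  also have "\<dots> \<le> ?t * real (card (chains_through A x))"
    by (intro mult_right_mono binomial_ge_power) (use g x n0 in \<open>auto simp: d_def\<close>)
  finally show "?c \<le> ?t * real (card (chains_through A x))" .
  have "?c = 1 / real (card y choose d) * real (card (chains_through A y))"
  proof -
    have "card y - d = card x" using le by (simp add: d_def)
    moreover have "d \<le> card y" using le by (simp add: d_def)
    ultimately show ?thesis
      unfolding c by (simp add: card_chains_through[OF A(1,3)] binomial_fact)
  qed
  also have "\<dots> \<le> ?t * real (card (chains_through A y))"
    by (intro mult_right_mono binomial_ge_power) (use g y n0 in \<open>auto simp: d_def\<close>)
  finally show "?c \<le> ?t * real (card (chains_through A y))" .
qed

text \<open>For \<open>m < s\<close> the ratio of \<open>(n choose m)\<close> to
  \<open>(n choose Suc m)\<close> is \<open>(m + 1) / (n - m)\<close>, at most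
  \<open>s / (n - s)\<close>; the bound is stated without quotients.\<close>

lemma binomial_below_decay:
  assumes "s \<le> n" "i \<le> s"
  shows "real (n choose (s - i)) * real (n - s) ^ i \<le> real s ^ i * real (n choose s)"
  using assms(2)
proof (induction i)
  case (Suc i)
  define m where "m = s - Suc i"
  have m: "s - i = Suc m" using Suc.prems by (simp add: m_def)
  have "Suc m * (n choose Suc m) = (n - m) * (n choose m)"
    using binomial_absorb_comp[of n m] Suc_times_binomial[of m "n - 1"] assms m by (cases n) auto
  then have e: "real (n - m) * real (n choose m) = real (Suc m) * real (n choose Suc m)"
    by (metis of_nat_mult)
  have "real (n choose m) * real (n - s) \<le> real (n choose m) * real (n - m)"
    using m by (intro mult_left_mono) auto
  also have "\<dots> = real (Suc m) * real (n choose Suc m)" using e by (simp add: mult.commute)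
  also have "\<dots> \<le> real s * real (n choose Suc m)" using m by (intro mult_right_mono) auto
  finally have 1: "real (n choose m) * real (n - s) \<le> real s * real (n choose Suc m)" .
  have "real (n choose (s - Suc i)) * real (n - s) ^ Suc i = (real (n choose m) * real (n - s)) * real (n - s) ^ i"
    by (simp add: m_def)
  also have "\<dots> \<le> (real s * real (n choose Suc m)) * real (n - s) ^ i" by (intro mult_right_mono 1) auto
  also have "\<dots> = real s * (real (n choose (s - i)) * real (n - s) ^ i)" by (simp add: m)
  also have "\<dots> \<le> real s * (real s ^ i * real (n choose s))"
    using Suc by (intro mult_left_mono) auto
  finally show ?case by (simp add: mult_ac)
qed simp

text \<open>Compare with the level \<open>s\<close>, about halfway between the middle and the edge
  of the middle layers. Below it consecutive coefficients decrease by a factor at most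
  \<open>1 - 1 / (2 * q)\<close>, and at least \<open>v \<ge> n / (4 * q)\<close> steps remain to
  the outer layer. Layers above the middle are reflected by \<open>m'\<close>.\<close>

lemma binomial_outer_layer:
  assumes q: "0 < q" "8 * q \<le> n" and m: "m \<le> n" "m < n div 2 - n div q \<or> n div 2 + n div q < m"
  shows "real (n choose m) \<le> exp (- (real n / (8 * real q ^ 2))) * real (n choose (n div 2))"
proof -
  define v s where "v = (n div q) div 2" and "s = n div 2 - v"
  define m' where "m' = (if m < n div 2 - n div q then m else n - m)"
  have nq: "n div q \<le> n div 2 \<or> q = 1"
    using q by (cases "q \<ge> 2") (auto intro: div_le_mono2)
  have C: "n choose m = n choose m'"
    using binomial_symmetric[of m n] m(1) by (simp add: m'_def)
  have m': "m' + n div q \<le> n div 2"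
    using m q by (auto simp: m'_def)
  have v2: "2 * v \<le> n div q" by (simp add: v_def)
  have sn: "s \<le> n" by (simp add: s_def)
  have mi: "m' = s - (s - m')" "s - m' \<le> s" "v \<le> s - m'" using m' v2 by (auto simp: s_def)
  \<comment> \<open>Two roundings occur, in \<open>n div q\<close> and in halving it;
    \<open>8 * q \<le> n\<close> absorbs both.\<close>
  have vge: "real n / (4 * real q) \<le> real v"
  proof -
    have "real n / real q < real (n div q) + 1"
      using q by (simp add: divide_less_eq) (metis add.commute dividend_less_div_times mult.commute of_nat_Suc of_nat_less_iff of_nat_mult plus_1_eq_Suc times_div_less_eq_dividend mult_Suc_right)
    moreover have "real (n div q) \<le> 2 * real v + 1"
    proof -
      have "n div q \<le> 2 * v + 1" unfolding v_def by linarith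
      then show ?thesis by linarith
    qed
    moreover have "8 \<le> real n / real q"
    proof -
      have "8 * real q \<le> real n" using of_nat_mono[OF q(2), where 'a=real] by simp
      then show ?thesis using q(1) by (simp add: le_divide_eq)
    qed
    ultimately have "real n / real q \<le> 4 * real v" by linarith
    then show ?thesis using q by (simp add: field_simps)
  qed
  define \<rho> where "\<rho> = 1 - 1 / (2 * real q)"
  have \<rho>: "0 \<le> \<rho>" "\<rho> \<le> 1" using q by (auto simp: \<rho>_def field_simps)
  have nspos: "0 < n - s" 
  proof -
    have "0 < n" using q by linarith
    then show ?thesis unfolding s_def by linarith
  qed
  have ratio: "real s / real (n - s) \<le> \<rho>"
  proof -
    have "2 * real s \<le> real n - 2 * real v"
    proof -
      have "2 * s + 2 * v \<le> n" using m' v2 by (simp add: s_def)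
      then show ?thesis by linarith
    qed
    then have "real s * (2 - 1 / (2 * real q)) \<le> (real n / 2 - real v) * (2 - 1 / (2 * real q))"
      using q by (intro mult_right_mono) (auto simp: field_simps)
    also have "\<dots> = real n - 2 * real v - real n / (4 * real q) + real v / (2 * real q)"
      by (simp add: algebra_simps)
    also have "\<dots> \<le> real n - real n / (2 * real q)"
    proof -
      have "real v / (2 * real q) \<le> real v" using q by (simp add: divide_le_eq) (simp add: mult_le_cancel_left1)
      moreover have "real n / (2 * real q) = real n / (4 * real q) + real n / (4 * real q)" by (simp add: field_simps)
      ultimately show ?thesis using vge by linarith
    qed
    finally have "real s \<le> \<rho> * (real n - real s)" by (simp add: \<rho>_def algebra_simps diff_divide_distrib)
    then show ?thesis using nspos sn by (simp add: divide_le_eq of_nat_diff)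
  qed
  have "real (n choose m') * real (n - s) ^ (s - m') \<le> real s ^ (s - m') * real (n choose s)"
    using binomial_below_decay[OF sn mi(2)] mi(1) by simp
  then have "real (n choose m') \<le> (real s / real (n - s)) ^ (s - m') * real (n choose s)"
    using nspos by (simp add: power_divide field_simps)
  also have "\<dots> \<le> \<rho> ^ (s - m') * real (n choose (n div 2))"
    using ratio \<rho>(1) binomial_maximum[of n s] by (intro mult_mono power_mono) auto
  also have "\<dots> \<le> \<rho> ^ v * real (n choose (n div 2))"
    using \<rho> mi(3) by (intro mult_right_mono power_decreasing) auto
  finally have 1: "real (n choose m') \<le> \<rho> ^ v * real (n choose (n div 2))" .
  have "\<rho> ^ v \<le> exp (- (1 / (2 * real q))) ^ v"
    using \<rho> exp_ge_add_one_self[of "- (1 / (2 * real q))"] by (intro power_mono) (auto simp: \<rho>_def)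
  also have "\<dots> = exp (- (real v / (2 * real q)))" by (simp add: exp_of_nat_mult[symmetric])
  also have "\<dots> \<le> exp (- (real n / (8 * real q ^ 2)))"
  proof -
    have "real n / (4 * real q) / (2 * real q) \<le> real v / (2 * real q)"
      using vge q by (intro divide_right_mono) auto
    then show ?thesis by (simp add: power2_eq_square)
  qed
  finally have "\<rho> ^ v * real (n choose (n div 2)) \<le> exp (- (real n / (8 * real q ^ 2))) * real (n choose (n div 2))"
    by (intro mult_right_mono) auto
  with 1 show ?thesis unfolding C by linarith
qed

lemma few_sets_outside_middle_layers:
  assumes q: "0 < q" and \<epsilon>: "0 < \<epsilon>"
  shows "\<exists>N. \<forall>n\<ge>N. real (card (Pow {1..n} - middle_layers q n)) \<le> \<epsilon> * real (n choose (n div 2))"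
proof -
  define c where "c = 1 / (8 * real q ^ 2)"
  have c: "0 < c" using q by (simp add: c_def)
  have "((\<lambda>n. (real n + 1) * exp (- (c * real n))) \<longlongrightarrow> 0) sequentially" using c by real_asymp
  then have "eventually (\<lambda>n. (real n + 1) * exp (- (c * real n)) < \<epsilon>) sequentially"
    using \<epsilon> by (rule order_tendstoD)
  then obtain N where N: "\<And>n. n \<ge> N \<Longrightarrow> (real n + 1) * exp (- (c * real n)) < \<epsilon>"
    by (auto simp: eventually_sequentially)
  show ?thesis
  proof (intro exI[of _ "max N (8 * q)"] allI impI)
    fix n assume n: "max N (8 * q) \<le> n"
    define out where "out m \<longleftrightarrow> m < n div 2 - n div q \<or> n div 2 + n div q < m" for m
    have "real (card (Pow {1..n} - middle_layers q n)) = real (card {x \<in> Pow {1..n}. out (card x)})"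
      by (rule arg_cong[where f="\<lambda>S. real (card S)"]) (auto simp: middle_layers_def out_def)
    also have "\<dots> = (\<Sum>x\<in>Pow {1..n}. (\<lambda>m. if out m then 1 else 0) (card x))"
      by (simp flip: sum.inter_filter)
    also have "\<dots> = (\<Sum>m\<le>card {1..n}. real (card {1..n} choose m) * (if out m then 1 else 0))"
      by (rule sum_over_layers) simp
    also have "\<dots> = (\<Sum>m\<le>n. real (n choose m) * (if out m then 1 else 0))" by simp
    also have "\<dots> \<le> (\<Sum>m\<le>n. exp (- (c * real n)) * real (n choose (n div 2)))"
    proof (rule sum_mono)
      fix m assume "m \<in> {..n}"
      then show "real (n choose m) * (if out m then 1 else 0) \<le> exp (- (c * real n)) * real (n choose (n div 2))"
        using binomial_outer_layer[OF q, of n m] n by (auto simp: out_def c_def)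
    qed
    also have "\<dots> = ((real n + 1) * exp (- (c * real n))) * real (n choose (n div 2))" by simp
    also have "\<dots> \<le> \<epsilon> * real (n choose (n div 2))"
      using N[of n] n by (intro mult_right_mono) auto
    finally show "real (card (Pow {1..n} - middle_layers q n)) \<le> \<epsilon> * real (n choose (n div 2))" .
  qed
qed

section \<open>Supersaturation\<close>

text \<open>The tree after enumeration: \<open>R\<close> is its order on indices,
  \<open>attach\<close> says that each index arrives as a leaf whose comparabilities come from one
  earlier index, and \<open>h i\<close> is the window position that is to receive index
  \<open>i\<close>.\<close>

locale ranked_tree =
  fixes r k :: nat and R :: "nat \<Rightarrow> nat \<Rightarrow> bool" and h :: "nat \<Rightarrow> nat"
  assumes r_pos: "0 < r"
    and R_refl: "\<And>i. i < r \<Longrightarrow> R i i"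
    and h_less: "\<And>i. i < r \<Longrightarrow> h i < k"
    and h_mono: "\<And>i j. i < r \<Longrightarrow> j < r \<Longrightarrow> R i j \<Longrightarrow> i \<noteq> j \<Longrightarrow> h i < h j"
    and attach: "\<And>i. i < r \<Longrightarrow> 0 < i \<Longrightarrow> \<exists>u<i.
      (\<forall>w<i. (R w i \<longleftrightarrow> R w u) \<and> \<not> R i w) \<or> (\<forall>w<i. (R i w \<longleftrightarrow> R u w) \<and> \<not> R w i)"
begin

lemma k_pos: "0 < k" using h_less[OF r_pos] by simp

abbreviation has_dense_measure :: "nat \<Rightarrow> real \<Rightarrow> nat \<Rightarrow> nat set set \<Rightarrow> bool" where
  "has_dense_measure g c n F \<equiv> \<exists>\<mu>. capped r (lubell {1..n}) ((4 * real g / real n) ^ g) (embeddings r R F) \<mu> \<and>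
     c * sum (lubell {1..n}) F \<le> sum \<mu> (embeddings r R F)"

abbreviation has_container :: "nat \<Rightarrow> real \<Rightarrow> real \<Rightarrow> nat \<Rightarrow> nat set set \<Rightarrow> bool" where
  "has_container g c K n F \<equiv> \<exists>C. container_map (lubell {1..n}) (avoids r (embeddings r R F)) (r - 1)
     (K * (4 * real g / real n) ^ g * sum (lubell {1..n}) F) ((1 - c) * sum (lubell {1..n}) F) F C"

lemma supersaturation:
  assumes g: "0 < (g :: nat)" and \<epsilon>: "0 < (\<epsilon> :: real)"
  shows "\<exists>c>0. \<exists>q0. \<forall>q\<ge>q0. \<exists>N. \<forall>n\<ge>N. \<forall>F\<subseteq>middle_layers q n.
     real (g * (k - 1)) + \<epsilon> \<le> sum (lubell {1..n}) F \<longrightarrow> has_dense_measure g c n F"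
proof -
  define a where "a = real (g * (k - 1))"
  \<comment> \<open>The excess over \<open>a\<close> as a fraction of the weight. This fraction
    increases with the weight, so the least admissible weight \<open>a + \<epsilon>\<close>
    determines it.\<close>
  define \<epsilon>' where "\<epsilon>' = \<epsilon> / (a + \<epsilon>)"
  define \<delta> where "\<delta> = \<epsilon>' / (2 * real k)"
  \<comment> \<open>Chosen so that at most \<open>r\<close> earlier images spoil no more than half
    of the fraction \<open>\<delta>\<close> of chains.\<close>
  define \<beta> where "\<beta> = \<delta> / (4 * real r)"
  have a0: "0 \<le> a" by (simp add: a_def)
  have pos: "0 < \<epsilon>'" "0 < \<delta>" "0 < \<beta>"
    using \<epsilon> a0 r_pos k_pos by (auto simp: \<epsilon>'_def \<delta>_def \<beta>_def intro!: divide_pos_pos add_nonneg_pos)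
  define c where "c = (\<delta> / 2) ^ (r - 1) * (\<epsilon>' / 2)"
  have c: "0 < c" using pos by (simp add: c_def)
  \<comment> \<open>The term \<open>16\<close> makes \<open>lo\<close> and \<open>n - hi\<close> at
    least \<open>n / 4\<close> and keeps pair distances in the lower half of the binomial rows;
    \<open>8 / \<beta>\<close> then bounds \<open>hi - lo\<close> by \<open>\<beta>\<close> times
    \<open>n / 4\<close>.\<close>
  define q0 where "q0 = max 16 (nat \<lceil>8 / \<beta>\<rceil>)"
  show ?thesis
  proof (rule exI[of _ c], intro conjI c, rule exI[of _ q0], intro allI impI)
    fix q assume q: "q0 \<le> q"
    have q16: "16 \<le> q" using q by (simp add: q0_def)
    have "8 / \<beta> \<le> real q"
    proof -
      have "8 / \<beta> \<le> real (nat \<lceil>8 / \<beta>\<rceil>)" by (rule real_nat_ceiling_ge)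
      also have "\<dots> \<le> real q" using q by (simp add: q0_def)
      finally show ?thesis .
    qed
    then have q\<beta>: "8 \<le> \<beta> * real q" using pos by (simp add: divide_le_eq mult.commute)
    show "\<exists>N. \<forall>n\<ge>N. \<forall>F\<subseteq>middle_layers q n.
     real (g * (k - 1)) + \<epsilon> \<le> sum (lubell {1..n}) F \<longrightarrow> has_dense_measure g c n F"
    proof (rule exI[of _ 16], intro allI impI)
      fix n F
      assume n: "16 \<le> n" and F: "F \<subseteq> middle_layers q n"
        and big: "real (g * (k - 1)) + \<epsilon> \<le> sum (lubell {1..n}) F"
      define A where "A = {1..n}"
      define lo hi where "lo = n div 2 - n div q" and "hi = n div 2 + n div q"
      define \<tau> where "\<tau> = (4 * real g / real n) ^ g"
      define \<Lambda> where "\<Lambda> = sum (lubell A) F"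
      have A: "finite A" "card A = n" by (auto simp: A_def)
      have FA: "F \<subseteq> Pow A" using F by (auto simp: middle_layers_def A_def)
      have Fc: "lo \<le> card x" "card x \<le> hi" if "x \<in> F" for x
        using F that by (auto simp: middle_layers_def lo_def hi_def)
      have w16: "n div q * 16 \<le> n"
      proof -
        have "n div q * 16 \<le> n div q * q" using q16 by (rule mult_le_mono2)
        also have "\<dots> \<le> n" by (rule div_times_less_eq_dividend)
        finally show ?thesis .
      qed
      have lo4: "n \<le> 4 * lo" "8 * (n div q) \<le> 2 * lo" "0 < lo" "n \<le> 4 * (n - hi)" "8 * (n div q) \<le> 2 * (n - hi)" "hi < n"
        "hi - lo = 2 * (n div q)"
        using w16 n unfolding lo_def hi_def by linarith+
      have qn: "2 * real (n div q) \<le> \<beta> * (real n / 4)"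
      proof -
        have "real (n div q) * real q \<le> real n"
          using div_times_less_eq_dividend[of n q] by (metis of_nat_le_iff of_nat_mult)
        then have "real (n div q) * 8 \<le> real (n div q) * (\<beta> * real q)"
          using q\<beta> by (intro mult_left_mono) auto
        also have "\<dots> = \<beta> * (real (n div q) * real q)" by simp
        also have "\<dots> \<le> \<beta> * real n"
          using \<open>real (n div q) * real q \<le> real n\<close> pos by (intro mult_left_mono) auto
        finally show ?thesis by simp
      qed
      have \<beta>lo: "real (hi - lo) \<le> \<beta> * real lo"
      proof -
        have "\<beta> * (real n / 4) \<le> \<beta> * real lo" using lo4(1) pos by (intro mult_left_mono) auto
        then show ?thesis using qn lo4(7) by simp
      qed
      have \<beta>hi: "real (hi - lo) \<le> \<beta> * real (card A - hi)"
      proof -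
        have "\<beta> * (real n / 4) \<le> \<beta> * real (n - hi)" using lo4(4) pos by (intro mult_left_mono) auto
        then show ?thesis using qn lo4(7) A by simp
      qed
      have big': "\<epsilon>' * \<Lambda> \<le> \<Lambda> - real (g * (k - 1))"
      proof -
        have "\<epsilon> * \<Lambda> \<le> (\<Lambda> - a) * (a + \<epsilon>)"
        proof -
          have "0 \<le> a * (\<Lambda> - (a + \<epsilon>))"
            using a0 big by (intro mult_nonneg_nonneg) (auto simp: \<Lambda>_def A_def a_def)
          then show ?thesis by (simp add: algebra_simps)
        qed
        moreover have "0 < a + \<epsilon>" using \<epsilon> a0 by simp
        ultimately show ?thesis unfolding \<epsilon>'_def a_def[symmetric] by (simp add: divide_le_eq)
      qed
      obtain G :: "nat \<Rightarrow> nat set set" and B :: "nat \<Rightarrow> nat \<Rightarrow> nat set \<Rightarrow> nat set \<Rightarrow> nat list set" where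
        GF: "\<And>j. j < k \<Longrightarrow> G j \<subseteq> F" and
        Gbig: "\<And>j. j < k \<Longrightarrow> \<epsilon>' / 2 * sum (lubell A) F \<le> sum (lubell A) (G j)" and
        B: "\<And>j j' x y. j < k \<Longrightarrow> j' < k \<Longrightarrow> B j j' x y \<subseteq> chains_through A x \<inter> chains_through A y"
        "\<And>j j' x y. B j j' x y = B j' j y x"
        "\<And>j j' x y y'. j < k \<Longrightarrow> y \<noteq> y' \<Longrightarrow> B j j' x y \<inter> B j j' x y' = {}"
        "\<And>j j' x y \<sigma>. j < j' \<Longrightarrow> j' < k \<Longrightarrow> \<sigma> \<in> B j j' x y \<Longrightarrow> x \<subset> y \<and> card x + g \<le> card y"
        "\<And>j j' x. j < k \<Longrightarrow> j' < k \<Longrightarrow> x \<in> G j \<Longrightarrow>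
           \<epsilon>' / (2 * real k) * real (card (chains_through A x)) \<le> real (card (\<Union>y\<in>G j'. B j j' x y))"
        by (rule chain_windows[OF A(1) FA k_pos g pos(1) big'[unfolded \<Lambda>_def]]) (rule that, assumption+)
      interpret chain_kernel A F k g lo hi \<delta> \<tau> \<beta> G B
      proof
        show "finite A" "F \<subseteq> Pow A" "0 < lo" "hi < card A" "0 \<le> \<beta>" by (use A FA lo4 pos in auto)
        show "0 < \<tau>" using g n by (simp add: \<tau>_def)
        show "real (hi - lo) \<le> \<beta> * real lo" "real (hi - lo) \<le> \<beta> * real (card A - hi)" by fact+
        show "lo \<le> card x" "card x \<le> hi" if "x \<in> F" for x using Fc[OF that] by auto
        show "\<delta> * real (card (chains_through A x)) \<le> real (card (\<Union>y\<in>G j'. B j j' x y))"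
          if "j < k" "j' < k" "x \<in> G j" for j j' x using B(5)[OF that] by (simp add: \<delta>_def)
        fix x y assume xy: "x \<in> F" "y \<in> F" "x \<subset> y" "card x + g \<le> card y"
        have c: "lo \<le> card x" "card x \<le> hi" "lo \<le> card y" "card y \<le> hi" using Fc xy by auto
        have yA: "x \<subseteq> y" "y \<subseteq> A" using xy FA by auto
        have d: "card y - card x \<le> 2 * (n div q)" using c lo4(7) by linarith
        have nums: "2 * (card y - card x) \<le> card A - card x" "card A \<le> 4 * (card A - card x)"
          "2 * (card y - card x) \<le> card y" "card A \<le> 4 * card y"
          using c d lo4 unfolding A(2) by linarith+
        show "real (card (chains_through A x \<inter> chains_through A y)) \<le> \<tau> * real (card (chains_through A x)) \<and>
          real (card (chains_through A x \<inter> chains_through A y)) \<le> \<tau> * real (card (chains_through A y))"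
          using chains_through_pair_le[OF A(1) yA g xy(4) nums] unfolding \<tau>_def A(2) by blast
      qed (fact GF B)+
      \<comment> \<open>Only embeddings that send each index to its own class \<open>G (h i)\<close>
        receive weight; all other embeddings get weight zero.\<close>
      define H' where "H' = {f \<in> embeddings r R F. \<forall>i<r. f i \<in> G (h i)}"
      have few: "2 * real r * \<beta> \<le> \<delta> / 2" using r_pos by (simp add: \<beta>_def)
      have "\<exists>\<nu>. capped r (lubell A) \<tau> H' \<nu> \<and> (\<delta> / 2) ^ (r - 1) * sum (lubell A) (G (h 0)) \<le> sum \<nu> H'"
        unfolding H'_def by (rule embedding_measure[OF R_refl h_less h_mono attach few pos(2) r_pos order_refl])
      then obtain \<nu> where \<nu>: "capped r (lubell A) \<tau> H' \<nu>"
        "(\<delta> / 2) ^ (r - 1) * sum (lubell A) (G (h 0)) \<le> sum \<nu> H'" by blast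
      have sub: "H' \<subseteq> embeddings r R F" by (auto simp: H'_def)
      have finE: "finite (embeddings r R F)"
        by (rule finite_subset[of _ "{..<r} \<rightarrow>\<^sub>E F"]) (use finF in \<open>auto simp: embeddings_def intro!: finite_PiE\<close>)
      have "c * \<Lambda> \<le> (\<delta> / 2) ^ (r - 1) * sum (lubell A) (G (h 0))"
      proof -
        have "c * \<Lambda> = (\<delta> / 2) ^ (r - 1) * (\<epsilon>' / 2 * \<Lambda>)" by (simp add: c_def)
        also have "\<dots> \<le> (\<delta> / 2) ^ (r - 1) * sum (lubell A) (G (h 0))"
          using Gbig[OF h_less[OF r_pos]] pos by (intro mult_left_mono) (auto simp: \<Lambda>_def)
        finally show ?thesis .
      qed
      with \<nu>(2) have "c * \<Lambda> \<le> sum \<nu> H'" by linarith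
      then show "has_dense_measure g c n F"
        using capped_extend_zero[OF \<nu>(1) sub finE]
        unfolding A_def[symmetric] \<tau>_def[symmetric] \<Lambda>_def[symmetric]
        by (intro exI[of _ "\<lambda>f. if f \<in> H' then \<nu> f else 0"]) simp
    qed
  qed
qed

lemma layer_container:
  assumes g: "0 < (g :: nat)" and \<epsilon>: "0 < (\<epsilon> :: real)"
  shows "\<exists>c>0. \<exists>K>0. c \<le> 1 \<and> (\<exists>q0. \<forall>q\<ge>q0. \<exists>N. \<forall>n\<ge>N. \<forall>F\<subseteq>middle_layers q n.
     real (g * (k - 1)) + \<epsilon> \<le> sum (lubell {1..n}) F \<longrightarrow> has_container g c K n F)"
proof -
  obtain c0 q0 where c0: "0 < c0" and sat: "\<forall>q\<ge>q0. \<exists>N. \<forall>n\<ge>N. \<forall>F\<subseteq>middle_layers q n.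
     real (g * (k - 1)) + \<epsilon> \<le> sum (lubell {1..n}) F \<longrightarrow> has_dense_measure g c0 n F"
    using supersaturation[OF g \<epsilon>] by (elim exE conjE)
  obtain r' where r': "r = Suc r'" using r_pos by (cases r) auto
  obtain c K where cK: "0 < c" "0 < K" "c \<le> 1" and step: "\<forall>(F :: nat set set) p \<tau> H \<mu>.
     finite F \<and> F \<noteq> {} \<and> (\<forall>x. 0 \<le> p x) \<and> (\<forall>x\<in>F. 0 < p x) \<and> 0 < \<tau> \<and> H \<subseteq> {..<Suc r'} \<rightarrow>\<^sub>E F \<and>
     capped (Suc r') p \<tau> H \<mu> \<and> c0 * sum p F \<le> sum \<mu> H \<longrightarrow>
     (\<exists>C. container_map p (avoids (Suc r') H) r' (K * \<tau> * sum p F) ((1 - c) * sum p F) F C)"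
    using container_step[where 'v="nat set", rule_format, OF c0, of r'] by (elim exE conjE)
  show ?thesis
  proof (rule exI[of _ c], intro conjI cK, rule exI[of _ K], intro conjI cK, rule exI[of _ q0], intro allI impI)
    fix q assume "q0 \<le> q"
    with sat obtain N where N: "\<forall>n\<ge>N. \<forall>F\<subseteq>middle_layers q n.
     real (g * (k - 1)) + \<epsilon> \<le> sum (lubell {1..n}) F \<longrightarrow> has_dense_measure g c0 n F" by blast
    show "\<exists>N. \<forall>n\<ge>N. \<forall>F\<subseteq>middle_layers q n.
     real (g * (k - 1)) + \<epsilon> \<le> sum (lubell {1..n}) F \<longrightarrow> has_container g c K n F"
    proof (rule exI[of _ "max N 1"], intro allI impI)
      fix n F assume n: "max N 1 \<le> n" and F: "F \<subseteq> middle_layers q n"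
        and big: "real (g * (k - 1)) + \<epsilon> \<le> sum (lubell {1..n}) F"
      from N n F big obtain \<mu> where \<mu>: "capped r (lubell {1..n}) ((4 * real g / real n) ^ g) (embeddings r R F) \<mu>"
        "c0 * sum (lubell {1..n}) F \<le> sum \<mu> (embeddings r R F)" by (meson max.boundedE)
      have FP: "F \<subseteq> Pow {1..n}" using F by (auto simp: middle_layers_def)
      then have "finite F" by (rule finite_subset) simp
      moreover have "F \<noteq> {}"
      proof
        assume "F = {}"
        then have "real (g * (k - 1)) + \<epsilon> \<le> 0" using big by simp
        then show False using \<epsilon> by (smt (verit) of_nat_0_le_iff)
      qed
      moreover have "\<forall>x\<in>F. 0 < lubell {1..n} x" using FP by (auto intro!: lubell_pos)
      moreover have "0 < (4 * real g / real n) ^ g" using n g by simp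
      moreover have "embeddings r R F \<subseteq> {..<Suc r'} \<rightarrow>\<^sub>E F" by (auto simp: embeddings_def r')
      ultimately show "has_container g c K n F"
        using step[rule_format, of F "lubell {1..n}" "(4 * real g / real n) ^ g" "embeddings r R F" \<mu>] \<mu>
        unfolding r' diff_Suc_1 by (simp add: lubell_nonneg)
    qed
  qed
qed

end

text \<open>While the weight is at least \<open>\<theta>\<close>, a step multiplies it by at most
  \<open>1 - c\<close>. The length must not depend on when this stops, so a family that is already
  light merely pads its list. All entries share the bound for the first family because weights never
  increase.\<close>

lemma iterate_containers:
  fixes p :: "'v \<Rightarrow> real" and Ind :: "'v set \<Rightarrow> bool"
  assumes p0: "\<And>x. 0 \<le> p x" and c: "c \<le> 1" and M: "0 \<le> M"
    and step: "\<And>F. F \<subseteq> V \<Longrightarrow> \<theta> \<le> sum p F \<Longrightarrow>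
      \<exists>C. container_map p Ind s (M * sum p F) ((1 - c) * sum p F) F C"
    and c0: "0 \<le> c" and F: "F \<subseteq> V"
  shows "\<exists>C. container_map p Ind (J * s) (M * sum p F) (max \<theta> ((1 - c) ^ J * sum p F)) F C"
  using F
proof (induction J arbitrary: F)
  case 0
  show ?case by (rule exI[of _ "\<lambda>_. F"]) (auto simp: container_map_def)
next
  case (Suc J)
  have pF: "0 \<le> sum p F" for F using p0 by (simp add: sum_nonneg)
  show ?case
  proof (cases "\<theta> \<le> sum p F")
    case False
    \<comment> \<open>The family is light enough: it is its own container, and empty sets fill the
      list.\<close>
    have "\<exists>Ts. length Ts = Suc J * s \<and> (\<forall>T\<in>set Ts. T \<subseteq> I \<inter> F \<and> sum p T \<le> M * sum p F) \<and> I \<inter> F \<subseteq> F" for I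
      by (rule exI[of _ "replicate (Suc J * s) {}"]) (use M pF[of F] in auto)
    then show ?thesis using False by (intro exI[of _ "\<lambda>_. F"]) (auto simp: container_map_def)
  next
    case True
    obtain C0 where C00: "\<forall>Ts. C0 Ts \<subseteq> F \<and> sum p (C0 Ts) \<le> (1 - c) * sum p F"
      and I0: "\<forall>I. Ind I \<longrightarrow> (\<exists>Ts. length Ts = s \<and> (\<forall>T\<in>set Ts. T \<subseteq> I \<inter> F \<and> sum p T \<le> M * sum p F) \<and> I \<inter> F \<subseteq> C0 Ts)"
      using step[OF Suc.prems True] unfolding container_map_def by (elim exE conjE)
    have C0: "C0 Ts \<subseteq> F" "sum p (C0 Ts) \<le> (1 - c) * sum p F" for Ts using C00 by auto
    have "\<forall>Ts0. \<exists>C. container_map p Ind (J * s) (M * sum p (C0 Ts0)) (max \<theta> ((1 - c) ^ J * sum p (C0 Ts0))) (C0 Ts0) C"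
    proof
      fix Ts0
      have "C0 Ts0 \<subseteq> V" using C0(1)[of Ts0] Suc.prems by blast
      then show "\<exists>C. container_map p Ind (J * s) (M * sum p (C0 Ts0)) (max \<theta> ((1 - c) ^ J * sum p (C0 Ts0))) (C0 Ts0) C"
        by (rule Suc.IH)
    qed
    from choice[OF this] obtain C1 where C11: "\<forall>Ts0. container_map p Ind (J * s) (M * sum p (C0 Ts0))
        (max \<theta> ((1 - c) ^ J * sum p (C0 Ts0))) (C0 Ts0) (C1 Ts0)"
      by (elim exE)
    have C1: "C1 Ts0 Ts \<subseteq> C0 Ts0" "sum p (C1 Ts0 Ts) \<le> max \<theta> ((1 - c) ^ J * sum p (C0 Ts0))" for Ts0 Ts
      using C11[rule_format, of Ts0] by (auto simp: container_map_def)
    have I1: "\<exists>Ts. length Ts = J * s \<and> (\<forall>T\<in>set Ts. T \<subseteq> I \<inter> C0 Ts0 \<and> sum p T \<le> M * sum p (C0 Ts0)) \<and> I \<inter> C0 Ts0 \<subseteq> C1 Ts0 Ts"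
      if "Ind I" for Ts0 I
      using C11[rule_format, of Ts0, unfolded container_map_def, THEN conjunct2, rule_format, OF that] .
    \<comment> \<open>The first \<open>s\<close> entries determine the container of the first step,
      and the rest is read inside that container.\<close>
    define C where "C Ts = C1 (take s Ts) (drop s Ts)" for Ts
    have le: "sum p (C0 Ts0) \<le> sum p F" for Ts0
      using C0(2)[of Ts0] mult_right_mono[of "1 - c" 1 "sum p F"] c0 pF[of F] by simp
    have bound: "C Ts \<subseteq> F \<and> sum p (C Ts) \<le> max \<theta> ((1 - c) ^ Suc J * sum p F)" for Ts
    proof
      show "C Ts \<subseteq> F" using C1(1) C0(1) unfolding C_def by blast
      have "(1 - c) ^ J * sum p (C0 (take s Ts)) \<le> (1 - c) ^ J * ((1 - c) * sum p F)"
        using C0(2) c by (intro mult_left_mono) auto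
      then show "sum p (C Ts) \<le> max \<theta> ((1 - c) ^ Suc J * sum p F)"
        using C1(2)[of "take s Ts" "drop s Ts"] by (simp add: C_def mult_ac)
    qed
    have cov: "\<exists>Ts. length Ts = Suc J * s \<and> (\<forall>T\<in>set Ts. T \<subseteq> I \<inter> F \<and> sum p T \<le> M * sum p F) \<and> I \<inter> F \<subseteq> C Ts"
      if I: "Ind I" for I
    proof -
      obtain Ts0 where Ts0: "length Ts0 = s" "\<forall>T\<in>set Ts0. T \<subseteq> I \<inter> F \<and> sum p T \<le> M * sum p F" "I \<inter> F \<subseteq> C0 Ts0"
        using I0[rule_format, OF I] by (elim exE conjE)
      obtain Ts where Ts: "length Ts = J * s" "\<forall>T\<in>set Ts. T \<subseteq> I \<inter> C0 Ts0 \<and> sum p T \<le> M * sum p (C0 Ts0)"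
        "I \<inter> C0 Ts0 \<subseteq> C1 Ts0 Ts"
        using I1[OF I, of Ts0] by (elim exE conjE)
      have "M * sum p (C0 Ts0) \<le> M * sum p F" using le M by (rule mult_left_mono)
      then have "\<forall>T\<in>set Ts. T \<subseteq> I \<inter> F \<and> sum p T \<le> M * sum p F"
        using Ts(2) C0(1)[of Ts0] order_trans by blast
      then have "\<forall>T\<in>set (Ts0 @ Ts). T \<subseteq> I \<inter> F \<and> sum p T \<le> M * sum p F"
        using Ts0(2) by auto
      moreover have "I \<inter> F \<subseteq> C (Ts0 @ Ts)" using Ts0(1,3) Ts(3) by (auto simp: C_def)
      moreover have "length (Ts0 @ Ts) = Suc J * s" using Ts0(1) Ts(1) by simp
      ultimately show ?thesis by blast
    qed
    show ?thesis unfolding container_map_def using bound cov by blast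
  qed
qed

section \<open>Counting fingerprints\<close>

lemma card_Union_list_le:
  assumes "\<And>T. T \<in> set Ts \<Longrightarrow> real (card T) \<le> b"
  shows "real (card (\<Union> (set Ts))) \<le> real (length Ts) * b"
  using assms
proof (induction Ts)
  case (Cons T Ts)
  have "card (\<Union> (set (T # Ts))) \<le> card T + card (\<Union> (set Ts))"
    using card_Un_le[of T "\<Union> (set Ts)"] by simp
  then have "real (card (\<Union> (set (T # Ts)))) \<le> real (card T) + real (card (\<Union> (set Ts)))"
    by linarith
  also have "\<dots> \<le> b + real (length Ts) * b" using Cons by (intro add_mono) auto
  finally show ?case by (simp add: algebra_simps)
qed simp

text \<open>The exponential-moment bound: multiply by \<open>x ^ s\<close> with
  \<open>x = s / X \<le> 1\<close>, complete to \<open>(1 + x) ^ w\<close>, and use that this is at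
  most \<open>exp s\<close>.\<close>

lemma sum_binomials_le_exp:
  fixes X :: real
  assumes "real w \<le> X" "0 < s" "real s \<le> X"
  shows "(\<Sum>i\<le>s. real (w choose i)) \<le> (exp 1 * X / real s) ^ s"
proof -
  define x where "x = real s / X"
  have X: "0 < X" using assms by linarith
  have x: "0 < x" "x \<le> 1" using assms X by (auto simp: x_def)
  have "(\<Sum>i\<le>s. real (w choose i)) * x ^ s \<le> (\<Sum>i\<le>s. real (w choose i) * x ^ i)"
    unfolding sum_distrib_right using x by (intro sum_mono mult_left_mono power_decreasing) auto
  also have "\<dots> = (\<Sum>i\<in>{..s} \<inter> {..w}. real (w choose i) * x ^ i)"
    by (rule sum.mono_neutral_right) auto
  also have "\<dots> \<le> (\<Sum>i\<le>w. real (w choose i) * x ^ i)" using x by (intro sum_mono2) auto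
  also have "\<dots> = (x + 1) ^ w" by (simp add: binomial_ring)
  also have "\<dots> \<le> exp x ^ w" using x exp_ge_add_one_self[of x] by (intro power_mono) (auto simp: add.commute)
  also have "\<dots> = exp (real w * x)" by (simp add: exp_of_nat_mult)
  also have "\<dots> \<le> exp (real s)"
  proof -
    have "real w * real s \<le> X * real s" using assms(1) by (intro mult_right_mono) auto
    then show ?thesis using X by (simp add: x_def divide_le_eq mult.commute)
  qed
  also have "\<dots> = exp 1 ^ s" using exp_of_nat_mult[of s 1] by simp
  finally have "(\<Sum>i\<le>s. real (w choose i)) \<le> exp 1 ^ s / x ^ s" using x by (simp add: pos_le_divide_eq)
  also have "\<dots> = (exp 1 * X / real s) ^ s" using X by (simp add: x_def power_divide power_mult_distrib)
  finally show ?thesis .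
qed

lemma card_small_subsets:
  assumes "finite W"
  shows "card {U. U \<subseteq> W \<and> card U \<le> s} \<le> (\<Sum>i\<le>s. card W choose i)"
proof -
  have "{U. U \<subseteq> W \<and> card U \<le> s} = (\<Union>i\<le>s. {U. U \<subseteq> W \<and> card U = i})" by auto
  also have "card \<dots> \<le> (\<Sum>i\<le>s. card {U. U \<subseteq> W \<and> card U = i})" by (rule card_UN_le) simp
  also have "\<dots> = (\<Sum>i\<le>s. card W choose i)" using n_subsets[OF assms] by simp
  finally show ?thesis .
qed

lemma card_small_subsets_power:
  assumes "finite W"
  shows "card {U. U \<subseteq> W \<and> card U \<le> s} \<le> (card W + 1) ^ s"
proof -
  have "card {U. U \<subseteq> W \<and> card U \<le> s} \<le> (\<Sum>i\<le>s. card W choose i)" by (rule card_small_subsets[OF assms])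
  also have "\<dots> \<le> (\<Sum>i\<le>s. (s choose i) * card W ^ i)"
  proof (rule sum_mono)
    fix i assume i: "i \<in> {..s}"
    have "card W choose i \<le> card W ^ i"
      by (cases "i \<le> card W") (auto intro: binomial_le_pow simp: binomial_eq_0)
    also have "\<dots> \<le> (s choose i) * card W ^ i" using i by (simp add: Suc_leI)
    finally show "card W choose i \<le> (s choose i) * card W ^ i" .
  qed
  also have "\<dots> = (card W + 1) ^ s" using binomial[of "card W" 1 s] by simp
  finally show ?thesis .
qed

text \<open>Choose a set \<open>U\<close> that can serve as the union, then each of the
  \<open>m\<close> entries among the subsets of \<open>U\<close>.\<close>

lemma card_lists_small_union:
  assumes "finite W"
  shows "finite {Ts. length Ts = m \<and> (\<forall>T\<in>set Ts. T \<subseteq> W) \<and> card (\<Union> (set Ts)) \<le> s}" (is "finite ?L")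
    "card {Ts. length Ts = m \<and> (\<forall>T\<in>set Ts. T \<subseteq> W) \<and> card (\<Union> (set Ts)) \<le> s}
      \<le> (\<Sum>i\<le>s. card W choose i) * 2 ^ (m * s)"
proof -
  let ?U = "{U. U \<subseteq> W \<and> card U \<le> s}"
  let ?P = "\<lambda>U. {Ts. set Ts \<subseteq> Pow U \<and> length Ts = m}"
  have finU: "finite ?U" using assms by simp
  have finP: "finite (?P U)" if "U \<in> ?U" for U
    using that assms finite_subset[of U W] by (intro finite_lists_length_eq) auto
  have sub: "?L \<subseteq> (\<Union>U\<in>?U. ?P U)"
  proof
    fix Ts assume "Ts \<in> ?L"
    then have "\<Union> (set Ts) \<in> ?U" "Ts \<in> ?P (\<Union> (set Ts))" by auto
    then show "Ts \<in> (\<Union>U\<in>?U. ?P U)" by blast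
  qed
  have fin: "finite (\<Union>U\<in>?U. ?P U)" using finU finP by blast
  show "finite ?L" using sub fin by (rule finite_subset)
  have "card ?L \<le> card (\<Union>U\<in>?U. ?P U)" using fin sub by (rule card_mono)
  also have "\<dots> \<le> (\<Sum>U\<in>?U. card (?P U))" using finU by (rule card_UN_le)
  also have "\<dots> \<le> (\<Sum>U\<in>?U. 2 ^ (m * s))"
  proof (rule sum_mono)
    fix U assume U: "U \<in> ?U"
    then have finU: "finite U" using assms finite_subset by auto
    then have "card (?P U) = card (Pow U) ^ m" by (intro card_lists_length_eq) simp
    also have "\<dots> = 2 ^ (m * card U)" using finU by (simp add: card_Pow mult.commute flip: power_mult)
    also have "\<dots> \<le> 2 ^ (m * s)" using U by (intro power_increasing) auto
    finally show "card (?P U) \<le> 2 ^ (m * s)" .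
  qed
  also have "\<dots> = card ?U * 2 ^ (m * s)" by simp
  also have "\<dots> \<le> (\<Sum>i\<le>s. card W choose i) * 2 ^ (m * s)"
    by (intro mult_right_mono card_small_subsets assms) simp
  finally show "card ?L \<le> (\<Sum>i\<le>s. card W choose i) * 2 ^ (m * s)" .
qed

text \<open>The members of the encoding are the atoms: two elements lie in the same member if they lie
  in the same entries of the given list.\<close>
lemma disjoint_encoding:
  obtains enc :: "'v set list \<Rightarrow> 'v set list" where
    "\<And>Ts i j. i < length (enc Ts) \<Longrightarrow> j < length (enc Ts) \<Longrightarrow> i \<noteq> j \<Longrightarrow> enc Ts ! i \<inter> enc Ts ! j = {}"
    "\<And>Ts. length Ts = m \<Longrightarrow> \<Union> (set (enc Ts)) = \<Union> (set Ts)"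
    "inj_on enc {Ts. length Ts = m}"
proof -
  \<comment> \<open>One member for each set of indices, possibly empty. The vector has
    \<open>2 ^ m\<close> members, which is harmless since only the size of its union is
    constrained.\<close>
  obtain Qs where Qs: "set Qs = Pow {..<m}" "distinct Qs"
    using finite_distinct_list[of "Pow {..<m}"] by auto
  define ty where "ty Ts t = {i. i < m \<and> t \<in> Ts ! i}" for Ts :: "'v set list" and t
  define enc where "enc Ts = map (\<lambda>Q. {t \<in> \<Union> (set Ts). ty Ts t = Q}) Qs" for Ts :: "'v set list"
  have tyQ: "ty Ts t \<in> set Qs" for Ts t by (auto simp: Qs ty_def)
  have un: "\<Union> (set (enc Ts)) = \<Union> (set Ts)" for Ts using tyQ[of Ts] by (auto simp: enc_def)
  \<comment> \<open>An entry is the union of the atoms whose type contains its index, so the atoms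
    determine the list.\<close>
  have decode: "Ts ! i = (\<Union>j\<in>{j. j < length Qs \<and> i \<in> Qs ! j}. enc Ts ! j)"
    if "length Ts = m" "i < m" for Ts i
  proof
    show "Ts ! i \<subseteq> (\<Union>j\<in>{j. j < length Qs \<and> i \<in> Qs ! j}. enc Ts ! j)"
    proof
      fix t assume t: "t \<in> Ts ! i"
      obtain j where j: "j < length Qs" "Qs ! j = ty Ts t" using tyQ[of Ts t] by (auto simp: in_set_conv_nth)
      have "i \<in> ty Ts t" using t that by (simp add: ty_def)
      moreover have "Ts ! i \<in> set Ts" using that by simp
      then have "t \<in> enc Ts ! j" using t j by (auto simp: enc_def)
      ultimately show "t \<in> (\<Union>j\<in>{j. j < length Qs \<and> i \<in> Qs ! j}. enc Ts ! j)" using j by auto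
    qed
    show "(\<Union>j\<in>{j. j < length Qs \<and> i \<in> Qs ! j}. enc Ts ! j) \<subseteq> Ts ! i"
      by (auto simp: enc_def ty_def)
  qed
  show ?thesis
  proof (rule that[of enc])
    fix Ts i j assume "i < length (enc Ts)" "j < length (enc Ts)" "i \<noteq> j"
    then have "Qs ! i \<noteq> Qs ! j" using Qs(2) by (simp add: enc_def nth_eq_iff_index_eq)
    then show "enc Ts ! i \<inter> enc Ts ! j = {}" using \<open>i < length (enc Ts)\<close> \<open>j < length (enc Ts)\<close>
      by (auto simp: enc_def)
  next
    show "inj_on enc {Ts. length Ts = m}"
    proof (rule inj_onI)
      fix Ts Ts' assume "Ts \<in> {Ts. length Ts = m}" "Ts' \<in> {Ts. length Ts = m}" and eq: "enc Ts = enc Ts'"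
      then have l: "length Ts = m" "length Ts' = m" by auto
      show "Ts = Ts'"
      proof (rule nth_equalityI)
        fix i assume "i < length Ts"
        then have "i < m" using l by simp
        from decode[OF l(1) this] decode[OF l(2) this] show "Ts ! i = Ts' ! i" unfolding eq by (rule trans[OF _ sym])
      qed (use l in simp)
    qed
  qed (rule un)
qed

section \<open>Heights and copies of the poset\<close>

definition strict_height :: "'a set \<Rightarrow> ('a \<Rightarrow> 'a \<Rightarrow> bool) \<Rightarrow> 'a \<Rightarrow> nat" where
  "strict_height X le x = Max (card ` {C. is_chain X le C \<and> (\<forall>y\<in>C. le y x \<and> y \<noteq> x)})"

text \<open>Adding \<open>x\<close> to a longest chain strictly below \<open>x\<close> gives a
  longer chain, which lies strictly below every \<open>y\<close> above \<open>x\<close> and is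
  counted by the height of the poset. So the values are window positions below
  \<open>k\<close>.\<close>

lemma strict_height:
  assumes P: "poset_on X le"
  shows "x \<in> X \<Longrightarrow> strict_height X le x < poset_height X le"
    "x \<in> X \<Longrightarrow> y \<in> X \<Longrightarrow> le x y \<Longrightarrow> x \<noteq> y \<Longrightarrow> strict_height X le x < strict_height X le y"
proof -
  have finX: "finite X" by (rule poset_onD(1)[OF P])
  define S where "S x = {C. is_chain X le C \<and> (\<forall>y\<in>C. le y x \<and> y \<noteq> x)}" for x
  have finC: "finite {C. is_chain X le C}"
    by (rule finite_subset[of _ "Pow X"]) (use finX in \<open>auto simp: is_chain_def\<close>)
  have finS: "finite (S x)" for x by (rule finite_subset[OF _ finC]) (auto simp: S_def)
  have ins: "is_chain X le (insert x C)" "card (insert x C) = strict_height X le x + 1" "card C = strict_height X le x"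
    "C \<in> S x"
    if x: "x \<in> X" and "C = (SOME C. C \<in> S x \<and> card C = strict_height X le x)" for x C
  proof -
    have "{} \<in> S x" by (simp add: S_def is_chain_def)
    then have "strict_height X le x \<in> card ` S x"
      unfolding strict_height_def S_def[symmetric] using finS by (intro Max_in) auto
    then have "\<exists>C. C \<in> S x \<and> card C = strict_height X le x" by auto
    then have C: "C \<in> S x" "card C = strict_height X le x"
      using someI_ex[of "\<lambda>C. C \<in> S x \<and> card C = strict_height X le x"] that(2) by auto
    then have Ch: "C \<subseteq> X" "\<And>y z. y \<in> C \<Longrightarrow> z \<in> C \<Longrightarrow> le y z \<or> le z y" "\<And>y. y \<in> C \<Longrightarrow> le y x" "x \<notin> C"
      by (auto simp: S_def is_chain_def)
    have finCC: "finite C" using Ch(1) finX by (rule finite_subset)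
    show "is_chain X le (insert x C)"
      unfolding is_chain_def using x Ch poset_onD(2)[OF P x] by blast
    show "card (insert x C) = strict_height X le x + 1" using finCC Ch(4) C(2) by simp
    show "card C = strict_height X le x" "C \<in> S x" by fact+
  qed
  show "strict_height X le x < poset_height X le" if x: "x \<in> X"
  proof -
    note i = ins[OF x refl]
    have "card (insert x (SOME C. C \<in> S x \<and> card C = strict_height X le x)) \<le> poset_height X le"
      unfolding poset_height_def using finC i(1) by (intro Max_ge) auto
    then show ?thesis using i(2) by simp
  qed
  show "strict_height X le x < strict_height X le y" if x: "x \<in> X" and y: "y \<in> X" "le x y" "x \<noteq> y"
  proof -
    define C where "C = (SOME C. C \<in> S x \<and> card C = strict_height X le x)"
    note i = ins[OF x C_def]
    have below: "le z y \<and> z \<noteq> y" if z: "z \<in> C" for z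
    proof -
      have zx: "z \<in> X" "le z x" "z \<noteq> x" using i(4) z by (auto simp: S_def is_chain_def)
      have "le z y" by (rule poset_onD(4)[OF P zx(1) x y(1) zx(2) y(2)])
      moreover have "z \<noteq> y" using poset_onD(3)[OF P x y(1) y(2)] zx y(3) by auto
      ultimately show ?thesis by blast
    qed
    have "insert x C \<in> S y" using i(1) below y by (auto simp: S_def)
    then have "card (insert x C) \<le> strict_height X le y"
      unfolding strict_height_def S_def[symmetric] using finS by (intro Max_ge) auto
    then show ?thesis using i(2) by simp
  qed
qed

lemma embedding_is_copy:
  assumes P: "poset_on X le" and e: "bij_betw e {..<card X} X"
    and f: "f \<in> embeddings (card X) (\<lambda>i j. le (e i) (e j)) F" and F: "F \<subseteq> Pow {1..n}"
  shows "copy_of X le n (f ` {..<card X})"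
proof -
  let ?r = "card X"
  have fF: "f i \<in> F" if "i < ?r" for i using f that by (auto simp: embeddings_def)
  have fR: "le (e i) (e j) \<longleftrightarrow> f i \<subseteq> f j" if "i < ?r" "j < ?r" for i j
    using f that by (auto simp: embeddings_def)
  have eX: "e i \<in> X" if "i < ?r" for i using e that by (auto simp: bij_betw_def)
  have inj: "inj_on f {..<?r}"
  proof (rule inj_onI)
    fix i j assume ij: "i \<in> {..<?r}" "j \<in> {..<?r}" "f i = f j"
    then have "e i = e j" using fR[of i j] fR[of j i] by (intro poset_onD(3)[OF P]) (auto intro: eX)
    then show "i = j" using e ij by (auto simp: bij_betw_def inj_on_def)
  qed
  define e' where "e' = inv_into {..<?r} e"
  have e': "bij_betw e' X {..<?r}" unfolding e'_def by (rule bij_betw_inv_into[OF e])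
  have ee': "e (e' x) = x" if "x \<in> X" for x
    using that e unfolding e'_def by (auto simp: bij_betw_def f_inv_into_f)
  have e'r: "e' x < ?r" if "x \<in> X" for x using e' that by (auto simp: bij_betw_def)
  have "bij_betw (f \<circ> e') X (f ` {..<?r})"
    using e' inj_on_imp_bij_betw[OF inj] by (rule bij_betw_trans)
  moreover have "\<forall>x\<in>X. \<forall>y\<in>X. le x y \<longleftrightarrow> (f \<circ> e') x \<subseteq> (f \<circ> e') y"
    using fR[OF e'r e'r] ee' by auto
  moreover have "f ` {..<?r} \<subseteq> boolean_lattice n" using fF F by (auto simp: boolean_lattice_def)
  moreover have "card (f ` {..<?r}) = card X" using card_image[OF inj] by simp
  ultimately show ?thesis unfolding copy_of_def by blast
qed

section \<open>The two phases of the iteration\<close>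

lemma embeddings_mono: "F \<subseteq> F' \<Longrightarrow> embeddings r R F \<subseteq> embeddings r R F'"
  by (auto simp: embeddings_def PiE_iff)

lemma container_map_mono:
  assumes "container_map p Ind s M b F C" "\<And>I. Ind' I \<Longrightarrow> Ind I"
  shows "container_map p Ind' s M b F C"
  using assms unfolding container_map_def by blast

text \<open>With gap 5, an entry weighs \<open>O(n ^ -5)\<close> times a family of weight at most
  \<open>n + 1\<close>, hence \<open>O(n ^ -4)\<close>. Even linearly many such entries, at a cost
  of order \<open>n\<close> per element, stay well below the allowed exponent. The entries of
  \<open>Ts\<close> are only \<open>O(1 / n)\<close>, but they lie in \<open>C1 Us\<close>, whose
  weight is at most the constant \<open>\<theta>\<close>; this is what makes them cheap to
  count.\<close>

lemma (in ranked_tree) two_phase_containers: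
  assumes \<epsilon>: "0 < (\<epsilon> :: real)"
  shows "\<exists>\<theta>>0. \<exists>K>0. \<exists>m q N. \<forall>n\<ge>N.
     real (card (Pow {1..n} - middle_layers q n)) \<le> \<epsilon> * real (n choose (n div 2)) \<and>
     (\<exists>C1 C2. (\<forall>Us. C1 Us \<subseteq> middle_layers q n \<and> sum (lubell {1..n}) (C1 Us) \<le> \<theta>) \<and>
        (\<forall>Us Ts. C2 Us Ts \<subseteq> middle_layers q n \<and> sum (lubell {1..n}) (C2 Us Ts) \<le> real (k - 1) + \<epsilon>) \<and>
        (\<forall>I. avoids r (embeddings r R (middle_layers q n)) I \<longrightarrow>
           (\<exists>Us Ts. length Us = n * (r - 1) \<and> length Ts = m \<and>
              (\<forall>T\<in>set Us. T \<subseteq> I \<inter> middle_layers q n \<and> sum (lubell {1..n}) T \<le> K / real n ^ 4) \<and>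
              (\<forall>T\<in>set Ts. T \<subseteq> I \<inter> C1 Us \<and> sum (lubell {1..n}) T \<le> K / real n) \<and>
              I \<inter> middle_layers q n \<subseteq> C2 Us Ts)))"
proof -
  define \<theta> where "\<theta> = real (5 * (k - 1)) + 1"
  define \<theta>' where "\<theta>' = real (k - 1) + \<epsilon>"
  have \<theta>: "0 < \<theta>" "0 < \<theta>'" using \<epsilon> by (auto simp: \<theta>_def \<theta>'_def)
  obtain c5 K5 q5 where c5: "0 < c5" "0 < K5" "c5 \<le> 1" and step5: "\<forall>q\<ge>q5. \<exists>N. \<forall>n\<ge>N. \<forall>F\<subseteq>middle_layers q n.
     real (5 * (k - 1)) + 1 \<le> sum (lubell {1..n}) F \<longrightarrow> has_container 5 c5 K5 n F"
    using layer_container[of 5 1, OF zero_less_numeral zero_less_one] by (elim exE conjE)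
  obtain c1 K1 q1 where c1: "0 < c1" "0 < K1" "c1 \<le> 1" and step1: "\<forall>q\<ge>q1. \<exists>N. \<forall>n\<ge>N. \<forall>F\<subseteq>middle_layers q n.
     real (1 * (k - 1)) + \<epsilon> \<le> sum (lubell {1..n}) F \<longrightarrow> has_container 1 c1 K1 n F"
    using layer_container[OF zero_less_one \<epsilon>] by (elim exE conjE)
  define q where "q = max 1 (max q5 q1)"
  have q: "q5 \<le> q" "q1 \<le> q" "0 < q" by (simp_all add: q_def)
  obtain N5 where N5: "\<forall>n\<ge>N5. \<forall>F\<subseteq>middle_layers q n.
     real (5 * (k - 1)) + 1 \<le> sum (lubell {1..n}) F \<longrightarrow> has_container 5 c5 K5 n F"
    using step5[rule_format, OF q(1)] by (elim exE)
  obtain N1 where N1: "\<forall>n\<ge>N1. \<forall>F\<subseteq>middle_layers q n.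
     real (1 * (k - 1)) + \<epsilon> \<le> sum (lubell {1..n}) F \<longrightarrow> has_container 1 c1 K1 n F"
    using step1[rule_format, OF q(2)] by (elim exE)
  obtain N2 where N2: "\<And>n. n \<ge> N2 \<Longrightarrow> real (card (Pow {1..n} - middle_layers q n)) \<le> \<epsilon> * real (n choose (n div 2))"
    using few_sets_outside_middle_layers[OF q(3) \<epsilon>] by blast
  \<comment> \<open>The starting weight is at most \<open>n + 1\<close>, so for large
    \<open>n\<close> the \<open>n\<close> steps with factor \<open>1 - c5\<close> bring it below the
    constant \<open>\<theta>\<close>.\<close>
  have "((\<lambda>n. (real n + 1) * exp (- (c5 * real n))) \<longlongrightarrow> 0) sequentially" using c5(1) by real_asymp
  then have "eventually (\<lambda>n. (real n + 1) * exp (- (c5 * real n)) < \<theta>) sequentially"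
    using \<theta>(1) by (rule order_tendstoD)
  then obtain N3 where N3: "\<And>n. n \<ge> N3 \<Longrightarrow> (real n + 1) * exp (- (c5 * real n)) < \<theta>"
    by (auto simp: eventually_sequentially)
  \<comment> \<open>The second phase descends from one constant to another, so its number of steps
    does not depend on \<open>n\<close>.\<close>
  obtain J where J: "(1 - c1) ^ J < \<theta>' / \<theta>"
    using real_arch_pow_inv[of "\<theta>' / \<theta>" "1 - c1"] \<theta> c1 by auto
  \<comment> \<open>The first term bounds entries of the first phase, using
    \<open>n + 1 \<le> 2 * n\<close> and \<open>4 * 5 = 20\<close>; the second bounds those of the
    second phase.\<close>
  define K where "K = 2 * K5 * 20 ^ 5 + K1 * 4 * \<theta>"
  have K: "0 < K" using c5 c1 \<theta> by (simp add: K_def add_pos_pos)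
  show ?thesis
  proof (rule exI[of _ \<theta>], intro conjI \<theta>(1), rule exI[of _ K], intro conjI K,
      rule exI[of _ "J * (r - 1)"], rule exI[of _ q], rule exI[of _ "Max {1, N1, N2, N3, N5}"], intro allI impI conjI)
    fix n assume n: "Max {1, N1, N2, N3, N5} \<le> n"
    show "real (card (Pow {1..n} - middle_layers q n)) \<le> \<epsilon> * real (n choose (n div 2))"
      by (rule N2) (use n in auto)
    have nN: "N1 \<le> n" "N2 \<le> n" "N3 \<le> n" "N5 \<le> n" "1 \<le> n" using n by auto
    define V where "V = middle_layers q n"
    define p where "p = lubell {1..n}"
    define Ind where "Ind = avoids r (embeddings r R V)"
    have n0: "0 < real n" using n by auto
    have p0: "0 \<le> p x" for x by (simp add: p_def lubell_nonneg)
    have pF0: "0 \<le> sum p F" for F using p0 by (simp add: sum_nonneg)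
    have pV: "sum p V \<le> real n + 1"
      using lubell_total[of "{1..n}" V] by (auto simp: V_def p_def middle_layers_def)
    have IndD: "avoids r (embeddings r R F) I" if "Ind I" "F \<subseteq> V" for I F
      using that embeddings_mono[OF that(2), of r R] unfolding Ind_def avoids_def by blast
    define M5 where "M5 = K5 * (4 * real 5 / real n) ^ 5"
    define M1 where "M1 = K1 * (4 * real 1 / real n) ^ 1"
    have M: "0 \<le> M5" "0 \<le> M1" using c5 c1 by (auto simp: M5_def M1_def)
    have s5: "\<exists>C. container_map p Ind (r - 1) (M5 * sum p F) ((1 - c5) * sum p F) F C"
      if F: "F \<subseteq> V" "\<theta> \<le> sum p F" for F
    proof -
      obtain C where C: "container_map p (avoids r (embeddings r R F)) (r - 1) (M5 * sum p F) ((1 - c5) * sum p F) F C"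
        using N5[rule_format, OF nN(4), of F] F unfolding V_def p_def \<theta>_def M5_def by blast
      show ?thesis using container_map_mono[OF C] IndD[OF _ F(1)] by blast
    qed
    have s1: "\<exists>C. container_map p Ind (r - 1) (M1 * sum p F) ((1 - c1) * sum p F) F C"
      if F: "F \<subseteq> V" "\<theta>' \<le> sum p F" for F
    proof -
      obtain C where C: "container_map p (avoids r (embeddings r R F)) (r - 1) (M1 * sum p F) ((1 - c1) * sum p F) F C"
        using N1[rule_format, OF nN(1), of F] F unfolding V_def p_def \<theta>'_def M1_def mult_1 by blast
      show ?thesis using container_map_mono[OF C] IndD[OF _ F(1)] by blast
    qed
    have "\<exists>C. container_map p Ind (n * (r - 1)) (M5 * sum p V) (max \<theta> ((1 - c5) ^ n * sum p V)) V C"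
      by (rule iterate_containers[where V=V and \<theta>=\<theta>]) (use p0 c5 M s5 in auto)
    then obtain C1 where C1: "container_map p Ind (n * (r - 1)) (M5 * sum p V) (max \<theta> ((1 - c5) ^ n * sum p V)) V C1"
      by (elim exE)
    have "(1 - c5) ^ n * sum p V \<le> \<theta>"
    proof -
      have "(1 - c5) ^ n \<le> exp (- c5) ^ n"
        using c5 exp_ge_add_one_self[of "- c5"] by (intro power_mono) auto
      also have "\<dots> = exp (- (c5 * real n))" by (simp add: mult.commute flip: exp_of_nat_mult)
      finally have "(1 - c5) ^ n * sum p V \<le> exp (- (c5 * real n)) * (real n + 1)"
        using pV pF0 by (intro mult_mono) auto
      also have "\<dots> < \<theta>" using N3[of n] n by (simp add: mult.commute)
      finally show ?thesis by simp
    qed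
    then have C1V: "C1 Us \<subseteq> V" "sum p (C1 Us) \<le> \<theta>" for Us using C1 by (auto simp: container_map_def)
    have "\<forall>Us. \<exists>C. container_map p Ind (J * (r - 1)) (M1 * sum p (C1 Us)) (max \<theta>' ((1 - c1) ^ J * sum p (C1 Us))) (C1 Us) C"
      by (intro allI iterate_containers[where V=V and \<theta>=\<theta>']) (use p0 c1 M s1 C1V in auto)
    from choice[OF this] obtain C2 where C2: "\<forall>Us. container_map p Ind (J * (r - 1)) (M1 * sum p (C1 Us))
        (max \<theta>' ((1 - c1) ^ J * sum p (C1 Us))) (C1 Us) (C2 Us)"
      by (elim exE)
    have C2V: "C2 Us Ts \<subseteq> V \<and> sum p (C2 Us Ts) \<le> \<theta>'" for Us Ts
    proof
      show "C2 Us Ts \<subseteq> V" using C2 C1V unfolding container_map_def by blast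
      have "(1 - c1) ^ J * sum p (C1 Us) \<le> \<theta>' / \<theta> * \<theta>"
        using J C1V(2)[of Us] pF0 \<theta> by (intro mult_mono) auto
      then have "max \<theta>' ((1 - c1) ^ J * sum p (C1 Us)) = \<theta>'" using \<theta> by (simp add: max_absorb1)
      then show "sum p (C2 Us Ts) \<le> \<theta>'" using C2[rule_format, of Us] unfolding container_map_def by metis
    qed
    have M5K: "M5 * sum p V \<le> K / real n ^ 4"
    proof -
      have "M5 * sum p V \<le> K5 * (20 / real n) ^ 5 * (2 * real n)"
        unfolding M5_def using pV n0 n c5 by (intro mult_mono) (auto simp: pF0)
      also have "\<dots> = 2 * K5 * 20 ^ 5 / real n ^ 4"
        using n0 by (simp add: power_divide field_simps eval_nat_numeral)
      also have "\<dots> \<le> K / real n ^ 4" using c1 \<theta> by (intro divide_right_mono) (auto simp: K_def)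
      finally show ?thesis .
    qed
    have M1K: "M1 * sum p (C1 Us) \<le> K / real n" for Us
    proof -
      have "M1 * sum p (C1 Us) \<le> M1 * \<theta>" using C1V M by (intro mult_left_mono)
      also have "\<dots> = K1 * 4 * \<theta> / real n" by (simp add: M1_def)
      also have "\<dots> \<le> K / real n" using c5 by (intro divide_right_mono) (auto simp: K_def)
      finally show ?thesis .
    qed
    have cover: "\<exists>Us Ts. length Us = n * (r - 1) \<and> length Ts = J * (r - 1) \<and>
              (\<forall>T\<in>set Us. T \<subseteq> I \<inter> V \<and> sum p T \<le> K / real n ^ 4) \<and>
              (\<forall>T\<in>set Ts. T \<subseteq> I \<inter> C1 Us \<and> sum p T \<le> K / real n) \<and>
              I \<inter> V \<subseteq> C2 Us Ts" if I: "Ind I" for I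
    proof -
      obtain Us where Us: "length Us = n * (r - 1)" "\<forall>T\<in>set Us. T \<subseteq> I \<inter> V \<and> sum p T \<le> M5 * sum p V"
        "I \<inter> V \<subseteq> C1 Us"
        using C1[unfolded container_map_def, THEN conjunct2, rule_format, OF I] by (elim exE conjE)
      obtain Ts where Ts: "length Ts = J * (r - 1)" "\<forall>T\<in>set Ts. T \<subseteq> I \<inter> C1 Us \<and> sum p T \<le> M1 * sum p (C1 Us)"
        "I \<inter> C1 Us \<subseteq> C2 Us Ts"
        using C2[rule_format, of Us, unfolded container_map_def, THEN conjunct2, rule_format, OF I] by (elim exE conjE)
      have "\<forall>T\<in>set Us. T \<subseteq> I \<inter> V \<and> sum p T \<le> K / real n ^ 4" using Us(2) M5K by (meson order_trans)
      moreover have "\<forall>T\<in>set Ts. T \<subseteq> I \<inter> C1 Us \<and> sum p T \<le> K / real n" using Ts(2) M1K by (meson order_trans)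
      moreover have "I \<inter> V \<subseteq> C2 Us Ts" using Us(3) Ts(3) by blast
      ultimately show ?thesis using Us(1) Ts(1) by (intro exI[of _ Us] exI[of _ Ts] conjI)
    qed
    show "\<exists>C1 C2. (\<forall>Us. C1 Us \<subseteq> middle_layers q n \<and> sum (lubell {1..n}) (C1 Us) \<le> \<theta>) \<and>
        (\<forall>Us Ts. C2 Us Ts \<subseteq> middle_layers q n \<and> sum (lubell {1..n}) (C2 Us Ts) \<le> real (k - 1) + \<epsilon>) \<and>
        (\<forall>I. avoids r (embeddings r R (middle_layers q n)) I \<longrightarrow>
           (\<exists>Us Ts. length Us = n * (r - 1) \<and> length Ts = J * (r - 1) \<and>
              (\<forall>T\<in>set Us. T \<subseteq> I \<inter> middle_layers q n \<and> sum (lubell {1..n}) T \<le> K / real n ^ 4) \<and>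
              (\<forall>T\<in>set Ts. T \<subseteq> I \<inter> C1 Us \<and> sum (lubell {1..n}) T \<le> K / real n) \<and>
              I \<inter> middle_layers q n \<subseteq> C2 Us Ts))"
      unfolding V_def[symmetric] p_def[symmetric] \<theta>'_def[symmetric] Ind_def[symmetric]
      using C1V C2V cover by (intro exI[of _ C1] exI[of _ C2] conjI allI impI) auto
  qed
qed

section \<open>Assembling the fingerprint\<close>

lemma sum_card_bounded_lists:
  fixes A :: "'v list set" and B :: "'v list \<Rightarrow> 'v list set" and b :: real
  assumes "finite A" "\<And>Us. Us \<in> A \<Longrightarrow> finite (B Us) \<and> real (card (B Us)) \<le> b"
    and S: "S \<subseteq> (\<lambda>(Us, Ts). enc (Us @ Ts)) ` (SIGMA Us:A. B Us)"
  shows "real (card S) \<le> real (card A) * b"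
proof -
  have fin: "finite (SIGMA Us:A. B Us)" using assms(1,2) by blast
  have "card S \<le> card ((\<lambda>(Us, Ts). enc (Us @ Ts)) ` (SIGMA Us:A. B Us))"
    using fin S by (intro card_mono) auto
  also have "\<dots> \<le> card (SIGMA Us:A. B Us)" using fin by (rule card_image_le)
  also have "\<dots> = (\<Sum>Us\<in>A. card (B Us))" using assms(1,2) by simp
  finally have "real (card S) \<le> (\<Sum>Us\<in>A. real (card (B Us)))" by (simp flip: of_nat_sum)
  also have "\<dots> \<le> (\<Sum>Us\<in>A. b)" using assms(2) by (intro sum_mono) auto
  finally show ?thesis by simp
qed

lemma card_lists_small_union_real:
  fixes X :: real
  assumes "finite W" "real (card W) \<le> X" "real s \<le> X"
  shows "real (card {Ts. length Ts = m \<and> (\<forall>T\<in>set Ts. T \<subseteq> W) \<and> card (\<Union> (set Ts)) \<le> s})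
    \<le> (2 ^ m * exp 1 * X / real s) ^ s"
proof -
  have "real (card {Ts. length Ts = m \<and> (\<forall>T\<in>set Ts. T \<subseteq> W) \<and> card (\<Union> (set Ts)) \<le> s})
      \<le> real ((\<Sum>i\<le>s. card W choose i) * 2 ^ (m * s))"
    using card_lists_small_union(2)[OF assms(1)] by (intro of_nat_mono)
  also have "\<dots> = (\<Sum>i\<le>s. real (card W choose i)) * (2 ^ m) ^ s"
    by (simp add: power_mult)
  also have "\<dots> \<le> (2 ^ m * exp 1 * X / real s) ^ s"
  \<comment> \<open>At \<open>s = 0\<close> both sides are \<open>1\<close>: the quotient by zero is
    only raised to the power zero.\<close>
  proof (cases "s = 0")
    case False
    then have "(\<Sum>i\<le>s. real (card W choose i)) * (2 ^ m) ^ s \<le> (exp 1 * X / real s) ^ s * (2 ^ m) ^ s"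
      using assms by (intro mult_right_mono sum_binomials_le_exp) auto
    also have "\<dots> = (exp 1 * X / real s * 2 ^ m) ^ s" by (rule power_mult_distrib[symmetric])
    finally show ?thesis by (simp add: mult_ac)
  qed simp
  finally show ?thesis .
qed

text \<open>A crude count is enough for the first phase: an element of the whole lattice costs a
  factor \<open>2 ^ n + 1\<close>, at most \<open>exp (n + 1)\<close>.\<close>

lemma card_lists_small_members:
  fixes x :: real and n l :: nat
  assumes x: "0 \<le> x"
  shows "finite {Us. set Us \<subseteq> {U. U \<subseteq> Pow {1..n} \<and> card U \<le> nat \<lfloor>x\<rfloor>} \<and> length Us = l}" (is "finite ?A")
    "real (card {Us. set Us \<subseteq> {U. U \<subseteq> Pow {1..n} \<and> card U \<le> nat \<lfloor>x\<rfloor>} \<and> length Us = l})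
      \<le> exp ((real n + 1) * x * real l)"
proof -
  let ?S = "{U. U \<subseteq> Pow {1..n} \<and> card U \<le> nat \<lfloor>x\<rfloor>}"
  have finS: "finite ?S" by simp
  show "finite ?A" by (rule finite_lists_length_eq[OF finS])
  have "card ?A = card ?S ^ l" by (rule card_lists_length_eq[OF finS])
  also have "\<dots> \<le> ((2 ^ n + 1) ^ nat \<lfloor>x\<rfloor>) ^ l"
    using card_small_subsets_power[of "Pow {1..n}" "nat \<lfloor>x\<rfloor>"] by (intro power_mono) (auto simp: card_Pow)
  finally have "real (card ?A) \<le> real (((2 ^ n + 1) ^ nat \<lfloor>x\<rfloor>) ^ l)" by (rule of_nat_mono)
  also have "\<dots> = (2 ^ n + 1) ^ (nat \<lfloor>x\<rfloor> * l)" by (simp add: power_mult add.commute)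
  also have "\<dots> \<le> exp (real n + 1) ^ (nat \<lfloor>x\<rfloor> * l)"
  proof (rule power_mono)
    have "(2 :: real) ^ n + 1 \<le> 2 ^ Suc n" by simp
    also have "\<dots> \<le> exp 1 ^ Suc n" using exp_ge_add_one_self[of 1] by (intro power_mono) auto
    also have "\<dots> = exp (real n + 1)" by (simp add: exp_of_nat_mult[symmetric] add.commute mult_exp_exp)
    finally show "(2 :: real) ^ n + 1 \<le> exp (real n + 1)" .
  qed simp
  also have "\<dots> = exp (real (nat \<lfloor>x\<rfloor> * l) * (real n + 1))" by (rule exp_of_nat_mult[symmetric])
  also have "\<dots> \<le> exp ((real n + 1) * x * real l)"
  proof -
    have "real (nat \<lfloor>x\<rfloor>) \<le> x" using x by linarith
    then have "real (nat \<lfloor>x\<rfloor>) * (real l * (real n + 1)) \<le> x * (real l * (real n + 1))"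
      by (intro mult_right_mono) auto
    then show ?thesis by (simp add: mult_ac)
  qed
  finally show "real (card ?A) \<le> exp ((real n + 1) * x * real l)" .
qed

theorem theorem6p4:
  fixes X :: "'a set" and le :: "'a \<Rightarrow> 'a \<Rightarrow> bool" and k :: nat and \<epsilon> :: real
  assumes "tree_poset X le"
    and "poset_height X le = k" and "k \<ge> 2"
    and "\<epsilon> > 0"
  shows "\<exists>K::real. K > 0 \<and> (\<exists>N. \<forall>n\<ge>N.
     \<exists>calT g C. fingerprint X le n calT g C \<and> finite calT \<and>
       (\<forall>T\<in>calT. real (card (vec_union T)) \<le> K / real n * real (n choose (n div 2))) \<and>
       (\<forall>s::nat. real (card {T\<in>calT. card (vec_union T) = s})
          \<le> (K * real (n choose (n div 2)) / real s) ^ s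
             * exp (K / real n * real (n choose (n div 2)))) \<and>
       (\<forall>I\<in>indep_sets X le n.
          real (card (C (g I))) \<le> (real k - 1 + \<epsilon>) * real (n choose (n div 2))))"
proof -
  note P = tree_posetD(1)[OF assms(1)]
  define r where "r = card X"
  obtain e where e: "bij_betw e {..<r} X" and att: "\<forall>i<r. 0 < i \<longrightarrow> (\<exists>u<i.
      (\<forall>w<i. (le (e w) (e i) \<longleftrightarrow> le (e w) (e u)) \<and> \<not> le (e i) (e w)) \<or>
      (\<forall>w<i. (le (e i) (e w) \<longleftrightarrow> le (e u) (e w)) \<and> \<not> le (e w) (e i)))"
    using tree_poset_enumeration[OF assms(1)] unfolding r_def by (elim exE conjE)
  have eX: "e i \<in> X" if "i < r" for i using e that by (auto simp: bij_betw_def)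
  define R where "R = (\<lambda>i j. le (e i) (e j))"
  define h where "h i = strict_height X le (e i)" for i
  interpret ranked_tree r k R h
  proof
    show "0 < r" using tree_posetD(2,4)[OF assms(1)] by (simp add: r_def card_gt_0_iff)
    show "R i i" if "i < r" for i unfolding R_def by (rule poset_onD(2)[OF P eX[OF that]])
    show "h i < k" if "i < r" for i
      using strict_height(1)[OF P eX[OF that]] assms(2) by (simp add: h_def)
    show "h i < h j" if "i < r" "j < r" "R i j" "i \<noteq> j" for i j
      unfolding h_def
    proof (rule strict_height(2)[OF P eX[OF that(1)] eX[OF that(2)]])
      show "le (e i) (e j)" using that(3) by (simp add: R_def)
      show "e i \<noteq> e j" using that e by (auto simp: bij_betw_def inj_on_def)
    qed
    show "\<exists>u<i. (\<forall>w<i. (R w i \<longleftrightarrow> R w u) \<and> \<not> R i w) \<or> (\<forall>w<i. (R i w \<longleftrightarrow> R u w) \<and> \<not> R w i)"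
      if "i < r" "0 < i" for i
      using att that unfolding R_def by blast
  qed
  define l where "l = r - 1"
  \<comment> \<open>One half is for the final containers, the other for the sets outside the middle
    layers.\<close>
  have "0 < \<epsilon> / 2" using assms(4) by simp
  from two_phase_containers[OF this] obtain \<theta> K m q N where \<theta>: "0 < \<theta>" and K: "0 < K"
    and tp: "\<forall>n\<ge>N.
     real (card (Pow {1..n} - middle_layers q n)) \<le> \<epsilon> / 2 * real (n choose (n div 2)) \<and>
     (\<exists>C1 C2. (\<forall>Us. C1 Us \<subseteq> middle_layers q n \<and> sum (lubell {1..n}) (C1 Us) \<le> \<theta>) \<and>
        (\<forall>Us Ts. C2 Us Ts \<subseteq> middle_layers q n \<and> sum (lubell {1..n}) (C2 Us Ts) \<le> real (k - 1) + \<epsilon> / 2) \<and>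
        (\<forall>I. avoids r (embeddings r R (middle_layers q n)) I \<longrightarrow>
           (\<exists>Us Ts. length Us = n * l \<and> length Ts = m \<and>
              (\<forall>T\<in>set Us. T \<subseteq> I \<inter> middle_layers q n \<and> sum (lubell {1..n}) T \<le> K / real n ^ 4) \<and>
              (\<forall>T\<in>set Ts. T \<subseteq> I \<inter> C1 Us \<and> sum (lubell {1..n}) T \<le> K / real n) \<and>
              I \<inter> middle_layers q n \<subseteq> C2 Us Ts)))"
    unfolding l_def by (elim exE conjE)
  \<comment> \<open>\<open>Ka\<close> bounds the size of a fingerprint, \<open>Kc\<close> the
    exponent that counts the first lists, and \<open>Kd\<close> the base that counts the second
    lists.\<close>
  define Ka where "Ka = K * (real l + real m)"
  define Kc where "Kc = 2 * real l * K"
  define Kd where "Kd = 2 ^ m * exp 1 * \<theta>"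
  have nonneg: "0 \<le> Ka" "0 \<le> Kc" "0 \<le> Kd" using K \<theta> by (auto simp: Ka_def Kc_def Kd_def)
  define Kf where "Kf = 1 + Ka + Kc + Kd"
  have Kf: "0 < Kf" "Ka \<le> Kf" "Kc \<le> Kf" "Kd \<le> Kf" using nonneg by (auto simp: Kf_def)
  show ?thesis
  proof (rule exI[of _ Kf], intro conjI Kf, rule exI[of _ "max (max N 1) (nat \<lceil>Ka / \<theta>\<rceil>)"], intro allI impI)
    fix n assume "max (max N 1) (nat \<lceil>Ka / \<theta>\<rceil>) \<le> n"
    then have n: "N \<le> n" "1 \<le> n" "nat \<lceil>Ka / \<theta>\<rceil> \<le> n" by auto
    have n1: "1 \<le> real n" using n by simp
    define V where "V = middle_layers q n"
    define p where "p = lubell {1..n}"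
    define b where "b = real (n choose (n div 2))"
    have b: "0 \<le> b" by (simp add: b_def)
    have VB: "V \<subseteq> Pow {1..n}" by (auto simp: V_def middle_layers_def)
    have card_le: "real (card F) \<le> b * sum p F" if "F \<subseteq> Pow {1..n}" for F
      using card_le_lubell[OF _ that] by (simp add: b_def p_def)
    note tpn = tp[rule_format, OF n(1), folded V_def p_def b_def]
    note out = tpn[THEN conjunct1]
    obtain C1 C2 where C1': "\<forall>Us. C1 Us \<subseteq> V \<and> sum p (C1 Us) \<le> \<theta>"
      and C2': "\<forall>Us Ts. C2 Us Ts \<subseteq> V \<and> sum p (C2 Us Ts) \<le> real (k - 1) + \<epsilon> / 2"
      and fp: "\<forall>I. avoids r (embeddings r R V) I \<longrightarrow>
           (\<exists>Us Ts. length Us = n * l \<and> length Ts = m \<and>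
              (\<forall>T\<in>set Us. T \<subseteq> I \<inter> V \<and> sum p T \<le> K / real n ^ 4) \<and>
              (\<forall>T\<in>set Ts. T \<subseteq> I \<inter> C1 Us \<and> sum p T \<le> K / real n) \<and>
              I \<inter> V \<subseteq> C2 Us Ts)"
      using tpn[THEN conjunct2] by (elim exE conjE)
    have C1: "C1 Us \<subseteq> V" "sum p (C1 Us) \<le> \<theta>" for Us using C1' by auto
    have C2: "C2 Us Ts \<subseteq> V" "sum p (C2 Us Ts) \<le> real (k - 1) + \<epsilon> / 2" for Us Ts using C2' by auto
    define cond where "cond I Us Ts \<longleftrightarrow> length Us = n * l \<and> length Ts = m \<and>
              (\<forall>T\<in>set Us. T \<subseteq> I \<inter> V \<and> sum p T \<le> K / real n ^ 4) \<and>
              (\<forall>T\<in>set Ts. T \<subseteq> I \<inter> C1 Us \<and> sum p T \<le> K / real n) \<and>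
              I \<inter> V \<subseteq> C2 Us Ts" for I Us Ts
    define good where "good I Ws \<longleftrightarrow> (\<exists>Us Ts. Ws = Us @ Ts \<and> cond I Us Ts)" for I Ws
    define tup where "tup I = (SOME Ws. good I Ws)" for I
    have tup: "good I (tup I)" if I: "I \<in> indep_sets X le n" for I
    proof -
      have "avoids r (embeddings r R V) I"
        unfolding avoids_def
      proof (intro ballI notI)
        fix f assume f: "f \<in> embeddings r R V" "f ` {..<r} \<subseteq> I"
        have "copy_of X le n (f ` {..<r})"
          using embedding_is_copy[OF P e[unfolded r_def] f(1)[unfolded r_def R_def] VB] by (simp add: r_def)
        then show False using I f(2) by (auto simp: indep_sets_def)
      qed
      then have "\<exists>Us Ts. cond I Us Ts" unfolding cond_def by (rule fp[rule_format])
      then have "\<exists>Ws. good I Ws" unfolding good_def by blast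
      then show ?thesis unfolding tup_def by (rule someI_ex)
    qed
    have IB: "I \<subseteq> Pow {1..n}" if "I \<in> indep_sets X le n" for I
      using that by (simp add: indep_sets_def boolean_lattice_def)
    define L where "L = n * l + m"
    obtain enc :: "nat set set list \<Rightarrow> nat set set list" where
      enc_disj: "\<And>Ts i j. i < length (enc Ts) \<Longrightarrow> j < length (enc Ts) \<Longrightarrow> i \<noteq> j \<Longrightarrow> enc Ts ! i \<inter> enc Ts ! j = {}"
      and enc_union: "\<And>Ts. length Ts = L \<Longrightarrow> \<Union> (set (enc Ts)) = \<Union> (set Ts)"
      and enc_inj: "inj_on enc {Ts. length Ts = L}"
      by (rule disjoint_encoding[where m=L and 'v="nat set"]) (rule that, assumption+)
    define g where "g I = enc (tup I)" for I
    \<comment> \<open>Since \<open>enc\<close> is injective on lists of length \<open>L\<close>, the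
      disjoint vector alone determines both lists and therefore the container.\<close>
    define dec where "dec = inv_into {Ts. length Ts = L} enc"
    define C where "C T = C2 (take (n * l) (dec T)) (drop (n * l) (dec T)) \<union> (Pow {1..n} - V)" for T
    define calT where "calT = g ` indep_sets X le n"
    have tup_len: "length (tup I) = L" if "I \<in> indep_sets X le n" for I
      using tup[OF that] by (auto simp: good_def cond_def L_def)
    have dec: "dec (g I) = tup I" if "I \<in> indep_sets X le n" for I
      unfolding dec_def g_def using tup_len[OF that] by (intro inv_into_f_f[OF enc_inj]) simp
    have union: "vec_union (g I) = \<Union> (set (tup I))" if "I \<in> indep_sets X le n" for I
      unfolding vec_union_def g_def by (rule enc_union[OF tup_len[OF that]])
    have unionI: "vec_union (g I) \<subseteq> I" if I: "I \<in> indep_sets X le n" for I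
    proof -
      obtain Us Ts where W: "tup I = Us @ Ts" "cond I Us Ts" using tup[OF I] unfolding good_def by blast
      then have "\<forall>T\<in>set (tup I). T \<subseteq> I" by (auto simp: cond_def)
      then show ?thesis unfolding union[OF I] by blast
    qed
    have size: "real (card (vec_union (g I))) \<le> Ka / real n * b" if I: "I \<in> indep_sets X le n" for I
    proof -
      obtain Us Ts where W: "tup I = Us @ Ts" "length Us = n * l" "length Ts = m"
        "\<forall>T\<in>set Us. T \<subseteq> I \<inter> V \<and> sum p T \<le> K / real n ^ 4" "\<forall>T\<in>set Ts. T \<subseteq> I \<inter> C1 Us \<and> sum p T \<le> K / real n"
        using tup[OF I] unfolding good_def cond_def by (elim exE conjE)
      have 1: "real (card T) \<le> b * (K / real n ^ 4)" if "T \<in> set Us" for T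
      proof -
        have "T \<subseteq> Pow {1..n}" using W(4) that IB[OF I] by blast
        then have "real (card T) \<le> b * sum p T" by (rule card_le)
        also have "\<dots> \<le> b * (K / real n ^ 4)" using W(4) that b by (intro mult_left_mono) auto
        finally show ?thesis .
      qed
      have 2: "real (card T) \<le> b * (K / real n)" if "T \<in> set Ts" for T
      proof -
        have "T \<subseteq> Pow {1..n}" using W(5) that IB[OF I] by blast
        then have "real (card T) \<le> b * sum p T" by (rule card_le)
        also have "\<dots> \<le> b * (K / real n)" using W(5) that b by (intro mult_left_mono) auto
        finally show ?thesis .
      qed
      have "card (vec_union (g I)) \<le> card (\<Union> (set Us)) + card (\<Union> (set Ts))"
        unfolding union[OF I] W(1) using card_Un_le by simp
      then have "real (card (vec_union (g I))) \<le> real (card (\<Union> (set Us))) + real (card (\<Union> (set Ts)))" by linarith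
      also have "\<dots> \<le> real (length Us) * (b * (K / real n ^ 4)) + real (length Ts) * (b * (K / real n))"
        by (intro add_mono card_Union_list_le 1 2)
      also have "\<dots> \<le> real l * (b * (K / real n)) + real m * (b * (K / real n))"
      proof (rule add_mono)
        \<comment> \<open>The first list has \<open>n * l\<close> entries of relative size
          \<open>K / n ^ 4\<close>; together they are no larger than \<open>l\<close> entries of the
          second list may be.\<close>
        have "real n * (K / real n ^ 4) \<le> K / real n"
        proof -
          have "real n * (K / real n ^ 4) = K / real n ^ 3" using n1 by (simp add: field_simps eval_nat_numeral)
          also have "\<dots> \<le> K / real n ^ 1"
            using n1 K by (intro divide_left_mono power_increasing) auto
          finally show ?thesis by simp
        qed
        then have "real l * b * (real n * (K / real n ^ 4)) \<le> real l * b * (K / real n)"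
          using b by (intro mult_left_mono) auto
        then show "real (length Us) * (b * (K / real n ^ 4)) \<le> real l * (b * (K / real n))"
          by (simp add: W(2) mult_ac)
      qed (simp add: W(3))
      also have "\<dots> = Ka / real n * b" by (simp add: Ka_def algebra_simps add_divide_distrib)
      finally show ?thesis .
    qed
    have "fingerprint X le n calT g C"
      unfolding fingerprint_def
    proof (intro conjI ballI)
      fix T assume "T \<in> calT"
      then obtain I where I: "I \<in> indep_sets X le n" "T = g I" by (auto simp: calT_def)
      have "\<forall>i<length T. T ! i \<subseteq> boolean_lattice n"
      proof (intro allI impI)
        fix i assume "i < length T"
        then have "T ! i \<subseteq> vec_union (g I)" unfolding vec_union_def I(2) by (intro Union_upper nth_mem)
        then show "T ! i \<subseteq> boolean_lattice n" using unionI[OF I(1)] IB[OF I(1)] by (auto simp: boolean_lattice_def)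
      qed
      then show "disj_vector n T" using enc_disj unfolding disj_vector_def I(2) g_def by blast
      show "C T \<subseteq> boolean_lattice n" using C2(1) VB unfolding C_def boolean_lattice_def by blast
    next
      fix I assume I: "I \<in> indep_sets X le n"
      show "g I \<in> calT" using I by (simp add: calT_def)
      show "vec_union (g I) \<subseteq> I" by (rule unionI[OF I])
      have "I \<inter> V \<subseteq> C2 (take (n * l) (tup I)) (drop (n * l) (tup I))"
      proof -
        obtain Us Ts where W: "tup I = Us @ Ts" "cond I Us Ts" using tup[OF I] unfolding good_def by blast
        then show ?thesis by (simp add: cond_def)
      qed
      then show "I \<subseteq> C (g I)" using IB[OF I] by (auto simp: C_def dec[OF I])
    qed
    moreover have "finite calT"
      unfolding calT_def by (rule finite_imageI, rule finite_subset[of _ "Pow (Pow {1..n})"]) (use IB in auto)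
    moreover have "real (card (vec_union T)) \<le> Kf / real n * b" if T: "T \<in> calT" for T
    proof -
      obtain I where I: "I \<in> indep_sets X le n" "T = g I" using T by (auto simp: calT_def)
      have "real (card (vec_union T)) \<le> Ka / real n * b" using size[OF I(1)] I(2) by simp
      also have "\<dots> \<le> Kf / real n * b" using Kf b by (intro mult_right_mono divide_right_mono) auto
      finally show ?thesis .
    qed
    moreover have "real (card {T \<in> calT. card (vec_union T) = s}) \<le> (Kf * b / real s) ^ s * exp (Kf / real n * b)" for s
    \<comment> \<open>An empty class needs only a nonnegative right side; a nonempty one supplies a
      fingerprint, and with it an upper bound on \<open>s\<close>.\<close>
    proof (cases "{T \<in> calT. card (vec_union T) = s} = {}")
      case True
      show ?thesis unfolding True using Kf b by simp
    next
      case False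
      then obtain T0 where T0: "T0 \<in> calT" "card (vec_union T0) = s" by blast
      obtain I0 where I0: "I0 \<in> indep_sets X le n" "T0 = g I0" using T0 by (auto simp: calT_def)
      \<comment> \<open>The binomial bound needs a parameter that dominates both the ground set and
        \<open>s\<close>; the requirement \<open>Ka / \<theta> \<le> n\<close> makes
        \<open>\<theta> * b\<close> such a parameter.\<close>
      have s\<theta>: "real s \<le> \<theta> * b"
      proof -
        have "real s \<le> Ka / real n * b" using size[OF I0(1)] T0(2) I0(2) by simp
        also have "\<dots> \<le> \<theta> * b"
        proof (rule mult_right_mono[OF _ b])
          have "Ka / \<theta> \<le> real n" using n(3) by linarith
          then show "Ka / real n \<le> \<theta>" using \<theta> n1 by (simp add: field_simps)
        qed
        finally show ?thesis .
      qed
      define x where "x = b * (K / real n ^ 4)"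
      have x0: "0 \<le> x" using b K by (simp add: x_def)
      define A where "A = {Us. set Us \<subseteq> {U. U \<subseteq> Pow {1..n} \<and> card U \<le> nat \<lfloor>x\<rfloor>} \<and> length Us = n * l}"
      note A = card_lists_small_members[OF x0, of n "n * l", folded A_def]
      \<comment> \<open>The union of \<open>Ts\<close> is part of the fingerprint, so it has at most
        \<open>s\<close> elements, all taken from \<open>C1 Us\<close>, which has at most
        \<open>\<theta> * b\<close>. This yields the base \<open>Kd * b / s\<close>.\<close>
      define B where "B Us = {Ts. length Ts = m \<and> (\<forall>T\<in>set Ts. T \<subseteq> C1 Us) \<and> card (\<Union> (set Ts)) \<le> s}" for Us
      have B: "finite (B Us) \<and> real (card (B Us)) \<le> (Kd * b / real s) ^ s" for Us
      proof -
        have CB: "C1 Us \<subseteq> Pow {1..n}" using C1(1) VB by blast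
        then have fin: "finite (C1 Us)" by (rule finite_subset) simp
        have "real (card (C1 Us)) \<le> b * sum p (C1 Us)" by (rule card_le[OF CB])
        also have "\<dots> \<le> \<theta> * b" using mult_left_mono[OF C1(2)[of Us] b] by (simp add: mult.commute)
        finally have "real (card (C1 Us)) \<le> \<theta> * b" .
        from card_lists_small_union_real[OF fin this s\<theta>, of m] card_lists_small_union(1)[OF fin, of m s]
        show ?thesis by (simp add: B_def Kd_def mult.assoc)
      qed
      have "{T \<in> calT. card (vec_union T) = s} \<subseteq> (\<lambda>(Us, Ts). enc (Us @ Ts)) ` (SIGMA Us:A. B Us)"
      proof
        fix T assume "T \<in> {T \<in> calT. card (vec_union T) = s}"
        then obtain I where I: "I \<in> indep_sets X le n" "T = g I" "card (vec_union (g I)) = s" by (auto simp: calT_def)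
        obtain Us Ts where W: "tup I = Us @ Ts" "length Us = n * l" "length Ts = m"
        "\<forall>T\<in>set Us. T \<subseteq> I \<inter> V \<and> sum p T \<le> K / real n ^ 4" "\<forall>T\<in>set Ts. T \<subseteq> I \<inter> C1 Us \<and> sum p T \<le> K / real n"
          using tup[OF I(1)] unfolding good_def cond_def by (elim exE conjE)
        have "U \<subseteq> Pow {1..n} \<and> card U \<le> nat \<lfloor>x\<rfloor>" if U: "U \<in> set Us" for U
        proof
          show UB: "U \<subseteq> Pow {1..n}" using W(4) U IB[OF I(1)] by blast
          have "real (card U) \<le> b * sum p U" by (rule card_le[OF UB])
          also have "\<dots> \<le> x" unfolding x_def using W(4) U b by (intro mult_left_mono) auto
          finally show "card U \<le> nat \<lfloor>x\<rfloor>" by (rule le_nat_floor)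
        qed
        then have UA: "Us \<in> A" using W(2) by (auto simp: A_def)
        have sub: "\<Union> (set Ts) \<subseteq> vec_union (g I)" unfolding union[OF I(1)] W(1) by auto
        have "vec_union (g I) \<subseteq> Pow {1..n}" using unionI[OF I(1)] IB[OF I(1)] by blast
        then have "finite (vec_union (g I))" by (rule finite_subset) simp
        then have "card (\<Union> (set Ts)) \<le> s" using card_mono[OF _ sub] I(3) by simp
        then have "Ts \<in> B Us" using W(3,5) by (auto simp: B_def)
        then have "(Us, Ts) \<in> (SIGMA Us:A. B Us)" using UA by blast
        moreover have "T = enc (Us @ Ts)" using I(2) W(1) by (simp add: g_def)
        ultimately show "T \<in> (\<lambda>(Us, Ts). enc (Us @ Ts)) ` (SIGMA Us:A. B Us)" by (intro image_eqI[of _ _ "(Us, Ts)"]) auto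
      qed
      from sum_card_bounded_lists[OF A(1) B this]
      have "real (card {T \<in> calT. card (vec_union T) = s}) \<le> real (card A) * (Kd * b / real s) ^ s" .
      also have "\<dots> \<le> exp (Kf / real n * b) * (Kf * b / real s) ^ s"
      proof (intro mult_mono power_mono divide_right_mono mult_right_mono)
        \<comment> \<open>Up to constants the exponent is \<open>b / n ^ 2\<close>, so the bound by
          \<open>Kc / n * b\<close> leaves a factor of order \<open>n\<close> to spare.\<close>
        have "(real n + 1) * x * real (n * l) \<le> Kc / real n * b"
        proof -
          have "(real n + 1) * real n \<le> 2 * real n * real n"
            using n1 by (intro mult_right_mono) auto
          also have "\<dots> = 2 * real n ^ 2" by (simp add: power2_eq_square)
          also have "\<dots> \<le> 2 * real n ^ 3" using n1 by (intro mult_left_mono power_increasing) auto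
          finally have "(real n + 1) * real n * (K / real n ^ 4 * (real l * b)) \<le> 2 * real n ^ 3 * (K / real n ^ 4 * (real l * b))"
            using K b by (intro mult_right_mono) auto
          also have "\<dots> = Kc / real n * b" using n1 by (simp add: Kc_def field_simps eval_nat_numeral)
          finally show ?thesis by (simp add: x_def mult_ac)
        qed
        also have "\<dots> \<le> Kf / real n * b" using Kf b by (intro mult_right_mono divide_right_mono) auto
        finally show "real (card A) \<le> exp (Kf / real n * b)" by (intro order_trans[OF A(2)]) simp
      qed (use Kf b nonneg in auto)
      finally show ?thesis by (simp add: mult.commute)
    qed
    moreover have "real (card (C (g I))) \<le> (real k - 1 + \<epsilon>) * b" if I: "I \<in> indep_sets X le n" for I
    proof -
      let ?C2 = "C2 (take (n * l) (dec (g I))) (drop (n * l) (dec (g I)))"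
      have "real (card (C (g I))) \<le> real (card ?C2) + real (card (Pow {1..n} - V))"
        unfolding C_def using card_Un_le[of ?C2 "Pow {1..n} - V"] by linarith
      also have "\<dots> \<le> (real (k - 1) + \<epsilon> / 2) * b + \<epsilon> / 2 * b"
      proof (intro add_mono out)
        have "?C2 \<subseteq> Pow {1..n}" using C2(1) VB by blast
        then have "real (card ?C2) \<le> b * sum p ?C2" by (rule card_le)
        also have "\<dots> \<le> b * (real (k - 1) + \<epsilon> / 2)" using C2(2) b by (intro mult_left_mono)
        finally show "real (card ?C2) \<le> (real (k - 1) + \<epsilon> / 2) * b" by (simp add: mult.commute)
      qed
      also have "\<dots> = (real k - 1 + \<epsilon>) * b" using assms(3) by (simp add: of_nat_diff algebra_simps)
      finally show ?thesis .
    qed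
    ultimately show "\<exists>calT g C. fingerprint X le n calT g C \<and> finite calT \<and>
       (\<forall>T\<in>calT. real (card (vec_union T)) \<le> Kf / real n * real (n choose (n div 2))) \<and>
       (\<forall>s::nat. real (card {T\<in>calT. card (vec_union T) = s})
          \<le> (Kf * real (n choose (n div 2)) / real s) ^ s
             * exp (Kf / real n * real (n choose (n div 2)))) \<and>
       (\<forall>I\<in>indep_sets X le n.
          real (card (C (g I))) \<le> (real k - 1 + \<epsilon>) * real (n choose (n div 2)))"
      unfolding b_def[symmetric] by blast
  qed
qed

end
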